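(* Let $t_*\in\mathbb V$ be a zero of the CC mapping $\mathcal A:\mathbb V\to\mathbb V^*$. Then $t_*$ is non-degenerate (i.e. $\mathcal A'(t_* )$ is invertible) if and only if $\mathcal E_{\mathrm{CC}}(t_* )\notin\sigma(\widehat{\mathcal H_K}(t_* )_{\mathfrak V})$. In this case $t_*$ is an isolated zero, and the topological index of $\mathcal A$ at $t_*$ is $$i(\mathcal A,t_* )=(-1)^{\nu},\qquad \nu=\big|\{j:\ \mathcal E_j(\widehat{\mathcal H_K}(t_* )_{\mathfrak V})\in\mathbb R,\ \mathcal E_j(\widehat{\mathcal H_K}(t_* )_{\mathfrak V})<\mathcal E_{\mathrm{CC}}(t_* )\}\big|.$$
   Context: Setting. Fix $1\le N\le K<\infty$. Let $\mathfrak L^2=\bigwedge^N L^2(\mathbb R^3)$ with inner product $\langle\cdot,\cdot\rangle$, $\mathfrak H^1=\mathfrak L^2\cap H^1(\mathbb R^{3N})$. Let $\phi_1,\dots,\phi_K\in H^1(\mathbb R^3)$ be $L^2$-orthonormal; $\phi_1,\dots,\phi_N$ are called occupied, the others virtual. For a multiindex $\alpha=(\alpha_1<\dots<\alpha_N)$ in $\{1,\dots,K\}$, $\Phi_\alpha=\phi_{\alpha_1}\wedge\dots\wedge\phi_{\alpha_N}$ is the ($\mathfrak L^2$-normalized) Slater determinant; these form an orthonormal basis of $\mathfrak H^1_K:=\mathrm{Span}\{\Phi_\alpha\}$. The index $0$ means $(1,\dots,N)$, and $\Phi_0=\phi_1\wedge\dots\wedge\phi_N$ is the reference. The Hamiltonian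 is $\mathcal H=\sum_i[-\tfrac12\Delta_{x_i}+V(x_i)]+\sum_{i<j}w(x_i-x_j)$ with real-valued $V,w\in L^{3/2}(\mathbb R^3)+L^\infty_\varepsilon(\mathbb R^3)$ (the $L^\infty$ part can be chosen arbitrarily small), $w$ even; $\mathcal H_K:\mathfrak H^1_K\to(\mathfrak H^1_K)^*$ is defined by $\langle\mathcal H_K\Phi,\Psi\rangle=\langle\mathcal H\Phi,\Psi\rangle$ (in the form sense) and is regarded as an operator on $\mathfrak H_K^1$ via $\langle\cdot,\cdot\rangle$. Everything is over $\mathbb R$ (the matrix elements $\langle\mathcal H_K\Phi_\alpha,\Phi_\beta\rangle$ are real). Excitation and cluster operators. The rank of $\alpha$ is its number of virtual indices. For $\alpha\ne0$ with virtual indices $A_1<\dots<A_r$ and with $I_1<\dots<I_r$ the occupied indices missing from $\alpha$, $X_\alpha=a_{A_1}^\dagger a_{I_1}\cdots a_{A_r}^\dagger a_{I_r}$, where $a_p^\dagger,a_p$ are the fermionic creation/annihilation operators of $\phi_p$; the sign of $\Phi_\alpha$ is chosen so that $\Phi_\alpha=X_\alpha\Phi_0$. Amplitude space. Let $\Xi$ be the set of (nonzero) excitation multiindices retained by the truncation, $\Xi^c$ the set of nonzero multiindices not in $\Xi$. $\mathbb V=\{t=(t_\alpha)_{\alpha\in\Xi}:t_\alpha\in\mathbb R\}$; the cluster operator of $t$ is $T=\sum_{\alpha\in\Xi}t_\alpha X_\alpha$ (capital letters denote the cluster operators of the corresponding lower-case amplitudes); $\langle t,s\rangle_{\mathbb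 V}=\langle T\Phi_0,S\Phi_0\rangle_{\mathfrak H^1}$; $\mathfrak V=\{T\Phi_0:t\in\mathbb V\}$. CC objects. $\mathcal H_K(t)=e^{-T}\mathcal H_Ke^T$; $\mathcal A:\mathbb V\to\mathbb V^*$, $\langle\mathcal A(t),s\rangle=\langle\mathcal H_K(t)\Phi_0,S\Phi_0\rangle$ for all $s\in\mathbb V$; $\mathcal E_{\mathrm{CC}}(t)=\langle\mathcal H_K(t)\Phi_0,\Phi_0\rangle$; $\widehat{\mathcal H_K}(t)=\mathcal H_K(t)-\sum_{\alpha\in\Xi^c}\langle\mathcal H_K(t)\Phi_0,\Phi_\alpha\rangle X_\alpha$. For an operator $\mathcal T$ on $\mathfrak H^1_K$, $\mathcal T_{\mathfrak V}:\mathfrak V\to\mathfrak V$ is defined by $\langle\mathcal T_{\mathfrak V}\Psi,\Psi'\rangle=\langle\mathcal T\Psi,\Psi'\rangle$ for $\Psi,\Psi'\in\mathfrak V$. $\mathcal E_j(\cdot)$ denote the (complex) eigenvalues, listed with algebraic multiplicity. Index. For an isolated zero $u$, $i(\mathcal A,u)=\deg(\mathcal A,B(u,r),0)$ (Brouwer degree, $r>0$ small), where $\mathbb V,\mathbb V^*$ are identified with $\mathbb R^n$ compatibly oriented (the dual basis of a positive basis is positive). *)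

theory Defs
  imports
    "HOL-Analysis.Analysis"
    "HOL-Homology.Homology"
    "Jordan_Normal_Form.Spectral_Radius"
begin

primrec Ck :: "nat \<Rightarrow> ('a::euclidean_space \<Rightarrow> real) \<Rightarrow> bool" where
  "Ck 0 f \<longleftrightarrow> continuous_on UNIV f"
| "Ck (Suc k) f \<longleftrightarrow>
     (\<forall>x. f differentiable (at x)) \<and> (\<forall>b\<in>Basis. Ck k (\<lambda>x. frechet_derivative f (at x) b))"

definition test_function :: "('a::euclidean_space \<Rightarrow> real) \<Rightarrow> bool" where
  "test_function \<eta> \<longleftrightarrow> (\<forall>k. Ck k \<eta>) \<and> compact (closure {x. \<eta> x \<noteq> 0})"

definition L2_fun :: "('a::euclidean_space \<Rightarrow> real) \<Rightarrow> bool" where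
  "L2_fun f \<longleftrightarrow> f \<in> borel_measurable borel \<and> integrable lborel (\<lambda>x. (f x)\<^sup>2)"

definition L2_inner :: "('a::euclidean_space \<Rightarrow> real) \<Rightarrow> ('a \<Rightarrow> real) \<Rightarrow> real" where
  "L2_inner f g = (\<integral>x. f x * g x \<partial>lborel)"

definition has_weak_derivative ::
    "'a::euclidean_space \<Rightarrow> ('a \<Rightarrow> real) \<Rightarrow> ('a \<Rightarrow> real) \<Rightarrow> bool" where
  "has_weak_derivative b f g \<longleftrightarrow> L2_fun g \<and>
     (\<forall>\<eta>. test_function \<eta> \<longrightarrow>
        L2_inner f (\<lambda>x. frechet_derivative \<eta> (at x) b) = - L2_inner g \<eta>)"

text \<open>Unique up to null sets, so that integrals of it do not depend on the choice.\<close>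

definition weak_derivative :: "'a::euclidean_space \<Rightarrow> ('a \<Rightarrow> real) \<Rightarrow> 'a \<Rightarrow> real" where
  "weak_derivative b f = (SOME g. has_weak_derivative b f g)"

definition H1_fun :: "('a::euclidean_space \<Rightarrow> real) \<Rightarrow> bool" where
  "H1_fun f \<longleftrightarrow> L2_fun f \<and> (\<forall>b\<in>Basis. \<exists>g. has_weak_derivative b f g)"

text \<open>The class \<open>L\<^sup>3\<^sup>/\<^sup>2 + L\<^sup>\<infinity>\<close> on three-dimensional space, with arbitrarily small bounded part.\<close>

definition admissible_potential :: "(real^3 \<Rightarrow> real) \<Rightarrow> bool" where
  "admissible_potential V \<longleftrightarrow>
     (\<forall>\<epsilon>>0. \<exists>V1 V2. V1 \<in> borel_measurable borel \<and> V2 \<in> borel_measurable borel \<and>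
        V = (\<lambda>x. V1 x + V2 x) \<and>
        integrable lborel (\<lambda>x. \<bar>V1 x\<bar> powr (3/2)) \<and> (AE x in lborel. \<bar>V2 x\<bar> \<le> \<epsilon>))"

text \<open>
  Particles are labelled by a finite linearly ordered type \<open>'n\<close>, so that \<open>N = CARD('n)\<close> and the
  configuration space is \<open>(real^3)^'n\<close>. A multiindex \<open>\<alpha>\<^sub>1 < \<dots> < \<alpha>\<^sub>N\<close> is encoded by the set of its
  entries; the index \<open>0\<close> is \<open>{1..N}\<close>.
\<close>

type_synonym 'n config = "(real^3, 'n) Finite_Cartesian_Product.vec"

definition multiindex_entry :: "nat set \<Rightarrow> 'n::{finite,linorder} \<Rightarrow> nat" where
  "multiindex_entry \<alpha> i = sorted_list_of_set \<alpha> ! card {j. j < i}"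

definition slater ::
    "(nat \<Rightarrow> real^3 \<Rightarrow> real) \<Rightarrow> nat set \<Rightarrow> 'n::{finite,linorder} config \<Rightarrow> real" where
  "slater \<phi> \<alpha> x =
     Determinants.det (\<chi> i j. \<phi> (multiindex_entry \<alpha> i) (vec_nth x j))
       / sqrt (fact CARD('n))"

text \<open>Since the directions in \<open>Basis\<close> are all coordinates of all particles, the first term is the
  quadratic form of \<open>- \<Delta> / 2\<close> summed over the particles.\<close>

definition hamiltonian_form ::
    "(real^3 \<Rightarrow> real) \<Rightarrow> (real^3 \<Rightarrow> real) \<Rightarrow>
     ('n::{finite,linorder} config \<Rightarrow> real) \<Rightarrow> ('n config \<Rightarrow> real) \<Rightarrow> real" where
  "hamiltonian_form V w f g =
     (1/2) * (\<Sum>b\<in>Basis. L2_inner (weak_derivative b f) (weak_derivative b g))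
     + (\<Sum>i\<in>UNIV. \<integral>x. V (vec_nth x i) * f x * g x \<partial>lborel)
     + (\<Sum>(i,j)\<in>{(i,j). i < j}. \<integral>x. w (vec_nth x i - vec_nth x j) * f x * g x \<partial>lborel)"

text \<open>
  A vector of the fermionic Fock space over the orbitals is given by its coefficients \<open>c S\<close> with
  respect to the increasingly ordered wedge products of the orbitals \<open>\<phi>\<^sub>p\<close>, \<open>p \<in> S\<close>.
  The signs are those of \<open>a\<^sub>p\<^sup>\<dagger>\<close> being the wedge product by \<open>\<phi>\<^sub>p\<close> from the left.
\<close>

type_synonym fock = "nat set \<Rightarrow> real"
type_synonym amplitudes = "nat set \<Rightarrow> real"

definition ket :: "nat set \<Rightarrow> fock" where
  "ket S = (\<lambda>S'. if S' = S then 1 else 0)"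

definition create :: "nat \<Rightarrow> fock \<Rightarrow> fock" where
  "create p c = (\<lambda>S. if p \<in> S then (-1) ^ card {q\<in>S. q < p} * c (S - {p}) else 0)"

definition annihilate :: "nat \<Rightarrow> fock \<Rightarrow> fock" where
  "annihilate p c = (\<lambda>S. if p \<in> S then 0 else (-1) ^ card {q\<in>S. q < p} * c (insert p S))"

definition excitation :: "nat \<Rightarrow> nat set \<Rightarrow> fock \<Rightarrow> fock" where
  "excitation N \<alpha> c =
     foldr (\<lambda>(A, I) v. create A (annihilate I v))
       (zip (sorted_list_of_set (\<alpha> - {1..N})) (sorted_list_of_set ({1..N} - \<alpha>))) c"

text \<open>The exponential series of an operator; it is used for nilpotent operators only.\<close>

definition op_exp :: "(fock \<Rightarrow> fock) \<Rightarrow> fock \<Rightarrow> fock" where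
  "op_exp T c = (\<lambda>S. suminf (\<lambda>k. (T ^^ k) c S / fact k))"

text \<open>
  Points of \<open>n\<close>-dimensional space are sequences vanishing from index \<open>n\<close> on, as in
  \<^const>\<open>Euclidean_space\<close>. For \<open>n \<ge> 1\<close>, the Brouwer degree of \<open>F\<close> on the ball of radius \<open>r\<close> at \<open>u\<close>
  with respect to \<open>0\<close> is the degree of the self-map
  \<open>x \<mapsto> F (u + r x) / |F (u + r x)|\<close> of the unit sphere; on the one-point space it is \<open>1\<close>.
\<close>

definition ball_degree ::
    "nat \<Rightarrow> ((nat \<Rightarrow> real) \<Rightarrow> nat \<Rightarrow> real) \<Rightarrow> (nat \<Rightarrow> real) \<Rightarrow> real \<Rightarrow> int" where
  "ball_degree n F u r =
     (if n = 0 then 1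
      else Brouwer_degree2 (n - 1)
        (\<lambda>x i. F (\<lambda>j. u j + r * x j) i / L2_set (F (\<lambda>j. u j + r * x j)) {..<n}))"

definition zero_index :: "nat \<Rightarrow> ((nat \<Rightarrow> real) \<Rightarrow> nat \<Rightarrow> real) \<Rightarrow> (nat \<Rightarrow> real) \<Rightarrow> int" where
  "zero_index n F u = (THE d. \<exists>r0>0. \<forall>r. 0 < r \<and> r < r0 \<longrightarrow> ball_degree n F u r = d)"

locale coupled_cluster =
  fixes particles :: "'n::{finite,linorder} itself"
    and K :: nat
    and \<phi> :: "nat \<Rightarrow> real^3 \<Rightarrow> real"
    and V w :: "real^3 \<Rightarrow> real"
    and \<Xi> :: "nat set set"
  assumes N_le_K: "CARD('n) \<le> K"
    and orbitals_H1: "\<And>p. p \<in> {1..K} \<Longrightarrow> H1_fun (\<phi> p)"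
    and orbitals_orthonormal:
      "\<And>p q. p \<in> {1..K} \<Longrightarrow> q \<in> {1..K} \<Longrightarrow> L2_inner (\<phi> p) (\<phi> q) = (if p = q then 1 else 0)"
    and V_admissible: "admissible_potential V"
    and w_admissible: "admissible_potential w"
    and w_even: "AE x in lborel. w (- x) = w x"
    and \<Xi>_excitations: "\<Xi> \<subseteq> {\<alpha>. \<alpha> \<subseteq> {1..K} \<and> card \<alpha> = CARD('n)} - {{1..CARD('n)}}"
begin

definition multiindices :: "nat set set" where
  "multiindices = {\<alpha>. \<alpha> \<subseteq> {1..K} \<and> card \<alpha> = CARD('n)}"

text \<open>The element of \<open>H\<^sup>1\<^sub>K\<close> with coefficients \<open>c\<close>, as a function on configuration space.\<close>

definition wavefun :: "fock \<Rightarrow> 'n config \<Rightarrow> real" where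
  "wavefun c x = (\<Sum>\<alpha>\<in>multiindices. c \<alpha> * slater \<phi> \<alpha> x)"

definition ip :: "fock \<Rightarrow> fock \<Rightarrow> real" where
  "ip c d = L2_inner (wavefun c) (wavefun d)"

text \<open>The linear operator on \<open>H\<^sup>1\<^sub>K\<close> whose matrix elements in the orthonormal basis of Slater
  determinants are those of the Hamiltonian form.\<close>

definition H_op :: "fock \<Rightarrow> fock" where
  "H_op c = (\<lambda>\<beta>. if \<beta> \<in> multiindices
     then \<Sum>\<alpha>\<in>multiindices. c \<alpha> *
        hamiltonian_form V w (slater \<phi> \<alpha> :: 'n config \<Rightarrow> real) (slater \<phi> \<beta>)
     else 0)"

definition \<Phi>0 :: fock where
  "\<Phi>0 = ket {1..CARD('n)}"

definition X :: "nat set \<Rightarrow> fock \<Rightarrow> fock" where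
  "X \<alpha> = excitation CARD('n) \<alpha>"

text \<open>This fixes the sign of the determinants; it may differ from \<^term>\<open>ket \<alpha>\<close> by a sign.\<close>

definition \<Phi> :: "nat set \<Rightarrow> fock" where
  "\<Phi> \<alpha> = X \<alpha> \<Phi>0"

definition amplitude_space :: "amplitudes set" where
  "amplitude_space = {t. \<forall>\<alpha>. \<alpha> \<notin> \<Xi> \<longrightarrow> t \<alpha> = 0}"

definition cluster :: "amplitudes \<Rightarrow> fock \<Rightarrow> fock" where
  "cluster t c = (\<lambda>S. \<Sum>\<alpha>\<in>\<Xi>. t \<alpha> * X \<alpha> c S)"

definition H_sim :: "amplitudes \<Rightarrow> fock \<Rightarrow> fock" where
  "H_sim t c = op_exp (\<lambda>v S. - cluster t v S) (H_op (op_exp (cluster t) c))"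

text \<open>The CC mapping; its values are linear functionals \<open>s \<mapsto> cc_map t s\<close> on the amplitude space.\<close>

definition cc_map :: "amplitudes \<Rightarrow> amplitudes \<Rightarrow> real" where
  "cc_map t s = ip (H_sim t \<Phi>0) (cluster s \<Phi>0)"

definition cc_energy :: "amplitudes \<Rightarrow> real" where
  "cc_energy t = ip (H_sim t \<Phi>0) \<Phi>0"

definition H_hat :: "amplitudes \<Rightarrow> fock \<Rightarrow> fock" where
  "H_hat t c = (\<lambda>S. H_sim t c S -
     (\<Sum>\<alpha>\<in>multiindices - {{1..CARD('n)}} - \<Xi>. ip (H_sim t \<Phi>0) (\<Phi> \<alpha>) * X \<alpha> c S))"

definition cluster_states :: "fock set" where
  "cluster_states = {cluster t \<Phi>0 | t. t \<in> amplitude_space}"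

definition compression :: "(fock \<Rightarrow> fock) \<Rightarrow> fock \<Rightarrow> fock" where
  "compression T \<psi> = (THE \<xi>. \<xi> \<in> cluster_states \<and> (\<forall>\<psi>'\<in>cluster_states. ip \<xi> \<psi>' = ip (T \<psi>) \<psi>'))"

text \<open>The complexified matrix of the compression of \<open>T\<close> in the orthonormal basis
  \<open>\<Phi> (e 0), \<Phi> (e 1), \<dots>\<close> of \<^term>\<open>cluster_states\<close>, where \<open>e\<close> enumerates \<open>\<Xi>\<close>.\<close>

definition compression_matrix :: "(nat \<Rightarrow> nat set) \<Rightarrow> (fock \<Rightarrow> fock) \<Rightarrow> complex mat" where
  "compression_matrix e T =
     Matrix.mat (card \<Xi>) (card \<Xi>) (\<lambda>(i, j). complex_of_real (ip (compression T (\<Phi> (e j))) (\<Phi> (e i))))"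

definition cc_zero :: "amplitudes \<Rightarrow> bool" where
  "cc_zero t \<longleftrightarrow> (\<forall>s\<in>amplitude_space. cc_map t s = 0)"

definition linear_functional :: "(amplitudes \<Rightarrow> real) \<Rightarrow> bool" where
  "linear_functional f \<longleftrightarrow>
     (\<forall>s\<in>amplitude_space. \<forall>s'\<in>amplitude_space. \<forall>a b.
        f (\<lambda>\<alpha>. a * s \<alpha> + b * s' \<alpha>) = a * f s + b * f s')"

text \<open>Frechet derivative of the CC mapping at \<open>t\<close>, as a linear map \<open>h \<mapsto> L h\<close> from the amplitude
  space to its dual. As the space is finite-dimensional, any norm may be used.\<close>

definition cc_has_derivative :: "amplitudes \<Rightarrow> (amplitudes \<Rightarrow> amplitudes \<Rightarrow> real) \<Rightarrow> bool" where
  "cc_has_derivative t L \<longleftrightarrow>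
     (\<forall>h\<in>amplitude_space. linear_functional (L h)) \<and>
     (\<forall>s\<in>amplitude_space. linear_functional (\<lambda>h. L h s)) \<and>
     (\<forall>\<epsilon>>0. \<exists>\<delta>>0. \<forall>h\<in>amplitude_space. L2_set h \<Xi> < \<delta> \<longrightarrow>
        (\<forall>s\<in>amplitude_space.
           \<bar>cc_map (\<lambda>\<alpha>. t \<alpha> + h \<alpha>) s - cc_map t s - L h s\<bar> \<le> \<epsilon> * L2_set h \<Xi> * L2_set s \<Xi>))"

definition cc_nondegenerate :: "amplitudes \<Rightarrow> bool" where
  "cc_nondegenerate t \<longleftrightarrow>
     (\<exists>L. cc_has_derivative t L \<and>
        (\<forall>f. linear_functional f \<longrightarrow>
           (\<exists>!h. h \<in> amplitude_space \<and> (\<forall>s\<in>amplitude_space. L h s = f s))))"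

definition cc_isolated_zero :: "amplitudes \<Rightarrow> bool" where
  "cc_isolated_zero t \<longleftrightarrow> t \<in> amplitude_space \<and> cc_zero t \<and>
     (\<exists>r>0. \<forall>u\<in>amplitude_space. L2_set (\<lambda>\<alpha>. u \<alpha> - t \<alpha>) \<Xi> < r \<and> cc_zero u \<longrightarrow> u = t)"

text \<open>An enumeration \<open>e\<close> of \<open>\<Xi>\<close> gives coordinates on the amplitude space with respect to
  the basis \<^term>\<open>ket (e 0)\<close>, \<^term>\<open>ket (e 1)\<close>, etc., and on its dual with respect to the dual basis.\<close>

definition amplitudes_of :: "(nat \<Rightarrow> nat set) \<Rightarrow> (nat \<Rightarrow> real) \<Rightarrow> amplitudes" where
  "amplitudes_of e x = (\<lambda>\<alpha>. \<Sum>i<card \<Xi>. x i * ket (e i) \<alpha>)"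

definition coords_of :: "(nat \<Rightarrow> nat set) \<Rightarrow> amplitudes \<Rightarrow> nat \<Rightarrow> real" where
  "coords_of e t = (\<lambda>i. if i < card \<Xi> then t (e i) else 0)"

definition cc_map_coords :: "(nat \<Rightarrow> nat set) \<Rightarrow> (nat \<Rightarrow> real) \<Rightarrow> nat \<Rightarrow> real" where
  "cc_map_coords e x = (\<lambda>i. if i < card \<Xi> then cc_map (amplitudes_of e x) (ket (e i)) else 0)"

definition cc_index :: "(nat \<Rightarrow> nat set) \<Rightarrow> amplitudes \<Rightarrow> int" where
  "cc_index e t = zero_index (card \<Xi>) (cc_map_coords e) (coords_of e t)"

end

text \<open>\<^const>\<open>proots\<close> is a multiset, so eigenvalues count with algebraic multiplicity.\<close>

definition count_real_eigenvalues_below :: "complex mat \<Rightarrow> real \<Rightarrow> nat" where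
  "count_real_eigenvalues_below M E =
     size (filter_mset (\<lambda>z. z \<in> \<real> \<and> Re z < E) (proots (char_poly M)))"

end

theory Submission
  imports Defs
begin

text \<open>
  Excitation operators create virtual orbitals and annihilate occupied ones, so they commute with each
  other and every cluster operator is nilpotent. Its exponential is therefore a finite sum, exponents
  add, and with \<open>G = H_sim t\<close> one has \<open>H_sim (t + h) = exp (-H) G exp H\<close>, where \<open>H\<close> is the cluster
  operator of \<open>h\<close>. To first order this is \<open>G + (G H - H G)\<close>, with a remainder that is quadratic in
  \<open>h\<close>; hence the derivative of the CC mapping at \<open>t\<close> is \<open>h \<mapsto> \<langle>(G H - H G) \<Phi>0, \<cdot>\<rangle>\<close>.

  Let \<open>t\<close> be a zero, \<open>E\<close> its energy. The vector \<open>G \<Phi>0\<close> has no component in the direction of \<open>\<Phi> \<alpha>\<close> for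
  \<open>\<alpha> \<in> \<Xi>\<close>, so that \<open>G \<Phi>0 = E \<Phi>0 + \<Sum> c \<gamma> \<Phi> \<gamma>\<close> with \<open>\<gamma>\<close> ranging over \<open>\<Xi>\<^sup>c\<close>. As excitations commute,
  \<open>X \<alpha> (\<Phi> \<gamma>) = X \<gamma> (\<Phi> \<alpha>)\<close>, and \<open>(G X \<alpha> - X \<alpha> G) \<Phi>0\<close> becomes \<open>(H_hat t - E) (\<Phi> \<alpha>)\<close>. Thus the
  Jacobian matrix of the CC mapping at \<open>t\<close> is \<open>M - E\<close>, where \<open>M\<close> is the matrix of the compression of
  \<open>H_hat t\<close> (\<open>cc_derivative_at_zero\<close>). This is the criterion for non-degeneracy, because derivatives
  are unique.

  If \<open>D = M - E\<close> is invertible, then on small spheres the straight homotopy from the CC mapping to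
  \<open>D\<close> has no zeros: \<open>|D h|\<close> is at least a multiple of \<open>|h|\<close>, the error at most a multiple of \<open>|h|\<^sup>2\<close>. So the
  zero is isolated, and its index is the degree of \<open>x \<mapsto> D x / |D x|\<close>. That degree is the sign of
  \<open>det D\<close> (\<open>linear_degree_eq_sgn_det\<close>): by elimination \<open>D\<close> is a product of matrices that differ from
  the identity in one column, and such a matrix can be deformed to the identity or to a reflection.
  Finally \<open>det (M - E)\<close> is the product of \<open>z - E\<close> over the eigenvalues \<open>z\<close>. Non-real eigenvalues come in
  conjugate pairs with positive contribution, so the sign is the parity of the number of real
  eigenvalues below \<open>E\<close>.

  The analytic input is the orthonormality of Slater determinants, a consequence of Fubini's theorem.
  It reduces \<open>ip\<close> to the sum of products of coefficients. The Hamiltonian then enters as a matrix only.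
\<close>

section \<open>Degree of the radial normalization of a linear map\<close>

definition unit_sphere :: "nat \<Rightarrow> (nat \<Rightarrow> real) set" where
  "unit_sphere n = {x. L2_set x {..<n} = 1 \<and> (\<forall>i\<ge>n. x i = 0)}"

definition normalized :: "nat \<Rightarrow> (nat \<Rightarrow> real) \<Rightarrow> nat \<Rightarrow> real" where
  "normalized n y = (\<lambda>i. y i / L2_set y {..<n})"

lemma nsphere_eq_unit_sphere: "nsphere p = top_of_set (unit_sphere (Suc p))"
proof -
  have "{x. (\<Sum>i\<le>p. (x i)\<^sup>2) = 1 \<and> (\<forall>i>p. x i = 0)} = unit_sphere (Suc p)"
    by (auto simp: unit_sphere_def L2_set_def lessThan_Suc_atMost Suc_le_eq)
  then show ?thesis
    by (simp add: nsphere euclidean_product_topology)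
qed

lemma topspace_nsphere_eq: "topspace (nsphere p) = unit_sphere (Suc p)"
  by (simp add: nsphere_eq_unit_sphere)

lemma normalized_in_unit_sphere:
  assumes "\<exists>i<n. y i \<noteq> 0" "\<And>i. i \<ge> n \<Longrightarrow> y i = 0"
  shows "normalized n y \<in> unit_sphere n"
proof -
  have p: "L2_set y {..<n} \<noteq> 0" using assms by (auto simp: L2_set_eq_0_iff)
  have "L2_set (normalized n y) {..<n} = L2_set y {..<n} * (1 / L2_set y {..<n})"
    unfolding normalized_def
    by (subst L2_set_left_distrib) (auto simp: L2_set_nonneg divide_inverse)
  then show ?thesis using p assms by (simp add: unit_sphere_def normalized_def)
qed

lemma continuous_on_normalized:
  assumes "\<And>i. continuous_on S (\<lambda>x. f x i)" "\<And>x. x \<in> S \<Longrightarrow> \<exists>i<n. f x i \<noteq> 0"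
  shows "continuous_on S (\<lambda>x. normalized n (f x))"
proof (rule continuous_on_coordinatewise_then_product)
  fix i
  show "continuous_on S (\<lambda>x. normalized n (f x) i)"
    unfolding normalized_def L2_set_def
    using assms(2)
    by (intro continuous_intros assms(1)) (fastforce simp: sum_nonneg_eq_0_iff)
qed

text \<open>
  A homotopy without zeros can be normalized at every time, which turns it into a homotopy of self-maps
  of the sphere.
\<close>

lemma degree_homotopic_nonvanishing:
  assumes cont: "\<And>i. continuous_on ({0..1} \<times> unit_sphere (Suc p)) (\<lambda>z. h (fst z) (snd z) i)"
    and nz: "\<And>s x. s \<in> {0..1} \<Longrightarrow> x \<in> unit_sphere (Suc p) \<Longrightarrow> \<exists>i<Suc p. h s x i \<noteq> 0"
    and z: "\<And>s x i. s \<in> {0..1::real} \<Longrightarrow> x \<in> unit_sphere (Suc p) \<Longrightarrow> i \<ge> Suc p \<Longrightarrow> h s x i = 0"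
  shows "Brouwer_degree2 p (\<lambda>x. normalized (Suc p) (h 0 x)) =
         Brouwer_degree2 p (\<lambda>x. normalized (Suc p) (h 1 x))"
proof (rule Brouwer_degree2_homotopic)
  let ?S = "unit_sphere (Suc p)"
  let ?k = "\<lambda>z. normalized (Suc p) (h (fst z) (snd z))"
  have "continuous_on ({0..1} \<times> ?S) ?k"
    by (rule continuous_on_normalized) (use cont nz in auto)
  moreover have "?k \<in> ({0..1} \<times> ?S) \<rightarrow> ?S"
    by (auto intro!: normalized_in_unit_sphere nz z)
  ultimately have "continuous_map (prod_topology (top_of_set {0..1}) (nsphere p)) (nsphere p) ?k"
    unfolding nsphere_eq_unit_sphere
    by (simp add: prod_topology_subtopology subtopology_subtopology Int_absorb1 Sigma_mono flip: subtopology_Times)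
  then show "homotopic_with (\<lambda>x. True) (nsphere p) (nsphere p) (\<lambda>x. normalized (Suc p) (h 0 x))
     (\<lambda>x. normalized (Suc p) (h 1 x))"
    unfolding homotopic_with_def
    by (intro exI[of _ ?k]) auto
qed

definition lin_map :: "real mat \<Rightarrow> (nat \<Rightarrow> real) \<Rightarrow> nat \<Rightarrow> real" where
  "lin_map A x = (\<lambda>i. if i < dim_row A then \<Sum>j<dim_col A. A $$ (i, j) * x j else 0)"

lemma lin_map_scale: "lin_map A (\<lambda>j. c * x j) = (\<lambda>i. c * lin_map A x i)"
  by (auto simp: lin_map_def sum_distrib_left fun_eq_iff intro!: sum.cong)

lemma continuous_on_lin_map: "continuous_on S (\<lambda>x. lin_map A x i)"
proof (cases "i < dim_row A")
  case True
  then show ?thesis unfolding lin_map_def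
    by (auto intro!: continuous_on_sum continuous_on_mult_left continuous_on_subset[OF continuous_on_product_coordinates])
qed (simp add: lin_map_def)

lemma lin_map_mult_mat_vec:
  assumes "A \<in> carrier_mat n n"
  shows "A *\<^sub>v Matrix.vec n x = Matrix.vec n (lin_map A x)"
  using assms by (auto simp: lin_map_def scalar_prod_def atLeast0LessThan intro!: sum.cong)

lemma lin_map_mult:
  assumes "A \<in> carrier_mat n n" "B \<in> carrier_mat n n"
  shows "lin_map (A * B) x = lin_map A (lin_map B x)"
proof
  fix i
  show "lin_map (A * B) x i = lin_map A (lin_map B x) i"
  proof (cases "i < n")
    case True
    have "(\<Sum>j<n. (\<Sum>k<n. A $$ (i,k) * B $$ (k,j)) * x j) = (\<Sum>k<n. A $$ (i,k) * (\<Sum>j<n. B $$ (k,j) * x j))"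
      by (simp add: sum_distrib_left sum_distrib_right mult.assoc) (rule sum.swap)
    then show ?thesis using assms True
      by (auto simp: lin_map_def scalar_prod_def atLeast0LessThan)
  qed (use assms in \<open>auto simp: lin_map_def\<close>)
qed

lemma lin_map_one:
  assumes "i < n" shows "lin_map (1\<^sub>m n) x i = x i"
proof -
  have "(\<Sum>j<n. 1\<^sub>m n $$ (i, j) * x j) = (\<Sum>j<n. if j = i then x i else 0)"
    using assms by (intro sum.cong) auto
  then show ?thesis using assms by (simp add: lin_map_def)
qed

lemma lin_map_nonzero:
  assumes "A \<in> carrier_mat n n" "det A \<noteq> 0" "\<exists>i<n. x i \<noteq> 0"
  shows "\<exists>i<n. lin_map A x i \<noteq> 0"
proof (rule ccontr)
  assume "\<not> ?thesis"
  then have "A *\<^sub>v Matrix.vec n x = 0\<^sub>v n"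
    using assms(1) by (subst lin_map_mult_mat_vec) auto
  moreover have "Matrix.vec n x \<noteq> 0\<^sub>v n"
    using assms(3) by (metis index_vec index_zero_vec(1))
  ultimately show False
    using det_0_iff_vec_prod_zero[OF assms(1)] assms(2) vec_carrier by blast
qed

lemma unit_sphere_nonzero: "x \<in> unit_sphere n \<Longrightarrow> \<exists>i<n. x i \<noteq> 0"
  by (rule ccontr) (auto simp: unit_sphere_def L2_set_def)

text \<open>
  Meaningful for invertible matrices: on the kernel of other matrices the normalization divides by zero.
\<close>

definition linear_degree :: "nat \<Rightarrow> real mat \<Rightarrow> int" where
  "linear_degree p A = Brouwer_degree2 p (\<lambda>x. normalized (Suc p) (lin_map A x))"

lemma continuous_map_normalized_lin_map:
  assumes "A \<in> carrier_mat (Suc p) (Suc p)" "det A \<noteq> 0"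
  shows "continuous_map (nsphere p) (nsphere p) (\<lambda>x. normalized (Suc p) (lin_map A x))"
proof -
  have "continuous_on (unit_sphere (Suc p)) (\<lambda>x. normalized (Suc p) (lin_map A x))"
    by (rule continuous_on_normalized)
      (use lin_map_nonzero[OF assms] unit_sphere_nonzero in \<open>auto intro: continuous_on_lin_map\<close>)
  moreover have "normalized (Suc p) (lin_map A x) \<in> unit_sphere (Suc p)" if "x \<in> unit_sphere (Suc p)" for x
    by (rule normalized_in_unit_sphere)
      (use assms(1) lin_map_nonzero[OF assms unit_sphere_nonzero[OF that]] in \<open>auto simp: lin_map_def\<close>)
  ultimately show ?thesis
    by (simp add: nsphere_eq_unit_sphere)
qed

lemma normalized_scale: "c > 0 \<Longrightarrow> normalized n (\<lambda>i. c * y i) = normalized n y"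
  by (auto simp: normalized_def fun_eq_iff simp flip: L2_set_right_distrib)

text \<open>
  The map of \<open>A * B\<close> is the composition of those of \<open>A\<close> and \<open>B\<close>: normalizing in between
  scales the vector by a positive factor, and the last normalization forgets it.
\<close>

lemma linear_degree_mult:
  assumes "A \<in> carrier_mat (Suc p) (Suc p)" "B \<in> carrier_mat (Suc p) (Suc p)" "det A \<noteq> 0" "det B \<noteq> 0"
  shows "linear_degree p (A * B) = linear_degree p A * linear_degree p B"
proof -
  have eq: "normalized (Suc p) (lin_map (A * B) x)
      = ((\<lambda>x. normalized (Suc p) (lin_map A x)) \<circ> (\<lambda>x. normalized (Suc p) (lin_map B x))) x"
    if x: "x \<in> topspace (nsphere p)" for x
  proof -
    define c where "c = L2_set (lin_map B x) {..<Suc p}"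
    have "\<exists>i<Suc p. lin_map B x i \<noteq> 0"
      using lin_map_nonzero[OF assms(2,4) unit_sphere_nonzero] x by (simp add: topspace_nsphere_eq)
    then have "c \<noteq> 0" by (auto simp: c_def L2_set_eq_0_iff)
    then have "c > 0" using L2_set_nonneg[of "lin_map B x" "{..<Suc p}"] by (simp add: c_def less_le)
    have "lin_map A (normalized (Suc p) (lin_map B x)) = (\<lambda>i. (1/c) * lin_map A (lin_map B x) i)"
      unfolding normalized_def c_def[symmetric] using lin_map_scale[of A "1/c" "lin_map B x"] by simp
    then show ?thesis
      using \<open>c > 0\<close> normalized_scale[of "1/c"] by (simp add: lin_map_mult[OF assms(1,2)])
  qed
  show ?thesis unfolding linear_degree_def
    by (subst Brouwer_degree2_eq[OF eq]) (simp_all add: Brouwer_degree2_compose continuous_map_normalized_lin_map assms)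
qed

text \<open>
  The identity matrix with column \<open>k\<close> replaced by \<open>c\<close>. Row scalings and row additions have this form,
  and so does the matrix that clears a whole column in one elimination step.
\<close>

definition column_matrix :: "nat \<Rightarrow> nat \<Rightarrow> (nat \<Rightarrow> real) \<Rightarrow> real mat" where
  "column_matrix n k c = Matrix.mat n n (\<lambda>(i, j). if j = k then c i else if i = j then 1 else 0)"

lemma column_matrix_carrier [simp]: "column_matrix n k c \<in> carrier_mat n n"
  by (simp add: column_matrix_def)

lemma det_column_matrix: assumes "k < n" shows "det (column_matrix n k c) = c k"
proof -
  have "det (column_matrix n k c) = (\<Sum>j<n. column_matrix n k c $$ (k,j) * cofactor (column_matrix n k c) k j)"
    by (rule laplace_expansion_row[OF column_matrix_carrier assms])
  also have "\<dots> = (\<Sum>j<n. if j = k then c k * cofactor (column_matrix n k c) k k else 0)"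
    by (rule sum.cong) (use assms in \<open>auto simp: column_matrix_def\<close>)
  also have "\<dots> = c k * cofactor (column_matrix n k c) k k" using assms by simp
  also have "mat_delete (column_matrix n k c) k k = 1\<^sub>m (n - 1)"
    using assms by (intro eq_matI) (auto simp: mat_delete_def column_matrix_def)
  then have "cofactor (column_matrix n k c) k k = 1" by (simp add: cofactor_def)
  finally show ?thesis by simp
qed

lemma lin_map_column_matrix:
  assumes "k < n"
  shows "lin_map (column_matrix n k c) x =
    (\<lambda>i. if i < n then (if i = k then c k * x k else x i + c i * x k) else 0)"
proof
  fix i
  show "lin_map (column_matrix n k c) x i =
    (if i < n then (if i = k then c k * x k else x i + c i * x k) else 0)"
  proof (cases "i < n")
    case True
    have "(\<Sum>j<n. column_matrix n k c $$ (i, j) * x j)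
        = (\<Sum>j<n. (if j = k then c i * x k else 0) + (if j = i then (if i = k then 0 else x i) else 0))"
      by (rule sum.cong) (use True in \<open>auto simp: column_matrix_def\<close>)
    then show ?thesis using True assms
      by (simp add: lin_map_def column_matrix_def sum.distrib)
  qed (simp add: lin_map_def column_matrix_def)
qed

text \<open>
  The reflections in coordinates \<open>0\<close> and \<open>k\<close> are conjugate by a transposition of coordinates. This
  is an involution, so its degree squares to \<open>1\<close> and does not affect the result.
\<close>

lemma Brouwer_degree2_coordinate_reflection:
  assumes "k \<le> p"
  shows "Brouwer_degree2 p (\<lambda>x i. if i = k then - x i else x i) = -1"
proof -
  let ?t = "\<lambda>(x::nat \<Rightarrow> real) i. x (Transposition.transpose 0 k i)"
  let ?r = "\<lambda>k (x::nat\<Rightarrow>real) i. if i = k then - x i else x i"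
  have t: "continuous_map (nsphere p) (nsphere p) ?t"
  proof -
    have "continuous_on (unit_sphere (Suc p)) ?t"
      by (intro continuous_on_coordinatewise_then_product continuous_on_subset[OF continuous_on_product_coordinates]) auto
    moreover have "?t x \<in> unit_sphere (Suc p)" if "x \<in> unit_sphere (Suc p)" for x
    proof -
      have "(\<Sum>i<Suc p. (x (Transposition.transpose 0 k i))\<^sup>2) = (\<Sum>i<Suc p. (x i)\<^sup>2)"
        by (rule sum.permute[symmetric, unfolded comp_def, of "Transposition.transpose 0 k" "{..<Suc p}" "\<lambda>i. (x i)\<^sup>2"])
          (use assms in \<open>auto intro: permutes_swap_id\<close>)
      then show ?thesis using that assms
        by (auto simp: unit_sphere_def L2_set_def Transposition.transpose_def)
    qed
    ultimately show ?thesis by (simp add: nsphere_eq_unit_sphere)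
  qed
  note r = continuous_map_nsphere_reflection
  have tt: "Brouwer_degree2 p ?t * Brouwer_degree2 p ?t = 1"
  proof -
    have "?t \<circ> ?t = id" by (auto simp: fun_eq_iff)
    then show ?thesis using Brouwer_degree2_compose[OF t t] by simp
  qed
  have "?r k = ?t \<circ> (?r 0 \<circ> ?t)"
    by (auto simp: fun_eq_iff Transposition.transpose_def)
  then have "Brouwer_degree2 p (?r k) = Brouwer_degree2 p ?t * (Brouwer_degree2 p (?r 0) * Brouwer_degree2 p ?t)"
    by (simp only: Brouwer_degree2_compose[OF continuous_map_compose[OF t r] t] Brouwer_degree2_compose[OF t r])
  then show ?thesis using tt by (simp add: Brouwer_degree2_reflection)
qed

text \<open>
  The entries of column \<open>k\<close> off the diagonal are shrunk to \<open>0\<close>, while the diagonal entry moves straight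
  to its sign. All matrices on the way are invertible, and the last one is the identity or the reflection
  in coordinate \<open>k\<close>.
\<close>

lemma linear_degree_column_matrix:
  assumes "k < Suc p" "c k \<noteq> 0"
  shows "real_of_int (linear_degree p (column_matrix (Suc p) k c)) = sgn (c k)"
proof -
  let ?n = "Suc p"
  let ?c = "\<lambda>s i. if i = k then (1 - s) * c k + s * sgn (c k) else (1 - s) * c i"
  let ?h = "\<lambda>s. lin_map (column_matrix ?n k (?c s))"
  have "Brouwer_degree2 p (\<lambda>x. normalized ?n (?h 0 x)) = Brouwer_degree2 p (\<lambda>x. normalized ?n (?h 1 x))"
  proof (rule degree_homotopic_nonvanishing)
    fix i
    show "continuous_on ({0..1} \<times> unit_sphere ?n) (\<lambda>z. ?h (fst z) (snd z) i)"
    proof (cases "i < ?n")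
      case True
      have snd: "continuous_on ({0..1} \<times> unit_sphere ?n) (\<lambda>z :: real \<times> (nat \<Rightarrow> real). snd z j)" for j
        by (rule continuous_on_compose2[OF continuous_on_product_coordinates continuous_on_snd[OF continuous_on_id]]) simp
      show ?thesis
      proof (cases "i = k")
        case True
        show ?thesis unfolding lin_map_column_matrix[OF assms(1)] if_P[OF True] if_P[OF \<open>i < ?n\<close>]
          unfolding if_P[OF refl] by (intro continuous_intros snd)
      next
        case False
        show ?thesis unfolding lin_map_column_matrix[OF assms(1)] if_not_P[OF False] if_P[OF \<open>i < ?n\<close>]
          by (intro continuous_intros snd)
      qed
    qed (simp add: lin_map_column_matrix[OF assms(1)])
  next
    fix s :: real and x assume s: "s \<in> {0..1}" and x: "x \<in> unit_sphere ?n"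
    have "(1 - s) * c k + s * sgn (c k) \<noteq> 0"
    proof (cases "c k > 0")
      case True
      then show ?thesis using s
        by (cases "s = 0") (auto simp: sgn_if add_nonneg_eq_0_iff)
    next
      case False
      then have "c k < 0" using assms by simp
      have "(1 - s) * c k \<le> 0" using s \<open>c k < 0\<close> by (intro mult_nonneg_nonpos) auto
      then have "(1 - s) * c k - s < 0" using s \<open>c k < 0\<close> by (cases "s = 0") auto
      then show ?thesis using \<open>c k < 0\<close> by (auto simp: sgn_if)
    qed
    then have "det (column_matrix ?n k (?c s)) \<noteq> 0"
      by (simp add: det_column_matrix[OF assms(1)])
    then show "\<exists>i<?n. ?h s x i \<noteq> 0"
      by (rule lin_map_nonzero[OF column_matrix_carrier _ unit_sphere_nonzero[OF x]])
  qed (simp add: lin_map_def column_matrix_def)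
  moreover have "(\<lambda>x. ?h 0 x) = lin_map (column_matrix ?n k c)"
    by (intro ext) (simp add: lin_map_column_matrix[OF assms(1)])
  moreover have "Brouwer_degree2 p (\<lambda>x. normalized ?n (?h 1 x)) =
     Brouwer_degree2 p (\<lambda>x i. if i = k then sgn (c k) * x i else x i)"
  proof (rule Brouwer_degree2_eq)
    fix x assume "x \<in> topspace (nsphere p)"
    then have x: "x \<in> unit_sphere ?n" by (simp add: topspace_nsphere_eq)
    have h: "?h 1 x = (\<lambda>i. if i = k then sgn (c k) * x i else x i)"
      using x assms by (auto simp: lin_map_column_matrix[OF assms(1)] unit_sphere_def fun_eq_iff)
    have "L2_set (?h 1 x) {..<?n} = L2_set x {..<?n}"
      unfolding h L2_set_def using assms(2) by (intro arg_cong[of _ _ sqrt] sum.cong) (auto simp: sgn_if)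
    then have "L2_set (?h 1 x) {..<?n} = 1" using x by (simp add: unit_sphere_def)
    then show "normalized ?n (?h 1 x) = (\<lambda>i. if i = k then sgn (c k) * x i else x i)"
      by (simp add: normalized_def h)
  qed
  moreover have "Brouwer_degree2 p (\<lambda>x i. if i = k then sgn (c k) * x i else x i) = (if c k > 0 then 1 else -1)"
  proof (cases "c k > 0")
    case True
    then have "(\<lambda>x i. if i = k then sgn (c k) * x i else x i) = (id :: (nat \<Rightarrow> real) \<Rightarrow> _)"
      by (auto simp: fun_eq_iff)
    then show ?thesis using True by simp
  next
    case False
    then have "sgn (c k) = -1" using assms(2) by (simp add: sgn_if)
    then have "(\<lambda>x i. if i = k then sgn (c k) * x i else x i) = (\<lambda>x i. if i = k then - x i else x i)"
      by (intro ext) auto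
    then show ?thesis using False assms(1) Brouwer_degree2_coordinate_reflection[of k p] by simp
  qed
  ultimately show ?thesis using assms by (auto simp: linear_degree_def sgn_if)
qed

lemma column_matrix_mult:
  assumes "k < n" "A \<in> carrier_mat n n" "i < n" "j < n"
  shows "(column_matrix n k c * A) $$ (i, j) = (if i = k then c k * A $$ (k, j) else A $$ (i, j) + c i * A $$ (k, j))"
proof -
  have "(column_matrix n k c * A) $$ (i, j) = lin_map (column_matrix n k c) (\<lambda>l. A $$ (l, j)) i"
    using assms by (auto simp: lin_map_def scalar_prod_def column_matrix_def atLeast0LessThan)
  then show ?thesis using assms by (simp add: lin_map_column_matrix)
qed

text \<open>
  Without a pivot in row \<open>k\<close> or below, column \<open>k\<close> would be a combination of the unit vectors to its left,
  and its coefficients would give a vector in the kernel.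
\<close>

lemma invertible_elimination_step:
  fixes A :: "real mat"
  assumes A: "A \<in> carrier_mat n n" and d: "det A \<noteq> 0" and k: "k < n"
    and id: "\<And>i j. i < n \<Longrightarrow> j < k \<Longrightarrow> A $$ (i, j) = (if i = j then 1 else 0)"
  obtains i where "k \<le> i" "i < n" "A $$ (i, k) \<noteq> 0"
proof (rule ccontr)
  assume "\<not> thesis"
  with that have z: "A $$ (i, k) = 0" if "k \<le> i" "i < n" for i using that by blast
  define x where "x j = (if j = k then 1 else if j < k then - A $$ (j, k) else 0)" for j
  have "\<exists>i<n. lin_map A x i \<noteq> 0"
    by (rule lin_map_nonzero[OF A d]) (use k in \<open>auto simp: x_def\<close>)
  then obtain i where i: "i < n" "lin_map A x i \<noteq> 0" by blast
  have "(\<Sum>j<n. A $$ (i, j) * x j) = (\<Sum>j<n. (if j = k then A $$ (i, k) else 0) + (if j = i then (if i < k then - A $$ (i, k) else 0) else 0))"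
    by (rule sum.cong) (use id[OF i(1)] in \<open>auto simp: x_def\<close>)
  also have "\<dots> = 0" using i k z[of i] by (simp add: sum.distrib)
  finally show False using i A by (simp add: lin_map_def)
qed

text \<open>
  Gaussian elimination: every invertible matrix is a product of column matrices. The induction runs
  downwards over the number \<open>k\<close> of columns that already agree with the identity. It multiplies by column
  matrices, and these can be cancelled since their inverses are column matrices too.
\<close>

lemma column_matrix_induct:
  fixes A :: "real mat"
  assumes "A \<in> carrier_mat n n" "det A \<noteq> 0"
    and one: "P (1\<^sub>m n)"
    and mult: "\<And>k c B. k < n \<Longrightarrow> c k \<noteq> 0 \<Longrightarrow> B \<in> carrier_mat n n \<Longrightarrow> det B \<noteq> 0 \<Longrightarrow> P B \<Longrightarrow>
       P (column_matrix n k c * B)"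
  shows "P A"
proof -
  have cancel: "P B" if k: "k < n" and c: "c k \<noteq> 0" and B: "B \<in> carrier_mat n n" "det B \<noteq> 0" and
    PB: "P (column_matrix n k c * B)" for k c B
  proof -
    let ?c' = "\<lambda>i. if i = k then 1 / c k else - c i / c k"
    have cB: "column_matrix n k c * B \<in> carrier_mat n n"
      using B(1) by (meson column_matrix_carrier mult_carrier_mat)
    have "column_matrix n k ?c' * (column_matrix n k c * B) = B"
      by (rule eq_matI)
       (use k c B carrier_matD[OF column_matrix_carrier] in
        \<open>auto simp: column_matrix_mult column_matrix_mult[OF k cB] field_simps simp del: index_mult_mat(1)\<close>)
    moreover have "P (column_matrix n k ?c' * (column_matrix n k c * B))"
      by (rule mult) (use k c B cB PB det_mult[OF column_matrix_carrier B(1), of k c] det_column_matrix[OF k] in auto)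
    ultimately show ?thesis by simp
  qed
  have "P A" if "k \<le> n" "A \<in> carrier_mat n n" "det A \<noteq> 0"
    "\<And>i j. i < n \<Longrightarrow> j < k \<Longrightarrow> A $$ (i, j) = (if i = j then 1 else 0)" for k A
    using that
  proof (induction k arbitrary: A rule: inc_induct)
    case base
    then have "A = 1\<^sub>m n" by (intro eq_matI) auto
    then show ?case using one by simp
  next
    case (step k)
    have elim: "P C" if C: "C \<in> carrier_mat n n" "det C \<noteq> 0" "C $$ (k, k) \<noteq> 0"
      "\<And>i j. i < n \<Longrightarrow> j < k \<Longrightarrow> C $$ (i, j) = (if i = j then 1 else 0)" for C
    proof -
      \<comment> \<open>This factor normalizes the pivot and clears the rest of column \<open>k\<close>.\<close>
      let ?c = "\<lambda>i. if i = k then 1 / C $$ (k, k) else - C $$ (i, k) / C $$ (k, k)"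
      have "P (column_matrix n k ?c * C)"
      proof (rule step.IH)
        show "column_matrix n k ?c * C \<in> carrier_mat n n"
          using C(1) by (meson column_matrix_carrier mult_carrier_mat)
        show "det (column_matrix n k ?c * C) \<noteq> 0"
          using C step.hyps by (simp add: det_mult[OF column_matrix_carrier C(1)] det_column_matrix)
        fix i j assume "i < n" "j < Suc k"
        then show "(column_matrix n k ?c * C) $$ (i, j) = (if i = j then 1 else 0)"
          using C step.hyps by (cases "j = k") (auto simp: column_matrix_mult simp del: index_mult_mat(1))
      qed
      then show ?thesis by (rule cancel[rotated -1]) (use C step.hyps in auto)
    qed
    obtain i where i: "k \<le> i" "i < n" "A $$ (i, k) \<noteq> 0"
      using invertible_elimination_step[OF step.prems(1,2) step.hyps(2)] step.prems(3) by metis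
    show ?case
    proof (cases "A $$ (k, k) = 0")
      case False
      then show ?thesis using elim step.prems by blast
    next
      case True
      with i have ik: "k < i" by (metis le_neq_implies_less)
      \<comment> \<open>Adding row \<open>i\<close> to row \<open>k\<close> creates a pivot on the diagonal.\<close>
      let ?c = "\<lambda>l. if l = i \<or> l = k then 1 else 0"
      have "P (column_matrix n i ?c * A)"
      proof (rule elim)
        show "column_matrix n i ?c * A \<in> carrier_mat n n"
          using step.prems(1) by (meson column_matrix_carrier mult_carrier_mat)
        show "det (column_matrix n i ?c * A) \<noteq> 0"
          using step.prems i by (simp add: det_mult[OF column_matrix_carrier step.prems(1)] det_column_matrix)
        show "(column_matrix n i ?c * A) $$ (k, k) \<noteq> 0"
          using True i ik step.prems by (simp add: column_matrix_mult del: index_mult_mat(1))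
        fix l j assume "l < n" "j < k"
        then show "(column_matrix n i ?c * A) $$ (l, j) = (if l = j then 1 else 0)"
          using step.prems i ik by (auto simp: column_matrix_mult simp del: index_mult_mat(1))
      qed
      then show ?thesis by (rule cancel[rotated -1]) (use i step.prems in auto)
    qed
  qed
  from this[of 0 A] assms(1,2) show ?thesis by simp
qed

text \<open>
  Both sides are multiplicative and agree on column matrices.
\<close>

lemma linear_degree_eq_sgn_det:
  assumes "A \<in> carrier_mat (Suc p) (Suc p)" "det A \<noteq> 0"
  shows "real_of_int (linear_degree p A) = sgn (det A)"
  using assms
proof (rule column_matrix_induct)
  have "1\<^sub>m (Suc p) = column_matrix (Suc p) 0 (\<lambda>i. if i = 0 then 1 else 0)"
    by (rule eq_matI) (auto simp: column_matrix_def)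
  then show "real_of_int (linear_degree p (1\<^sub>m (Suc p))) = sgn (det (1\<^sub>m (Suc p) :: real mat))"
    using linear_degree_column_matrix[of 0 p "\<lambda>i. if i = 0 then 1 else 0"] by (metis det_one sgn_one one_neq_zero zero_less_Suc)
next
  fix k and c :: "nat \<Rightarrow> real" and B :: "real mat"
  assume "k < Suc p" "c k \<noteq> 0" "B \<in> carrier_mat (Suc p) (Suc p)" "det B \<noteq> 0"
    "real_of_int (linear_degree p B) = sgn (det B)"
  then show "real_of_int (linear_degree p (column_matrix (Suc p) k c * B)) = sgn (det (column_matrix (Suc p) k c * B))"
    by (simp add: linear_degree_mult det_column_matrix linear_degree_column_matrix sgn_mult
      det_mult[OF column_matrix_carrier])
qed

section \<open>Index of a non-degenerate zero\<close>

lemma abs_le_L2_set: "finite S \<Longrightarrow> i \<in> S \<Longrightarrow> \<bar>f i\<bar> \<le> L2_set f S"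
  using member_le_L2_set[of S i "\<lambda>i. \<bar>f i\<bar>"] by (simp add: L2_set_def)

text \<open>
  The coordinates of \<open>h\<close> are recovered from those of \<open>D h\<close> by the inverse matrix.
\<close>

lemma lin_map_bounded_below:
  assumes D: "D \<in> carrier_mat n n" "det D \<noteq> 0"
  obtains M where "M \<ge> 0"
    "\<And>h a. (\<And>i. i < n \<Longrightarrow> \<bar>lin_map D h i\<bar> \<le> a) \<Longrightarrow> L2_set h {..<n} \<le> M * a"
proof -
  obtain E where E: "E \<in> carrier_mat n n" "E * D = 1\<^sub>m n"
    using det_non_zero_imp_unit[OF D, of "()"] by (auto simp: Units_def ring_mat_def)
  define M where "M = (\<Sum>i<n. \<Sum>j<n. \<bar>E $$ (i, j)\<bar>)"
  show thesis
  proof (rule that)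
    show "M \<ge> 0" by (simp add: M_def sum_nonneg)
    fix h a assume a: "\<And>i. i < n \<Longrightarrow> \<bar>lin_map D h i\<bar> \<le> a"
    have "L2_set h {..<n} \<le> (\<Sum>i<n. \<bar>h i\<bar>)" by (rule L2_set_le_sum_abs)
    also have "\<dots> \<le> (\<Sum>i<n. \<Sum>j<n. \<bar>E $$ (i, j)\<bar> * a)"
    proof (rule sum_mono)
      fix i assume "i \<in> {..<n}"
      then have i: "i < n" by simp
      have "h i = lin_map (1\<^sub>m n) h i" using i by (simp add: lin_map_one)
      also have "\<dots> = lin_map E (lin_map D h) i" using lin_map_mult[OF E(1) D(1)] E(2) by simp
      also have "\<dots> = (\<Sum>j<n. E $$ (i, j) * lin_map D h j)" using E(1) i by (simp add: lin_map_def)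
      finally have "\<bar>h i\<bar> \<le> (\<Sum>j<n. \<bar>E $$ (i, j) * lin_map D h j\<bar>)" by (metis sum_abs)
      also have "\<dots> \<le> (\<Sum>j<n. \<bar>E $$ (i, j)\<bar> * a)"
        using a by (intro sum_mono) (auto simp: abs_mult intro: mult_left_mono)
      finally show "\<bar>h i\<bar> \<le> (\<Sum>j<n. \<bar>E $$ (i, j)\<bar> * a)" .
    qed
    also have "\<dots> = M * a" by (simp add: M_def sum_distrib_right)
    finally show "L2_set h {..<n} \<le> M * a" .
  qed
qed

text \<open>
  At a zero of the homotopy, \<open>D h\<close> would be as small as the approximation error, which is
  quadratic in \<open>h\<close>. An invertible \<open>D\<close> forbids this for small \<open>h\<close>.
\<close>

lemma segment_to_linearization_nonvanishing:
  assumes D: "D \<in> carrier_mat n n" "det D \<noteq> 0" and C: "C \<ge> 0" and \<rho>: "\<rho> > 0"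
    and approx: "\<And>h i. (\<forall>i\<ge>n. h i = 0) \<Longrightarrow> L2_set h {..<n} \<le> \<rho> \<Longrightarrow> i < n \<Longrightarrow>
       \<bar>F (\<lambda>j. u j + h j) i - lin_map D h i\<bar> \<le> C * (L2_set h {..<n})\<^sup>2"
  shows "\<exists>r0>0. \<forall>h. \<forall>s\<in>{0..1}. (\<forall>i\<ge>n. h i = 0) \<longrightarrow> 0 < L2_set h {..<n} \<longrightarrow> L2_set h {..<n} < r0 \<longrightarrow>
       (\<exists>i<n. (1 - s) * F (\<lambda>j. u j + h j) i + s * lin_map D h i \<noteq> 0)"
proof -
  obtain M where M: "M \<ge> 0"
    "\<And>h a. (\<And>i. i < n \<Longrightarrow> \<bar>lin_map D h i\<bar> \<le> a) \<Longrightarrow> L2_set h {..<n} \<le> M * a"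
    using lin_map_bounded_below[OF D] by metis
  \<comment> \<open>Below this radius \<open>M * C * |h|\<^sup>2 < |h|\<close>, while a zero forces \<open>|h| \<le> M * C * |h|\<^sup>2\<close>.\<close>
  define r0 where "r0 = min \<rho> (1 / (M * C + 1))"
  have MC: "M * C \<ge> 0" using M C by simp
  show ?thesis
  proof (intro exI[of _ r0] conjI allI ballI impI)
    show "r0 > 0" using MC by (simp add: r0_def add_nonneg_pos \<rho>)
  next
    fix h :: "nat \<Rightarrow> real" and s :: real
    assume h: "\<forall>i\<ge>n. h i = 0" "0 < L2_set h {..<n}" "L2_set h {..<n} < r0" and s: "s \<in> {0..1}"
    define R where "R = L2_set h {..<n}"
    have R: "R > 0" "R \<le> \<rho>" "R * (M * C + 1) < 1"
      using h(2,3) MC unfolding R_def[symmetric] r0_def min_less_iff_conj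
      by (auto simp: pos_less_divide_eq add_nonneg_pos)
    show "\<exists>i<n. (1 - s) * F (\<lambda>j. u j + h j) i + s * lin_map D h i \<noteq> 0"
    proof (rule ccontr)
      assume "\<not> ?thesis"
      then have z: "(1 - s) * F (\<lambda>j. u j + h j) i + s * lin_map D h i = 0" if "i < n" for i
        using that by blast
      have "\<bar>lin_map D h i\<bar> \<le> C * R\<^sup>2" if i: "i < n" for i
      proof -
        have "lin_map D h i = - ((1 - s) * (F (\<lambda>j. u j + h j) i - lin_map D h i))"
          using z[OF i] by (simp add: algebra_simps)
        then have "\<bar>lin_map D h i\<bar> = (1 - s) * \<bar>F (\<lambda>j. u j + h j) i - lin_map D h i\<bar>"
          using s by (metis abs_minus_cancel abs_mult abs_of_nonneg atLeastAtMost_iff diff_ge_0_iff_ge)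
        also have "\<dots> \<le> 1 * (C * R\<^sup>2)"
          using s approx[OF h(1) _ i] R C by (intro mult_mono) (auto simp: R_def)
        finally show ?thesis by simp
      qed
      then have "R \<le> M * (C * R\<^sup>2)" using M(2) unfolding R_def by blast
      also have "\<dots> = R * (R * (M * C))" by (simp add: power2_eq_square)
      finally have "1 \<le> R * (M * C)" using R by simp
      then show False using R by (simp add: algebra_simps)
    qed
  qed
qed

lemma ball_degree_near_nondegenerate_zero:
  assumes D: "D \<in> carrier_mat (Suc p) (Suc p)" "det D \<noteq> 0" and r: "r > 0"
    and cont: "\<And>i. continuous_on UNIV (\<lambda>x. F x i)"
    and z: "\<And>x i. i \<ge> Suc p \<Longrightarrow> F x i = 0"
    and nz: "\<And>h s. (\<forall>i\<ge>Suc p. h i = 0) \<Longrightarrow> L2_set h {..<Suc p} = r \<Longrightarrow> s \<in> {0..1} \<Longrightarrow>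
       \<exists>i<Suc p. (1 - s) * F (\<lambda>j. u j + h j) i + s * lin_map D h i \<noteq> 0"
  shows "real_of_int (ball_degree (Suc p) F u r) = sgn (det D)"
proof -
  let ?h = "\<lambda>s (x :: nat \<Rightarrow> real) i. (1 - s) * F (\<lambda>j. u j + r * x j) i + s * lin_map D (\<lambda>j. r * x j) i"
  have "Brouwer_degree2 p (\<lambda>x. normalized (Suc p) (?h 0 x)) = Brouwer_degree2 p (\<lambda>x. normalized (Suc p) (?h 1 x))"
  proof (rule degree_homotopic_nonvanishing)
    fix i
    let ?T = "{0..1::real} \<times> unit_sphere (Suc p)"
    have snd: "continuous_on ?T (\<lambda>z. snd z j)" for j
      by (rule continuous_on_compose2[OF continuous_on_product_coordinates continuous_on_snd[OF continuous_on_id]]) simp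
    have "continuous_on ?T (\<lambda>z j. u j + r * snd z j)"
      by (intro continuous_on_coordinatewise_then_product continuous_intros snd)
    then have 1: "continuous_on ?T (\<lambda>z. F (\<lambda>j. u j + r * snd z j) i)"
      by (rule continuous_on_compose2[OF cont]) simp
    have "continuous_on ?T (\<lambda>z j. r * snd z j)"
      by (intro continuous_on_coordinatewise_then_product continuous_intros snd)
    then have 2: "continuous_on ?T (\<lambda>z. lin_map D (\<lambda>j. r * snd z j) i)"
      by (rule continuous_on_compose2[OF continuous_on_lin_map[of UNIV D i]]) simp
    show "continuous_on ?T (\<lambda>z. ?h (fst z) (snd z) i)"
      by (intro continuous_intros 1 2)
  next
    fix s :: real and x assume s: "s \<in> {0..1}" and x: "x \<in> unit_sphere (Suc p)"
    have "L2_set (\<lambda>j. r * x j) {..<Suc p} = r * L2_set x {..<Suc p}"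
      using r by (simp flip: L2_set_right_distrib)
    then have "L2_set (\<lambda>j. r * x j) {..<Suc p} = r" using x by (simp add: unit_sphere_def)
    moreover have "\<forall>i\<ge>Suc p. r * x i = 0" using x by (simp add: unit_sphere_def)
    ultimately show "\<exists>i<Suc p. ?h s x i \<noteq> 0" using nz[of "\<lambda>j. r * x j" s] s by blast
  next
    fix s :: real and x i assume "i \<ge> Suc p"
    then show "?h s x i = 0" using D z by (simp add: lin_map_def)
  qed
  moreover have "ball_degree (Suc p) F u r = Brouwer_degree2 p (\<lambda>x. normalized (Suc p) (?h 0 x))"
    by (simp add: ball_degree_def normalized_def)
  moreover have "normalized (Suc p) (?h 1 x) = normalized (Suc p) (lin_map D x)" for x
    using normalized_scale[OF r, of "Suc p" "lin_map D x"] by (simp add: lin_map_scale)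
  ultimately show ?thesis using linear_degree_eq_sgn_det[OF D] by (simp add: linear_degree_def)
qed

text \<open>
  The quadratic error bound stands for differentiability; it is what a polynomial map satisfies. The
  index is well defined since the degree has the same value for all small radii.
\<close>

lemma
  fixes F :: "(nat \<Rightarrow> real) \<Rightarrow> nat \<Rightarrow> real"
  assumes D: "D \<in> carrier_mat n n" "det D \<noteq> 0" and C: "C \<ge> 0" and \<rho>: "\<rho> > 0"
    and cont: "\<And>i. continuous_on UNIV (\<lambda>x. F x i)"
    and z: "\<And>x i. i \<ge> n \<Longrightarrow> F x i = 0"
    and approx: "\<And>h i. (\<forall>i\<ge>n. h i = 0) \<Longrightarrow> L2_set h {..<n} \<le> \<rho> \<Longrightarrow> i < n \<Longrightarrow>
       \<bar>F (\<lambda>j. u j + h j) i - lin_map D h i\<bar> \<le> C * (L2_set h {..<n})\<^sup>2"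
  shows nondegenerate_zero_isolated: "\<exists>r0>0. \<forall>h. (\<forall>i\<ge>n. h i = 0) \<longrightarrow> 0 < L2_set h {..<n} \<longrightarrow>
          L2_set h {..<n} < r0 \<longrightarrow> (\<exists>i<n. F (\<lambda>j. u j + h j) i \<noteq> 0)"
    and nondegenerate_zero_index: "real_of_int (zero_index n F u) = sgn (det D)"
proof -
  have "\<exists>r0>0. \<forall>h. \<forall>s\<in>{0..1}. (\<forall>i\<ge>n. h i = 0) \<longrightarrow> 0 < L2_set h {..<n} \<longrightarrow> L2_set h {..<n} < r0 \<longrightarrow>
       (\<exists>i<n. (1 - s) * F (\<lambda>j. u j + h j) i + s * lin_map D h i \<noteq> 0)"
    by (rule segment_to_linearization_nonvanishing[OF D C \<rho> approx])
  then obtain r0 where r0: "r0 > 0"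
    "\<And>h s. (\<forall>i\<ge>n. h i = 0) \<Longrightarrow> 0 < L2_set h {..<n} \<Longrightarrow> L2_set h {..<n} < r0 \<Longrightarrow> s \<in> {0..1} \<Longrightarrow>
       \<exists>i<n. (1 - s) * F (\<lambda>j. u j + h j) i + s * lin_map D h i \<noteq> 0"
    by blast
  show "\<exists>r0>0. \<forall>h. (\<forall>i\<ge>n. h i = 0) \<longrightarrow> 0 < L2_set h {..<n} \<longrightarrow>
          L2_set h {..<n} < r0 \<longrightarrow> (\<exists>i<n. F (\<lambda>j. u j + h j) i \<noteq> 0)"
    using r0(1) r0(2)[where s = 0] by (intro exI[of _ r0]) simp
  have deg: "real_of_int (ball_degree n F u r) = sgn (det D)" if "0 < r" "r < r0" for r
  proof (cases n)
    case 0
    then show ?thesis using D(1) by (simp add: ball_degree_def)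
  next
    case (Suc p)
    show ?thesis
      using D that r0(2) z unfolding Suc
      by (intro ball_degree_near_nondegenerate_zero cont) auto
  qed
  define d where "d = ball_degree n F u (r0 / 2)"
  have d: "sgn (det D) = real_of_int d" using deg[of "r0 / 2"] r0(1) by (simp add: d_def)
  have "zero_index n F u = d"
    unfolding zero_index_def
  proof (rule the_equality)
    show "\<exists>r0>0. \<forall>r. 0 < r \<and> r < r0 \<longrightarrow> ball_degree n F u r = d"
      using deg r0(1) d by auto
    fix d' assume "\<exists>r0>0. \<forall>r. 0 < r \<and> r < r0 \<longrightarrow> ball_degree n F u r = d'"
    then obtain r1 where r1: "r1 > 0" "\<And>r. 0 < r \<and> r < r1 \<Longrightarrow> ball_degree n F u r = d'" by blast
    have "0 < min r0 r1 / 2" "min r0 r1 / 2 < r0" "min r0 r1 / 2 < r1" using r0(1) r1(1) by auto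
    then show "d' = d" using deg[of "min r0 r1 / 2"] r1(2)[of "min r0 r1 / 2"] d by simp
  qed
  then show "real_of_int (zero_index n F u) = sgn (det D)" using d by simp
qed

section \<open>Parity of the real eigenvalues below a level\<close>

lemma proots_linear_eq: "proots [:- (z::complex), 1:] = {#z#}"
  using proots_linear_factor[of "- z"] by simp

text \<open>
  Both sides are multiplicative, so it suffices to split off factors. A factor \<open>x - a\<close> is positive at
  \<open>E\<close> exactly if its root lies below \<open>E\<close>, and its degree is odd. The quadratic factor of a conjugate pair
  is positive, has even degree and no real root.
\<close>

lemma sgn_poly_eq_parity_of_real_roots_below:
  fixes p :: "real poly"
  assumes "poly p E \<noteq> 0"
  shows "sgn (poly p E) = sgn (lead_coeff p) *
    (-1) ^ (degree p + size {#z \<in># proots (map_poly complex_of_real p). z \<in> \<real> \<and> Re z < E#})"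
  using assms
proof (induction "degree p" arbitrary: p rule: less_induct)
  case less
  let ?c = "map_poly complex_of_real"
  let ?N = "\<lambda>p. size {#z \<in># proots (?c p). z \<in> \<real> \<and> Re z < E#}"
  let ?Q = "\<lambda>p. sgn (poly p E) = sgn (lead_coeff p) * (-1) ^ (degree p + ?N p)"
  have hom: "?c (f * g) = ?c f * ?c g" for f g :: "real poly"
    by (rule poly_eqI) (simp add: coeff_map_poly coeff_mult)
  have hom_add: "?c (f + g) = ?c f + ?c g" for f g :: "real poly"
    by (rule poly_eqI) (simp add: coeff_map_poly)
  have factor: "?Q p" if "p = f * g" "?Q f" "degree f > 0" for f g
  proof -
    have nz: "f \<noteq> 0" "g \<noteq> 0" "poly g E \<noteq> 0" using less.prems that(1) by auto
    then have "degree p = degree f + degree g" using that(1) by (simp add: degree_mult_eq)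
    then have "?Q g" using less.hyps[of g] nz that(3) by simp
    moreover have "?N (f * g) = ?N f + ?N g"
      using nz by (simp add: hom proots_mult)
    ultimately have "?Q (f * g)" using that(2) nz
      by (simp add: sgn_mult degree_mult_eq coeff_mult_degree_sum power_add mult_ac)
    then show ?thesis by (simp only: that(1))
  qed
  show ?case
  proof (cases "degree p = 0")
    case True
    then obtain a where "p = [:a:]" by (metis degree_eq_zeroE)
    moreover have "?c [:a:] = [:of_real a:]" by (rule poly_eqI) (simp add: coeff_map_poly coeff_pCons split: nat.split)
    ultimately show ?thesis by simp
  next
    case False
    then have "\<not> constant (poly (?c p))" by (simp add: constant_degree)
    then obtain z where z: "poly (?c p) z = 0" using fundamental_theorem_of_algebra by blast
    show ?thesis
    proof (cases "z \<in> \<real>")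
      case True
      then obtain a where a: "z = of_real a" by (auto elim: Reals_cases)
      then have "poly p a = 0" using z by simp
      then obtain g where g: "p = [:-a, 1:] * g" by (metis dvdE poly_eq_0_iff_dvd)
      have "a \<noteq> E" using less.prems g by auto
      have "?c [:-a, 1:] = [:- of_real a, 1:]" by simp
      then have "proots (?c [:-a, 1:]) = {#of_real a#}" by (simp add: proots_linear_eq)
      then have "?Q [:-a, 1:]" using \<open>a \<noteq> E\<close> by (auto simp: sgn_if)
      from factor[OF g this] show ?thesis by simp
    next
      case False
      define f where "f = [:(Re z)\<^sup>2 + (Im z)\<^sup>2, - 2 * Re z, 1:]"
      have im: "Im z \<noteq> 0" using False by (simp add: complex_is_Real_iff)
      have cf: "?c f = [:- z, 1:] * [:- cnj z, 1:]"
        by (simp add: f_def complex_eq_iff power2_eq_square)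
      have Qf: "?Q f"
      proof -
        have "poly f E = (E - Re z)\<^sup>2 + (Im z)\<^sup>2"
          by (simp add: f_def power2_eq_square algebra_simps)
        then have "poly f E > 0" using im by (simp add: add_nonneg_pos)
        moreover have "proots (?c f) = {#z, cnj z#}"
          unfolding cf by (subst proots_mult) (auto simp: proots_linear_eq)
        moreover have "cnj z \<notin> \<real>" using False by (simp add: complex_is_Real_iff)
        ultimately show ?thesis using False by (simp add: f_def)
      qed
      have "f dvd p"
      proof -
        have "degree f = 2" by (simp add: f_def)
        then have d: "degree (p mod f) \<le> 1" using degree_mod_less[of f p] by force
        define a b where "a = poly.coeff (p mod f) 0" and "b = poly.coeff (p mod f) 1"
        \<comment> \<open>A remainder of degree at most one with the non-real root \<open>z\<close> has to vanish.\<close>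
        have ab: "p mod f = [:a, b:]"
        proof (rule poly_eqI)
          fix k
          show "poly.coeff (p mod f) k = poly.coeff [:a, b:] k"
            using d by (auto simp: a_def b_def coeff_pCons coeff_eq_0 split: nat.split)
        qed
        have "poly (?c f) z = 0" by (simp add: cf)
        moreover have "?c p = ?c (p div f) * ?c f + ?c (p mod f)"
          by (metis div_mult_mod_eq hom hom_add)
        ultimately have "poly (?c (p mod f)) z = 0" using z by simp
        moreover have "?c [:a, b:] = [:of_real a, of_real b:]"
          by (rule poly_eqI) (simp add: coeff_map_poly coeff_pCons split: nat.split)
        ultimately have "of_real a + z * of_real b = 0" by (simp add: ab)
        then have "a + Re z * b = 0" "Im z * b = 0" by (auto simp: complex_eq_iff)
        then have "p mod f = 0" using im by (simp add: ab)
        then show ?thesis by auto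
      qed
      then obtain g where "p = f * g" by blast
      from factor[OF this Qf] show ?thesis by (simp add: f_def)
    qed
  qed
qed

text \<open>
  The characteristic polynomial at \<open>E\<close> is \<open>(-1)^n\<close> times the determinant, and this sign cancels the one
  that the parity of the degree contributes for a monic polynomial.
\<close>

lemma sgn_det_minus_eq_parity_of_real_eigenvalues_below:
  fixes A :: "real mat"
  assumes A: "A \<in> carrier_mat n n" and d: "det (A - E \<cdot>\<^sub>m 1\<^sub>m n) \<noteq> 0"
  shows "sgn (det (A - E \<cdot>\<^sub>m 1\<^sub>m n)) = (-1) ^ count_real_eigenvalues_below (map_mat complex_of_real A) E"
proof -
  have cp: "char_poly (map_mat complex_of_real A) = map_poly complex_of_real (char_poly A)"
    by (rule of_real_hom.char_poly_hom[OF A])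
  have "poly (char_poly A) E = det (- (A - E \<cdot>\<^sub>m 1\<^sub>m n))"
  proof -
    have "- char_matrix A E = - (A - E \<cdot>\<^sub>m 1\<^sub>m n)" using A by (intro eq_matI) (auto simp: char_matrix_def)
    then show ?thesis by (simp add: char_poly_matrix[OF A])
  qed
  also have "\<dots> = (-1) ^ n * det (A - E \<cdot>\<^sub>m 1\<^sub>m n)"
  proof -
    have "- (A - E \<cdot>\<^sub>m 1\<^sub>m n) = (-1) \<cdot>\<^sub>m (A - E \<cdot>\<^sub>m 1\<^sub>m n)" using A by (intro eq_matI) auto
    then show ?thesis using A by (simp add: det_smult)
  qed
  finally have e: "poly (char_poly A) E = (-1) ^ n * det (A - E \<cdot>\<^sub>m 1\<^sub>m n)" .
  then have "poly (char_poly A) E \<noteq> 0" using d by simp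
  from sgn_poly_eq_parity_of_real_roots_below[OF this] degree_monic_char_poly[OF A]
  have "(-1) ^ n * sgn (det (A - E \<cdot>\<^sub>m 1\<^sub>m n)) = (-1) ^ n * (-1) ^ count_real_eigenvalues_below (map_mat complex_of_real A) E"
    by (simp add: e sgn_mult power_add count_real_eigenvalues_below_def cp power_sgn[symmetric])
  then show ?thesis by simp
qed

lemma det_minus_eq_0_iff_spectrum:
  fixes A :: "real mat"
  assumes A: "A \<in> carrier_mat n n"
  shows "det (A - E \<cdot>\<^sub>m 1\<^sub>m n) = 0 \<longleftrightarrow> complex_of_real E \<in> spectrum (map_mat complex_of_real A)"
proof -
  have 1: "char_matrix (map_mat complex_of_real A) (of_real E) = map_mat of_real (A - E \<cdot>\<^sub>m 1\<^sub>m n)"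
    using A by (intro eq_matI) (auto simp: char_matrix_def)
  show ?thesis
    unfolding spectrum_def mem_Collect_eq eigenvalue_det[OF map_carrier_mat[THEN iffD2, OF A]] 1
    by (simp add: of_real_hom.hom_det)
qed

section \<open>Orthonormality of Slater determinants\<close>

lemma vec_lambda_measurable:
  "(\<lambda>f. \<chi> i. f i) \<in> (\<Pi>\<^sub>M i\<in>(UNIV :: 'n::finite set). (lborel :: 'a::euclidean_space measure)) \<rightarrow>\<^sub>M borel"
proof -
  have "(\<lambda>f. f i \<bullet> b) \<in> borel_measurable (\<Pi>\<^sub>M i\<in>(UNIV :: 'n set). (lborel :: 'a measure))" for i b
    by measurable
  then show ?thesis
    by (subst borel_measurable_euclidean_space) (auto simp: Basis_vec_def inner_axis)
qed

lemma prod_Basis_vec: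
  "(\<Prod>b\<in>(Basis :: ('a::euclidean_space ^ 'n::finite) set). f b) = (\<Prod>i\<in>UNIV. \<Prod>b\<in>Basis. f (axis i b))"
proof -
  have B: "(Basis :: ('a ^ 'n) set) = (\<lambda>(i, b). axis i b) ` (UNIV \<times> Basis)"
    by (auto simp: Basis_vec_def)
  have "inj_on (\<lambda>(i, b). axis i b :: 'a ^ 'n) (UNIV \<times> Basis)"
    by (auto simp: inj_on_def axis_eq_axis)
  then show ?thesis
    unfolding B by (simp add: prod.reindex prod.cartesian_product case_prod_unfold)
qed

text \<open>
  The two measures agree on boxes. With this identity, integration over all particles is integration
  over a finite product of copies of one-particle space.
\<close>

lemma lborel_vec_eq_PiM:
  "(lborel :: ('a::euclidean_space ^ 'n::finite) measure) =
     distr (\<Pi>\<^sub>M i\<in>UNIV. lborel) borel (\<lambda>f. \<chi> i. f i)"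
proof (rule lborel_eqI)
  interpret product_sigma_finite "\<lambda>i::'n. lborel :: 'a measure" by standard
  fix l u :: "'a ^ 'n" assume le: "\<And>b. b \<in> Basis \<Longrightarrow> l \<bullet> b \<le> u \<bullet> b"
  have le': "vec_nth l i \<bullet> b \<le> vec_nth u i \<bullet> b" if "b \<in> Basis" for i b
    using le[of "axis i b"] that by (simp add: inner_axis axis_in_Basis_iff)
  have "(\<lambda>f. \<chi> i. f i) -` box l u \<inter> space (\<Pi>\<^sub>M i\<in>(UNIV :: 'n set). (lborel :: 'a measure))
      = (\<Pi>\<^sub>E i\<in>UNIV. box (vec_nth l i) (vec_nth u i))"
    by (auto simp: box_def Basis_vec_def inner_axis space_PiM PiE_def)
  then have "emeasure (distr (\<Pi>\<^sub>M i\<in>(UNIV :: 'n set). (lborel :: 'a measure)) borel (\<lambda>f. \<chi> i. f i)) (box l u)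
     = emeasure (\<Pi>\<^sub>M i\<in>(UNIV :: 'n set). (lborel :: 'a measure)) (\<Pi>\<^sub>E i\<in>UNIV. box (vec_nth l i) (vec_nth u i))"
    by (subst emeasure_distr[OF vec_lambda_measurable]) auto
  also have "\<dots> = (\<Prod>i\<in>UNIV. emeasure lborel (box (vec_nth l i) (vec_nth u i)))"
    by (subst emeasure_PiM) auto
  also have "\<dots> = (\<Prod>i\<in>UNIV. ennreal (\<Prod>b\<in>Basis. (vec_nth u i - vec_nth l i) \<bullet> b))"
    using le' by (intro prod.cong refl emeasure_lborel_box) auto
  also have "\<dots> = ennreal (\<Prod>i\<in>UNIV. \<Prod>b\<in>Basis. (vec_nth u i - vec_nth l i) \<bullet> b)"
    using le' by (intro prod_ennreal prod_nonneg) (auto simp: inner_diff_left)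
  also have "\<dots> = ennreal (\<Prod>b\<in>Basis. (u - l) \<bullet> b)"
    by (simp add: prod_Basis_vec inner_axis)
  finally show "emeasure (distr (\<Pi>\<^sub>M i\<in>(UNIV :: 'n set). (lborel :: 'a measure)) borel (\<lambda>f. \<chi> i. f i)) (box l u)
     = ennreal (\<Prod>b\<in>Basis. (u - l) \<bullet> b)" .
qed simp

lemma
  fixes F :: "'n::finite \<Rightarrow> 'a::euclidean_space \<Rightarrow> real"
  assumes F: "\<And>i. integrable lborel (F i)"
  shows integrable_prod_components: "integrable lborel (\<lambda>x. \<Prod>i\<in>UNIV. F i (vec_nth x i))"
    and integral_prod_components:
      "(\<integral>x. (\<Prod>i\<in>UNIV. F i (vec_nth x i)) \<partial>lborel) = (\<Prod>i\<in>UNIV. integral\<^sup>L lborel (F i))"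
proof -
  interpret product_sigma_finite "\<lambda>i::'n. lborel :: 'a measure" by standard
  have m: "(\<lambda>x. \<Prod>i\<in>UNIV. F i (vec_nth x i)) \<in> borel_measurable borel"
  proof (intro borel_measurable_prod)
    fix i
    have "F i \<in> borel_measurable borel" using borel_measurable_integrable[OF F[of i]] by simp
    moreover have "(\<lambda>x :: 'a ^ 'n. vec_nth x i) \<in> borel_measurable borel"
      by (intro borel_measurable_continuous_onI continuous_intros)
    ultimately show "(\<lambda>x :: 'a ^ 'n. F i (vec_nth x i)) \<in> borel_measurable borel"
      by (rule measurable_compose[rotated])
  qed
  show "integrable lborel (\<lambda>x. \<Prod>i\<in>UNIV. F i (vec_nth x i))"
    by (subst lborel_vec_eq_PiM, subst integrable_distr_eq[OF vec_lambda_measurable m])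
      (simp add: product_integrable_prod F)
  show "(\<integral>x. (\<Prod>i\<in>UNIV. F i (vec_nth x i)) \<partial>lborel) = (\<Prod>i\<in>UNIV. integral\<^sup>L lborel (F i))"
    by (subst lborel_vec_eq_PiM, subst integral_distr[OF vec_lambda_measurable m])
      (simp add: product_integral_prod F)
qed

lemma L2_fun_mult_integrable:
  assumes "L2_fun f" "L2_fun g"
  shows "integrable lborel (\<lambda>x. f x * g x)"
proof (rule Bochner_Integration.integrable_bound[where f = "\<lambda>x. (f x)\<^sup>2 + (g x)\<^sup>2"])
  show "integrable lborel (\<lambda>x. (f x)\<^sup>2 + (g x)\<^sup>2)" using assms by (auto simp: L2_fun_def)
  show "(\<lambda>x. f x * g x) \<in> borel_measurable lborel" using assms by (auto simp: L2_fun_def)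
  have "\<bar>a * b\<bar> \<le> a\<^sup>2 + b\<^sup>2" for a b :: real
  proof -
    have "2 * (\<bar>a\<bar> * \<bar>b\<bar>) \<le> a\<^sup>2 + b\<^sup>2" using sum_squares_bound[of "\<bar>a\<bar>" "\<bar>b\<bar>"] by simp
    moreover have "0 \<le> \<bar>a\<bar> * \<bar>b\<bar>" by simp
    ultimately show ?thesis unfolding abs_mult by linarith
  qed
  then show "AE x in lborel. norm (f x * g x) \<le> norm ((f x)\<^sup>2 + (g x)\<^sup>2)" by simp
qed

lemma bij_betw_rank: "bij_betw (\<lambda>i. card {j. j < i}) (UNIV :: 'n::{finite,linorder} set) {..<CARD('n)}"
proof -
  have lt: "card {k. k < i} < card {k. k < j}" if "i < j" for i j :: 'n
    using that by (intro psubset_card_mono) auto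
  have "inj (\<lambda>i::'n. card {j. j < i})"
    by (intro injI) (metis lt less_irrefl linorder_neqE)
  moreover have "(\<lambda>i. card {j. j < i}) ` (UNIV :: 'n set) \<subseteq> {..<CARD('n)}"
    by (auto intro!: psubset_card_mono)
  ultimately show ?thesis
    by (metis bij_betw_def card_image card_lessThan card_subset_eq finite_lessThan)
qed

lemma bij_betw_multiindex_entry:
  assumes "finite \<alpha>" "card \<alpha> = CARD('n)"
  shows "bij_betw (multiindex_entry \<alpha> :: 'n::{finite,linorder} \<Rightarrow> nat) UNIV \<alpha>"
proof -
  have "bij_betw ((!) (sorted_list_of_set \<alpha>)) {..<CARD('n)} \<alpha>"
    using assms by (intro bij_betw_nth) auto
  from bij_betw_trans[OF bij_betw_rank this] show ?thesis
    by (simp add: multiindex_entry_def[abs_def] comp_def)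
qed

text \<open>
  The Leibniz formula is used for the transposed matrix: its products are indexed by particles, and
  each factor depends on the position of one particle only.
\<close>

lemma slater_leibniz:
  fixes x :: "'n::{finite,linorder} config"
  shows "slater \<phi> \<alpha> x =
    (\<Sum>p | p permutes UNIV. of_int (sign p) * (\<Prod>j\<in>UNIV. \<phi> (multiindex_entry \<alpha> (p j)) (vec_nth x j))) / sqrt (fact CARD('n))"
  unfolding slater_def
  by (subst Determinants.det_transpose[symmetric]) (simp add: Determinants.det_def Finite_Cartesian_Product.transpose_def)

text \<open>
  The product of two determinants is a double sum over permutations \<open>p\<close>, \<open>q\<close>, and the integral of a term
  factors over the particles. It is \<open>1\<close> if orbital \<open>p j\<close> of \<open>\<alpha>\<close> is orbital \<open>q j\<close> of \<open>\<beta>\<close> for every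
  particle \<open>j\<close>, and \<open>0\<close> otherwise. The former requires \<open>\<alpha> = \<beta>\<close> and \<open>p = q\<close>, which happens
  \<open>N!\<close> times.
\<close>

lemma
  fixes \<phi> :: "nat \<Rightarrow> real^3 \<Rightarrow> real"
  assumes L2: "\<And>p. p \<in> P \<Longrightarrow> L2_fun (\<phi> p)"
    and orth: "\<And>p q. p \<in> P \<Longrightarrow> q \<in> P \<Longrightarrow> L2_inner (\<phi> p) (\<phi> q) = (if p = q then 1 else 0)"
    and \<alpha>: "\<alpha> \<subseteq> P" "finite \<alpha>" "card \<alpha> = CARD('n::{finite,linorder})"
    and \<beta>: "\<beta> \<subseteq> P" "finite \<beta>" "card \<beta> = CARD('n)"
  shows slater_mult_integrable: "integrable lborel (\<lambda>x :: 'n config. slater \<phi> \<alpha> x * slater \<phi> \<beta> x)"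
    and slater_orthonormal: "L2_inner (slater \<phi> \<alpha> :: 'n config \<Rightarrow> real) (slater \<phi> \<beta>) = (if \<alpha> = \<beta> then 1 else 0)"
proof -
  let ?S = "{p. p permutes (UNIV :: 'n set)}"
  let ?a = "multiindex_entry \<alpha> :: 'n \<Rightarrow> nat" and ?b = "multiindex_entry \<beta> :: 'n \<Rightarrow> nat"
  let ?I = "\<lambda>p q (x :: 'n config). \<Prod>j\<in>UNIV. \<phi> (?a (p j)) (vec_nth x j) * \<phi> (?b (q j)) (vec_nth x j)"
  have a: "inj ?a" "range ?a = \<alpha>" and b: "inj ?b" "range ?b = \<beta>"
    using bij_betw_multiindex_entry[OF \<alpha>(2,3)] bij_betw_multiindex_entry[OF \<beta>(2,3)]
    by (auto simp: bij_betw_def)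
  have aP: "?a i \<in> P" and bP: "?b i \<in> P" for i using a b \<alpha> \<beta> by auto
  have eq: "slater \<phi> \<alpha> x * slater \<phi> \<beta> x = (\<Sum>p\<in>?S. \<Sum>q\<in>?S. of_int (sign p) * of_int (sign q) / fact CARD('n) * ?I p q x)"
    for x :: "'n config"
  proof -
    have "slater \<phi> \<alpha> x * slater \<phi> \<beta> x =
     (\<Sum>p\<in>?S. of_int (sign p) * (\<Prod>j\<in>UNIV. \<phi> (?a (p j)) (vec_nth x j))) *
     (\<Sum>q\<in>?S. of_int (sign q) * (\<Prod>j\<in>UNIV. \<phi> (?b (q j)) (vec_nth x j))) / fact CARD('n)"
      by (simp add: slater_leibniz)
    also have "\<dots> = (\<Sum>p\<in>?S. \<Sum>q\<in>?S. of_int (sign p) * of_int (sign q) / fact CARD('n) * ?I p q x)"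
      unfolding sum_product sum_divide_distrib prod.distrib
      by (intro sum.cong refl) (simp add: field_simps)
    finally show ?thesis .
  qed
  have int: "integrable lborel (?I p q)" for p q
    by (intro integrable_prod_components L2_fun_mult_integrable L2 aP bP)
  have val: "(\<integral>x. ?I p q x \<partial>lborel) = (if \<forall>j. ?a (p j) = ?b (q j) then 1 else 0)" for p q
  proof -
    have "(\<integral>x. ?I p q x \<partial>lborel) = (\<Prod>j\<in>UNIV. \<integral>y. \<phi> (?a (p j)) y * \<phi> (?b (q j)) y \<partial>lborel)"
      by (intro integral_prod_components L2_fun_mult_integrable L2 aP bP)
    also have "\<dots> = (\<Prod>j\<in>UNIV. if ?a (p j) = ?b (q j) then 1 else 0)"
      using orth[OF aP bP] by (simp add: L2_inner_def)
    also have "\<dots> = (if \<forall>j. ?a (p j) = ?b (q j) then 1 else 0)" by auto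
    finally show ?thesis .
  qed
  show "integrable lborel (\<lambda>x :: 'n config. slater \<phi> \<alpha> x * slater \<phi> \<beta> x)"
    unfolding eq by (intro Bochner_Integration.integrable_sum integrable_mult_right int)
  have "L2_inner (slater \<phi> \<alpha> :: 'n config \<Rightarrow> real) (slater \<phi> \<beta>) =
    (\<Sum>p\<in>?S. \<Sum>q\<in>?S. of_int (sign p) * of_int (sign q) / fact CARD('n) * (\<integral>x. ?I p q x \<partial>lborel))"
    unfolding L2_inner_def eq
    by (subst Bochner_Integration.integral_sum, intro Bochner_Integration.integrable_sum integrable_mult_right int)
      (intro sum.cong refl, subst Bochner_Integration.integral_sum; intro integrable_mult_right int sum.cong refl Bochner_Integration.integral_mult_right_zero)
  also have "\<dots> = (\<Sum>p\<in>?S. \<Sum>q\<in>?S. if \<alpha> = \<beta> \<and> p = q then 1 / fact CARD('n) else 0)"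
  proof (intro sum.cong refl)
    fix p q assume p: "p \<in> ?S" and q: "q \<in> ?S"
    have "\<alpha> = \<beta> \<and> p = q" if e: "\<forall>j. ?a (p j) = ?b (q j)"
    proof -
      have "\<alpha> = ?a ` range p" using a p by (simp add: permutes_surj)
      also have "\<dots> = ?b ` range q" using e by (force simp: image_iff)
      also have "\<dots> = \<beta>" using b q by (simp add: permutes_surj)
      finally have "\<alpha> = \<beta>" .
      with e a(1) show ?thesis by (auto simp: inj_eq)
    qed
    then show "of_int (sign p) * of_int (sign q) / fact CARD('n) * (\<integral>x. ?I p q x \<partial>lborel) =
        (if \<alpha> = \<beta> \<and> p = q then 1 / fact CARD('n) else (0::real))"
      unfolding val by (auto simp: sign_def)
  qed
  also have "\<dots> = (if \<alpha> = \<beta> then 1 else 0)"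
  proof (cases "\<alpha> = \<beta>")
    case True
    have "(\<Sum>p\<in>?S. \<Sum>q\<in>?S. if p = q then 1 / fact CARD('n) else (0::real)) = (\<Sum>p\<in>?S. 1 / fact CARD('n))"
      by (intro sum.cong refl) simp
    also have "\<dots> = 1"
      unfolding sum_constant card_permutations[OF refl finite] by simp
    finally show ?thesis unfolding True by (simp only: simp_thms if_True)
  qed simp
  finally show "L2_inner (slater \<phi> \<alpha> :: 'n config \<Rightarrow> real) (slater \<phi> \<beta>) = (if \<alpha> = \<beta> then 1 else 0)" .
qed

section \<open>Exponentials of commuting nilpotent operators\<close>

text \<open>
  Vectors of Fock space are plain functions, hence the vector operations are written pointwise.
\<close>

definition linear_op :: "(fock \<Rightarrow> fock) \<Rightarrow> bool" where
  "linear_op T \<longleftrightarrow> (\<forall>a b c d. T (\<lambda>S. a * c S + b * d S) = (\<lambda>S. a * T c S + b * T d S))"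

lemma linear_opD: "linear_op T \<Longrightarrow> T (\<lambda>S. a * c S + b * d S) = (\<lambda>S. a * T c S + b * T d S)"
  by (simp add: linear_op_def)

lemma linear_op_zero: "linear_op T \<Longrightarrow> T (\<lambda>S. 0) = (\<lambda>S. 0)"
  using linear_opD[of T 0 "\<lambda>S. 0" 0 "\<lambda>S. 0"] by simp

lemma linear_op_diff: "linear_op T \<Longrightarrow> T (\<lambda>S. c S - d S) = (\<lambda>S. T c S - T d S)"
  using linear_opD[of T 1 c "-1" d] by simp

lemma linear_op_scale: "linear_op T \<Longrightarrow> T (\<lambda>S. a * c S) = (\<lambda>S. a * T c S)"
  using linear_opD[of T a c 0 c] by simp

lemma linear_op_minus: "linear_op T \<Longrightarrow> T (\<lambda>S. - c S) = (\<lambda>S. - T c S)"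
  using linear_op_scale[of T "-1" c] by simp

lemma linear_op_sum:
  assumes "linear_op T"
  shows "T (\<lambda>S. \<Sum>i\<in>A. a i * c i S) = (\<lambda>S. \<Sum>i\<in>A. a i * T (c i) S)"
proof (induction A rule: infinite_finite_induct)
  case (insert x F)
  then show ?case
    using linear_opD[OF assms, of "a x" "c x" 1 "\<lambda>S. \<Sum>i\<in>F. a i * c i S"] by simp
qed (simp_all add: linear_op_zero[OF assms])

lemma linear_op_funpow: "linear_op T \<Longrightarrow> linear_op (T ^^ k)"
  by (induction k) (simp_all add: linear_op_def)

lemma linear_op_comp: "linear_op T \<Longrightarrow> linear_op U \<Longrightarrow> linear_op (\<lambda>c. T (U c))"
  by (simp add: linear_op_def)

lemma linear_op_combination:
  assumes "\<And>i. i \<in> A \<Longrightarrow> linear_op (T i)"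
  shows "linear_op (\<lambda>c S. \<Sum>i\<in>A. a i * T i c S)"
proof -
  have "(\<Sum>i\<in>A. a i * T i (\<lambda>S. u * c S + v * d S) S)
     = (\<Sum>i\<in>A. u * (a i * T i c S) + v * (a i * T i d S))" for u v c d S
    using assms by (intro sum.cong refl) (simp add: linear_op_def algebra_simps)
  then show ?thesis
    by (simp add: linear_op_def sum.distrib sum_distrib_left)
qed

definition nilpotent_op :: "nat \<Rightarrow> (fock \<Rightarrow> fock) \<Rightarrow> bool" where
  "nilpotent_op m T \<longleftrightarrow> (\<forall>c k. k \<ge> m \<longrightarrow> (T ^^ k) c = (\<lambda>S. 0))"

lemma op_exp_nilpotent:
  assumes "nilpotent_op m T" "m \<le> M"
  shows "op_exp T c = (\<lambda>S. \<Sum>k<M. (T ^^ k) c S / fact k)"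
proof
  fix S
  have "suminf (\<lambda>k. (T ^^ k) c S / fact k) = (\<Sum>k<M. (T ^^ k) c S / fact k)"
    using assms by (intro suminf_finite) (auto simp: nilpotent_op_def)
  then show "op_exp T c S = (\<Sum>k<M. (T ^^ k) c S / fact k)" by (simp add: op_exp_def)
qed

lemma linear_op_exp:
  assumes "nilpotent_op m T" "linear_op T"
  shows "linear_op (op_exp T)"
proof -
  have "op_exp T = (\<lambda>c S. \<Sum>k<m. (1 / fact k) * (T ^^ k) c S)"
    using op_exp_nilpotent[OF assms(1) order_refl] by (auto simp: fun_eq_iff)
  then show ?thesis
    using linear_op_combination[of "{..<m}" "\<lambda>k. T ^^ k" "\<lambda>k. 1 / fact k"] linear_op_funpow[OF assms(2)] by simp
qed

text \<open>
  The binomial theorem. The coefficients are quotients of factorials because the powers are going to be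
  divided by \<open>fact k\<close>.
\<close>

lemma funpow_add_commuting:
  assumes T: "linear_op T" and H: "linear_op H" and comm: "\<And>c. T (H c) = H (T c)"
  shows "((\<lambda>v S. T v S + H v S) ^^ k) c =
    (\<lambda>S. \<Sum>j\<le>k. fact k / (fact j * fact (k - j)) * (T ^^ j) ((H ^^ (k - j)) c) S)"
proof (induction k)
  case (Suc k)
  have commk: "H ((T ^^ j) d) = (T ^^ j) (H d)" for j d
    by (induction j) (simp_all add: comm[symmetric])
  let ?t = "\<lambda>j l S. (T ^^ j) ((H ^^ l) c) S"
  let ?c = "\<lambda>j. fact k / (fact j * fact (k - j)) :: real"
  have "((\<lambda>v S. T v S + H v S) ^^ Suc k) c =
     (\<lambda>S. (\<Sum>j\<le>k. ?c j * ?t (Suc j) (k - j) S) + (\<Sum>j\<le>k. ?c j * ?t j (Suc (k - j)) S))"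
    unfolding funpow.simps comp_def Suc.IH linear_op_sum[OF T] linear_op_sum[OF H] commk ..
  also have "\<dots> = (\<lambda>S. \<Sum>j\<le>Suc k. fact (Suc k) / (fact j * fact (Suc k - j)) * ?t j (Suc k - j) S)"
  proof
    fix S
    let ?w = "\<lambda>j. fact k / (fact j * fact (Suc k - j)) :: real"
    \<comment> \<open>Pascal's rule: both sums get the common factor \<open>?w j\<close>, with weights \<open>j\<close> and \<open>Suc k - j\<close>.\<close>
    have 1: "(\<Sum>j\<le>k. ?c j * ?t (Suc j) (k - j) S) = (\<Sum>j\<le>Suc k. (of_nat j * ?w j) * ?t j (Suc k - j) S)"
    proof -
      have "(\<Sum>j\<le>Suc k. (of_nat j * ?w j) * ?t j (Suc k - j) S)
          = (\<Sum>j\<le>k. (of_nat (Suc j) * ?w (Suc j)) * ?t (Suc j) (Suc k - Suc j) S)"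
        by (subst sum.atMost_Suc_shift) simp
      also have "\<dots> = (\<Sum>j\<le>k. ?c j * ?t (Suc j) (k - j) S)"
        by (intro sum.cong refl) (simp add: divide_simps del: of_nat_Suc)
      finally show ?thesis by simp
    qed
    have 2: "(\<Sum>j\<le>k. ?c j * ?t j (Suc (k - j)) S) = (\<Sum>j\<le>Suc k. (of_nat (Suc k - j) * ?w j) * ?t j (Suc k - j) S)"
    proof -
      have "?c j = of_nat (Suc (k - j)) * ?w j" if "j \<le> k" for j
        using that by (simp add: Suc_diff_le divide_simps del: of_nat_Suc)
      then have "(\<Sum>j\<le>k. ?c j * ?t j (Suc (k - j)) S) = (\<Sum>j\<le>k. (of_nat (Suc k - j) * ?w j) * ?t j (Suc k - j) S)"
        by (intro sum.cong refl) (simp only: atMost_iff Suc_diff_le)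
      then show ?thesis by simp
    qed
    have "(\<Sum>j\<le>k. ?c j * ?t (Suc j) (k - j) S) + (\<Sum>j\<le>k. ?c j * ?t j (Suc (k - j)) S) =
      (\<Sum>j\<le>Suc k. (of_nat j + of_nat (Suc k - j)) * ?w j * ?t j (Suc k - j) S)"
      unfolding 1 2 sum.distrib[symmetric] by (intro sum.cong refl) (simp only: distrib_right)
    also have "\<dots> = (\<Sum>j\<le>Suc k. fact (Suc k) / (fact j * fact (Suc k - j)) * ?t j (Suc k - j) S)"
    proof (intro sum.cong refl)
      fix j assume "j \<in> {..Suc k}"
      then have "of_nat j + of_nat (Suc k - j) = (of_nat (Suc k) :: real)"
        by (simp flip: of_nat_add)
      then show "(of_nat j + of_nat (Suc k - j)) * ?w j * ?t j (Suc k - j) S =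
         fact (Suc k) / (fact j * fact (Suc k - j)) * ?t j (Suc k - j) S"
        by (simp add: fact_Suc)
    qed
    finally show "(\<Sum>j\<le>k. ?c j * ?t (Suc j) (k - j) S) + (\<Sum>j\<le>k. ?c j * ?t j (Suc (k - j)) S) =
       (\<Sum>j\<le>Suc k. fact (Suc k) / (fact j * fact (Suc k - j)) * ?t j (Suc k - j) S)" .
  qed
  finally show ?case .
qed simp

text \<open>
  The Cauchy product of two finite exponential sums. Powers of the sum vanish from \<open>2 * m\<close> on, since
  there every term contains one of the operators at least \<open>m\<close> times.
\<close>

lemma op_exp_add_commuting:
  assumes T: "linear_op T" "nilpotent_op m T" and H: "linear_op H" "nilpotent_op m H"
    and comm: "\<And>c. T (H c) = H (T c)"
  shows "op_exp (\<lambda>v S. T v S + H v S) c = op_exp T (op_exp H c)"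
proof -
  let ?t = "\<lambda>j l S. (1 / (fact j * fact l)) * (T ^^ j) ((H ^^ l) c) S"
  have zero: "(T ^^ j) ((H ^^ l) c) = (\<lambda>S. 0)" if "m \<le> j \<or> m \<le> l" for j l
    using that T H linear_op_zero[OF linear_op_funpow[OF T(1)]] by (auto simp: nilpotent_op_def)
  have pow: "((\<lambda>v S. T v S + H v S) ^^ k) c S / fact k = (\<Sum>j\<le>k. ?t j (k - j) S)" for k S
    unfolding funpow_add_commuting[OF T(1) H(1) comm] by (simp add: sum_divide_distrib)
  have "op_exp (\<lambda>v S. T v S + H v S) c S = (\<Sum>k<2*m. \<Sum>j\<le>k. ?t j (k - j) S)" for S
  proof -
    have "suminf (\<lambda>k. ((\<lambda>v S. T v S + H v S) ^^ k) c S / fact k)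
        = (\<Sum>k<2*m. ((\<lambda>v S. T v S + H v S) ^^ k) c S / fact k)"
    proof (intro suminf_finite)
      fix k assume k: "k \<notin> {..<2*m}"
      have "?t j (k - j) S = 0" if "j \<le> k" for j
        using zero[of j "k - j"] k that by (cases "m \<le> j") auto
      then show "((\<lambda>v S. T v S + H v S) ^^ k) c S / fact k = 0" unfolding pow by simp
    qed simp
    then show ?thesis by (simp add: op_exp_def pow)
  qed
  moreover have "(\<Sum>k<2*m. \<Sum>j\<le>k. ?t j (k - j) S) = (\<Sum>j<m. \<Sum>l<m. ?t j l S)" for S
  proof -
    have "(\<Sum>k<2*m. \<Sum>j\<le>k. ?t j (k - j) S) = (\<Sum>(j, l)\<in>{(j, l). j + l < 2*m}. ?t j l S)"
      by (rule sum.triangle_reindex[symmetric])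
    also have "\<dots> = (\<Sum>(j, l)\<in>{..<m} \<times> {..<m}. ?t j l S)"
    proof (rule sum.mono_neutral_right)
      show "finite {(j, l). j + l < 2*m}"
        by (rule finite_subset[of _ "{..2*m} \<times> {..2*m}"]) auto
      show "\<forall>p\<in>{(j, l). j + l < 2*m} - {..<m} \<times> {..<m}. (case p of (j, l) \<Rightarrow> ?t j l S) = 0"
      proof
        fix p assume p: "p \<in> {(j, l). j + l < 2*m} - {..<m} \<times> {..<m}"
        obtain j l where jl: "p = (j, l)" by force
        then have "m \<le> j \<or> m \<le> l" using p by auto
        then show "(case p of (j, l) \<Rightarrow> ?t j l S) = 0" by (simp add: jl zero)
      qed
    qed auto
    finally show ?thesis by (simp add: sum.cartesian_product)
  qed
  moreover have "op_exp T (op_exp H c) S = (\<Sum>j<m. \<Sum>l<m. ?t j l S)" for S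
  proof -
    have e: "op_exp H c = (\<lambda>S. \<Sum>l<m. (1 / fact l) * (H ^^ l) c S)"
      using op_exp_nilpotent[OF H(2) order_refl] by simp
    have "op_exp T (op_exp H c) S = (\<Sum>j<m. (T ^^ j) (op_exp H c) S / fact j)"
      using op_exp_nilpotent[OF T(2) order_refl] by simp
    also have "\<dots> = (\<Sum>j<m. \<Sum>l<m. ?t j l S)"
      unfolding e linear_op_sum[OF linear_op_funpow[OF T(1)]]
      by (simp add: sum_divide_distrib mult.commute)
    finally show ?thesis .
  qed
  ultimately show ?thesis by (intro ext) simp
qed

section \<open>Moving particles into holes\<close>

text \<open>
  The Jordan-Wigner sign. It changes if an orbital below \<open>p\<close> is added or removed, and this is the
  source of all anticommutation relations.
\<close>

definition jw_sign :: "nat \<Rightarrow> nat set \<Rightarrow> real" where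
  "jw_sign p S = (-1) ^ card {q\<in>S. q < p}"

lemma jw_sign_insert:
  assumes "q \<notin> S" shows "jw_sign p (insert q S) = (if q < p then - jw_sign p S else jw_sign p S)"
proof (cases "q < p")
  case True
  then have "{x \<in> insert q S. x < p} = insert q {x \<in> S. x < p}" by auto
  moreover have "finite {x \<in> S. x < p}" by simp
  ultimately show ?thesis using assms True by (simp add: jw_sign_def)
next
  case False
  then have "{x \<in> insert q S. x < p} = {x \<in> S. x < p}" by auto
  then show ?thesis using False by (simp add: jw_sign_def)
qed

lemma jw_sign_remove:
  assumes "q \<in> S" shows "jw_sign p (S - {q}) = (if q < p then - jw_sign p S else jw_sign p S)"
  using jw_sign_insert[of q "S - {q}" p] assms by (auto simp: insert_absorb split: if_splits)

lemma abs_jw_sign: "\<bar>jw_sign p S\<bar> = 1"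
  by (simp add: jw_sign_def power_abs)

lemma create_eq: "create p c S = (if p \<in> S then jw_sign p S * c (S - {p}) else 0)"
  and annihilate_eq: "annihilate p c S = (if p \<in> S then 0 else jw_sign p S * c (insert p S))"
  by (simp_all add: create_def annihilate_def jw_sign_def)

lemma create_anticommute: "create p (create q c) = (\<lambda>S. - create q (create p c) S)"
proof
  fix S
  have "S - {p} - {q} = S - {q} - {p}" by auto
  then show "create p (create q c) S = - create q (create p c) S"
    by (cases p q rule: linorder_cases) (auto simp: create_eq jw_sign_remove)
qed

lemma annihilate_anticommute: "annihilate p (annihilate q c) = (\<lambda>S. - annihilate q (annihilate p c) S)"
proof
  fix S
  have "insert p (insert q S) = insert q (insert p S)" by auto
  then show "annihilate p (annihilate q c) S = - annihilate q (annihilate p c) S"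
    by (cases p q rule: linorder_cases) (auto simp: annihilate_eq jw_sign_insert)
qed

lemma annihilate_create_anticommute:
  assumes "p \<noteq> q"
  shows "annihilate q (create p c) = (\<lambda>S. - create p (annihilate q c) S)"
proof
  fix S
  have "insert q S - {p} = insert q (S - {p})" using assms by auto
  then show "annihilate q (create p c) S = - create p (annihilate q c) S"
    using assms by (cases p q rule: linorder_cases) (auto simp: create_eq annihilate_eq jw_sign_insert jw_sign_remove)
qed

lemma linear_op_create: "linear_op (create p)"
  and linear_op_annihilate: "linear_op (annihilate p)"
  by (auto simp: linear_op_def create_eq annihilate_eq fun_eq_iff algebra_simps)

definition hop :: "nat \<Rightarrow> nat \<Rightarrow> fock \<Rightarrow> fock" where
  "hop A I c = create A (annihilate I c)"

lemma linear_op_hop: "linear_op (hop A I)"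
  unfolding hop_def[abs_def] by (rule linear_op_comp[OF linear_op_create linear_op_annihilate])

text \<open>
  Exchanging the two pairs takes an even number of anticommutations. Operators of the same kind
  anticommute without restriction; a creation and an annihilation operator do so for distinct orbitals,
  here a virtual and an occupied one.
\<close>

lemma hop_commute:
  assumes "A \<noteq> J" "B \<noteq> I"
  shows "hop A I (hop B J c) = hop B J (hop A I c)"
proof -
  have "hop A I (hop B J c) = (\<lambda>S. - create A (create B (annihilate I (annihilate J c))) S)"
    unfolding hop_def annihilate_create_anticommute[OF assms(2)] linear_op_minus[OF linear_op_create] ..
  also have "\<dots> = (\<lambda>S. - create B (create A (annihilate J (annihilate I c))) S)"
    by (subst create_anticommute, subst annihilate_anticommute)
      (simp add: linear_op_minus[OF linear_op_create])
  also have "\<dots> = hop B J (hop A I c)"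
    unfolding hop_def annihilate_create_anticommute[OF assms(1)] linear_op_minus[OF linear_op_create] ..
  finally show ?thesis .
qed

lemma hop_nonzero:
  assumes "hop A I c S \<noteq> 0" "A \<noteq> I"
  shows "A \<in> S" "I \<notin> S" "c (insert I (S - {A})) \<noteq> 0"
  using assms by (auto simp: hop_def create_eq annihilate_eq split: if_splits)

lemma hop_ket:
  assumes "I \<in> R" "A \<notin> R"
  shows "\<exists>\<sigma>\<in>{1, -1}. hop A I (ket R) = (\<lambda>S. \<sigma> * ket (insert A (R - {I})) S)"
proof -
  let ?T = "insert A (R - {I})"
  let ?\<sigma> = "jw_sign A ?T * jw_sign I (?T - {A})"
  have "\<bar>?\<sigma>\<bar> = 1" by (simp add: abs_mult abs_jw_sign)
  moreover have "hop A I (ket R) = (\<lambda>S. ?\<sigma> * ket ?T S)"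
  proof
    fix S
    have "A \<in> S \<and> I \<notin> S \<and> insert I (S - {A}) = R \<longleftrightarrow> S = ?T" using assms by auto
    then show "hop A I (ket R) S = ?\<sigma> * ket ?T S"
      using assms by (auto simp: hop_def create_eq annihilate_eq ket_def)
  qed
  ultimately show ?thesis by (intro bexI[of _ ?\<sigma>]) auto
qed

definition hops :: "(nat \<times> nat) list \<Rightarrow> fock \<Rightarrow> fock" where
  "hops ps c = foldr (\<lambda>(A, I). hop A I) ps c"

lemma hops_simps [simp]: "hops [] c = c" "hops ((A, I) # ps) c = hop A I (hops ps c)"
  by (simp_all add: hops_def)

lemma excitation_eq_hops:
  "excitation N \<alpha> = hops (zip (sorted_list_of_set (\<alpha> - {1..N})) (sorted_list_of_set ({1..N} - \<alpha>)))"
  by (simp add: excitation_def hops_def hop_def[abs_def] fun_eq_iff)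

lemma linear_op_hops: "linear_op (hops ps)"
proof (induction ps)
  case (Cons p ps)
  then show ?case
    using linear_op_comp[OF linear_op_hop[of "fst p" "snd p"] Cons.IH] by (cases p) (simp add: linear_op_def)
qed (simp add: linear_op_def)

lemma hop_hops_commute:
  assumes "A \<notin> snd ` set ps" "I \<notin> fst ` set ps"
  shows "hop A I (hops ps c) = hops ps (hop A I c)"
  using assms by (induction ps) (auto simp: hop_commute)

lemma hops_commute:
  assumes "fst ` set ps \<inter> snd ` set qs = {}" "snd ` set ps \<inter> fst ` set qs = {}"
  shows "hops ps (hops qs c) = hops qs (hops ps c)"
  using assms by (induction ps) (auto simp: hop_hops_commute)

lemma hops_ket:
  assumes "distinct (map fst ps)" "distinct (map snd ps)" "snd ` set ps \<subseteq> R" "fst ` set ps \<inter> R = {}"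
  shows "\<exists>\<sigma>\<in>{1, -1}. hops ps (ket R) = (\<lambda>S. \<sigma> * ket (R - snd ` set ps \<union> fst ` set ps) S)"
  using assms
proof (induction ps)
  case Nil
  then show ?case by (auto simp: fun_eq_iff)
next
  case (Cons p ps)
  obtain A I where p: "p = (A, I)" by force
  have "\<exists>\<sigma>\<in>{1, -1}. hops ps (ket R) = (\<lambda>S. \<sigma> * ket (R - snd ` set ps \<union> fst ` set ps) S)"
    by (rule Cons.IH) (use Cons.prems in auto)
  then obtain \<sigma> where \<sigma>: "\<sigma> \<in> {1, -1}" "hops ps (ket R) = (\<lambda>S. \<sigma> * ket (R - snd ` set ps \<union> fst ` set ps) S)"
    by blast
  let ?R = "R - snd ` set ps \<union> fst ` set ps"
  have "I \<in> ?R" "A \<notin> ?R" using Cons.prems by (auto simp: p)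
  from hop_ket[OF this] obtain \<tau> where \<tau>: "\<tau> \<in> {1, -1}" "hop A I (ket ?R) = (\<lambda>S. \<tau> * ket (insert A (?R - {I})) S)"
    by (rule bexE)
  have "insert A (?R - {I}) = R - snd ` set (p # ps) \<union> fst ` set (p # ps)"
    using Cons.prems by (auto simp: p)
  then have "hops (p # ps) (ket R) = (\<lambda>S. (\<sigma> * \<tau>) * ket (R - snd ` set (p # ps) \<union> fst ` set (p # ps)) S)"
    using \<tau>(2) by (simp add: p \<sigma>(2) linear_op_scale[OF linear_op_hop] mult.assoc)
  moreover have "\<sigma> * \<tau> \<in> {1, -1}" using \<sigma>(1) \<tau>(1) by auto
  ultimately show ?case by blast
qed

lemma hops_bounded:
  assumes "\<And>S. \<bar>c S\<bar> \<le> B" shows "\<bar>hops ps c S\<bar> \<le> B"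
proof -
  have hop: "\<bar>hop A I d S\<bar> \<le> B" if "\<And>S. \<bar>d S\<bar> \<le> B" for A I d S
    using that order_trans[OF abs_ge_zero that] by (auto simp: hop_def create_eq annihilate_eq abs_mult abs_jw_sign)
  show ?thesis
  proof (induction ps arbitrary: S)
    case Nil
    then show ?case by (simp add: assms)
  next
    case (Cons p ps)
    obtain A I where "p = (A, I)" by force
    then show ?case using hop[of "hops ps c", OF Cons.IH] by simp
  qed
qed

definition holes_ge :: "nat set \<Rightarrow> nat \<Rightarrow> fock \<Rightarrow> bool" where
  "holes_ge Occ k c \<longleftrightarrow> (\<forall>S. c S \<noteq> 0 \<longrightarrow> k \<le> card (Occ - S))"

text \<open>
  A particle that leaves \<open>Occ\<close> leaves a hole there, and no hop fills a hole. The number of holes is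
  bounded by \<open>card Occ\<close>; this is why cluster operators are nilpotent.
\<close>

lemma hops_holes:
  assumes "finite Occ" "fst ` set ps \<inter> Occ = {}" "snd ` set ps \<subseteq> Occ" "holes_ge Occ k c"
  shows "holes_ge Occ (k + length ps) (hops ps c)"
  using assms(2,3)
proof (induction ps)
  case Nil
  then show ?case using assms by simp
next
  case (Cons p ps)
  obtain A I where p: "p = (A, I)" by force
  have AI: "A \<notin> Occ" "I \<in> Occ" "A \<noteq> I" using Cons.prems by (auto simp: p)
  have IH: "holes_ge Occ (k + length ps) (hops ps c)" using Cons by auto
  show ?case
    unfolding holes_ge_def
  proof (intro allI impI)
    fix S assume "hops (p # ps) c S \<noteq> 0"
    then have S: "A \<in> S" "I \<notin> S" "hops ps c (insert I (S - {A})) \<noteq> 0"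
      using hop_nonzero[of A I "hops ps c" S] AI by (auto simp: p)
    have "Occ - S = insert I (Occ - insert I (S - {A}))" using AI S by auto
    then have "card (Occ - S) = Suc (card (Occ - insert I (S - {A})))"
      using assms(1) by (metis DiffD2 card_insert_disjoint finite_Diff insertI1)
    then show "k + length (p # ps) \<le> card (Occ - S)"
      using IH S(3) by (auto simp: holes_ge_def)
  qed
qed

lemma hops_support:
  assumes ps: "fst ` set ps \<inter> Occ = {}" "snd ` set ps \<subseteq> Occ" "fst ` set ps \<subseteq> U"
    and c: "\<And>S. c S \<noteq> 0 \<Longrightarrow> S \<subseteq> U \<and> card S = n" and U: "finite U"
  shows "hops ps c S \<noteq> 0 \<Longrightarrow> S \<subseteq> U \<and> card S = n"
  using ps
proof (induction ps arbitrary: S)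
  case Nil
  then show ?case using c by auto
next
  case (Cons p ps)
  obtain A I where p: "p = (A, I)" by force
  have AI: "A \<in> U" "A \<noteq> I" using Cons.prems by (auto simp: p)
  then have S: "A \<in> S" "I \<notin> S" "hops ps c (insert I (S - {A})) \<noteq> 0"
    using Cons.prems(1) hop_nonzero[of A I "hops ps c" S] by (auto simp: p)
  then have *: "insert I (S - {A}) \<subseteq> U \<and> card (insert I (S - {A})) = n"
    using Cons.IH[of "insert I (S - {A})"] Cons.prems by auto
  then have "S \<subseteq> U" using AI by auto
  moreover from this U have "finite S" by (rule finite_subset)
  then have "card (insert I (S - {A})) = card S"
    using S card_Suc_Diff1[of S A] by (subst card_insert_disjoint) auto
  ultimately show ?case using * by simp
qed

lemma continuous_on_hops:
  assumes "\<And>S. continuous_on X (\<lambda>x. v x S)"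
  shows "continuous_on X (\<lambda>x. hops ps (v x) S)"
proof -
  have "continuous_on X (\<lambda>x. hop A I (d x) S)" if "\<And>S. continuous_on X (\<lambda>x. d x S)" for d :: "'a \<Rightarrow> fock" and A I S
  proof -
    have "continuous_on X (\<lambda>x. annihilate I (d x) S)" for S
      unfolding annihilate_eq by (cases "I \<in> S") (simp_all add: that continuous_on_mult_left)
    then show ?thesis unfolding hop_def create_eq
      by (cases "A \<in> S") (simp_all add: continuous_on_mult_left)
  qed
  then show ?thesis
    by (induction ps arbitrary: S) (auto simp: assms)
qed

section \<open>First-order expansion of a similarity transform\<close>

text \<open>
  A bound on the operator norm for the supremum norm over all sets of orbitals. Excitations move
  coefficients up to sign or delete them, so that their bound is \<open>1\<close>.
\<close>

definition op_bound :: "real \<Rightarrow> (fock \<Rightarrow> fock) \<Rightarrow> bool" where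
  "op_bound C T \<longleftrightarrow> C \<ge> 0 \<and> (\<forall>c B. (\<forall>S. \<bar>c S\<bar> \<le> B) \<longrightarrow> (\<forall>S. \<bar>T c S\<bar> \<le> C * B))"

lemma op_boundD: "op_bound C T \<Longrightarrow> (\<And>S. \<bar>c S\<bar> \<le> B) \<Longrightarrow> \<bar>T c S\<bar> \<le> C * B"
  by (simp add: op_bound_def)

lemma op_bound_nonneg: "op_bound C T \<Longrightarrow> C \<ge> 0"
  by (simp add: op_bound_def)

lemma op_bound_mono:
  assumes "op_bound C T" "C \<le> D"
  shows "op_bound D T"
  unfolding op_bound_def
proof (intro conjI allI impI)
  show "D \<ge> 0" using assms op_bound_nonneg by fastforce
  fix c :: fock and B :: real and S assume c: "\<forall>S. \<bar>c S\<bar> \<le> B"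
  then have "B \<ge> 0" using abs_ge_zero order_trans by blast
  then have "C * B \<le> D * B" using assms(2) by (rule mult_right_mono[rotated])
  then show "\<bar>T c S\<bar> \<le> D * B" using op_boundD[OF assms(1), of c B S] c by simp
qed

lemma op_bound_comp: "op_bound C T \<Longrightarrow> op_bound D U \<Longrightarrow> op_bound (C * D) (\<lambda>c. T (U c))"
  by (auto simp: op_bound_def mult.assoc)

lemma op_bound_funpow:
  assumes "op_bound C T" shows "op_bound (C ^ k) (T ^^ k)"
proof (induction k)
  case (Suc k)
  then show ?case using op_bound_comp[OF assms Suc.IH] by (simp add: op_bound_def)
qed (simp add: op_bound_def)

lemma op_bound_combination:
  assumes "\<And>i. i \<in> A \<Longrightarrow> op_bound (C i) (T i)"
  shows "op_bound (\<Sum>i\<in>A. \<bar>a i\<bar> * C i) (\<lambda>c S. \<Sum>i\<in>A. a i * T i c S)"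
  unfolding op_bound_def
proof (intro conjI allI impI)
  show "(\<Sum>i\<in>A. \<bar>a i\<bar> * C i) \<ge> 0" using assms by (intro sum_nonneg) (auto simp: op_bound_def)
  fix c :: fock and B :: real and S assume c: "\<forall>S. \<bar>c S\<bar> \<le> B"
  have "\<bar>\<Sum>i\<in>A. a i * T i c S\<bar> \<le> (\<Sum>i\<in>A. \<bar>a i * T i c S\<bar>)" by (rule sum_abs)
  also have "\<dots> \<le> (\<Sum>i\<in>A. \<bar>a i\<bar> * (C i * B))"
    using assms c by (intro sum_mono) (auto simp: abs_mult op_bound_def intro!: mult_left_mono)
  finally show "\<bar>\<Sum>i\<in>A. a i * T i c S\<bar> \<le> (\<Sum>i\<in>A. \<bar>a i\<bar> * C i) * B"
    by (simp add: sum_distrib_right mult.assoc)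
qed

lemma op_bound_exp:
  assumes "nilpotent_op m T" "op_bound \<eta> T"
  shows "op_bound (\<Sum>k<m. \<eta> ^ k) (op_exp T)"
proof -
  have "op_bound (\<Sum>k<m. \<bar>1 / fact k\<bar> * \<eta> ^ k) (\<lambda>c S. \<Sum>k<m. (1 / fact k) * (T ^^ k) c S)"
    by (intro op_bound_combination op_bound_funpow assms)
  moreover have "op_exp T = (\<lambda>c S. \<Sum>k<m. (1 / fact k) * (T ^^ k) c S)"
    using op_exp_nilpotent[OF assms(1) order_refl] by (auto simp: fun_eq_iff)
  ultimately have *: "op_bound (\<Sum>k<m. \<bar>1 / fact k\<bar> * \<eta> ^ k) (op_exp T)" by simp
  have "(\<Sum>k<m. \<bar>1 / fact k\<bar> * \<eta> ^ k) \<le> (\<Sum>k<m. \<eta> ^ k)"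
    using op_bound_nonneg[OF assms(2)]
    by (intro sum_mono mult_left_le_one_le) (simp_all add: fact_ge_1)
  with * show ?thesis by (rule op_bound_mono)
qed

text \<open>
  The terms of order at least \<open>2\<close> in the exponential sum are bounded by \<open>\<eta>\<^sup>2\<close> each, as \<open>\<eta> \<le> 1\<close>.
\<close>

lemma op_exp_linearization:
  assumes nil: "nilpotent_op m T" and m: "m \<ge> 2" and \<eta>: "op_bound \<eta> T" "\<eta> \<le> 1" and c: "\<And>S. \<bar>c S\<bar> \<le> B"
  shows "\<bar>op_exp T c S - c S - T c S\<bar> \<le> m * \<eta>\<^sup>2 * B"
proof -
  have B: "B \<ge> 0" using order_trans[OF abs_ge_zero c] by blast
  have \<eta>0: "\<eta> \<ge> 0" using op_bound_nonneg[OF \<eta>(1)] .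
  have "(\<Sum>k<m. (T ^^ k) c S / fact k) = (\<Sum>k\<in>{..<m} - {0, 1}. (T ^^ k) c S / fact k) + (\<Sum>k\<in>{0, 1}. (T ^^ k) c S / fact k)"
    using m by (intro sum.subset_diff) auto
  then have "op_exp T c S - c S - T c S = (\<Sum>k\<in>{..<m} - {0, 1}. (T ^^ k) c S / fact k)"
    using op_exp_nilpotent[OF nil order_refl] by simp
  also have "\<bar>\<dots>\<bar> \<le> (\<Sum>k\<in>{..<m} - {0, 1}. \<bar>(T ^^ k) c S / fact k\<bar>)" by (rule sum_abs)
  also have "\<dots> \<le> (\<Sum>k\<in>{..<m} - {0, 1}. \<eta>\<^sup>2 * B)"
  proof (rule sum_mono)
    fix k assume "k \<in> {..<m} - {0, 1}"
    then have "2 \<le> k" by auto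
    have "\<bar>(T ^^ k) c S / fact k\<bar> \<le> \<bar>(T ^^ k) c S\<bar>"
      using fact_ge_1[of k, where 'a = real] by (simp add: abs_divide divide_le_eq mult_right_le_one_le mult_le_cancel_left1)
    also have "\<dots> \<le> \<eta> ^ k * B" by (rule op_boundD[OF op_bound_funpow[OF \<eta>(1)] c])
    also have "\<dots> \<le> \<eta>\<^sup>2 * B"
      using B \<eta>0 \<eta>(2) \<open>2 \<le> k\<close> by (intro mult_right_mono power_decreasing) auto
    finally show "\<bar>(T ^^ k) c S / fact k\<bar> \<le> \<eta>\<^sup>2 * B" .
  qed
  also have "\<dots> = real (card ({..<m} - {0, 1})) * (\<eta>\<^sup>2 * B)" by simp
  also have "\<dots> \<le> m * (\<eta>\<^sup>2 * B)"
    using B card_mono[of "{..<m}" "{..<m} - {0, 1}"] by (intro mult_right_mono) auto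
  finally show ?thesis by (simp add: mult.assoc)
qed

text \<open>
  With \<open>exp H c = c + H c + R1\<close> and \<open>w = G (exp H c)\<close>, the deviation of \<open>exp (-H) w\<close> from
  \<open>G c + (G H - H G) c\<close> consists of \<open>G R1\<close>, of \<open>H (G c - w)\<close>, and of the remainder of \<open>exp (-H)\<close> at
  \<open>w\<close>. Each of them is of order \<open>\<eta>\<^sup>2\<close>.
\<close>

lemma similarity_transform_linearization:
  assumes nilH: "nilpotent_op m H" and nilmH: "nilpotent_op m H'" and H': "H' = (\<lambda>c S. - H c S)"
    and linH: "linear_op H" and m: "m \<ge> 2"
    and \<eta>: "op_bound \<eta> H" "\<eta> \<le> 1" and G: "linear_op G" "op_bound C G" and c: "\<And>S. \<bar>c S\<bar> \<le> 1"
  shows "\<bar>op_exp H' (G (op_exp H c)) S - G c S - (G (H c) S - H (G c) S)\<bar> \<le> (2 * real m + 1 + (real m)\<^sup>2) * C * \<eta>\<^sup>2"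
proof -
  have \<eta>0: "\<eta> \<ge> 0" "C \<ge> 0" using op_bound_nonneg \<eta>(1) G(2) by auto
  have \<eta>': "op_bound \<eta> H'" using \<eta>(1) by (simp add: H' op_bound_def)
  have sumle: "(\<Sum>k<m. \<eta> ^ k) \<le> m"
  proof -
    have "(\<Sum>k<m. \<eta> ^ k) \<le> (\<Sum>k<m. 1)" using \<eta>0 \<eta>(2) by (intro sum_mono power_le_one) auto
    then show ?thesis by simp
  qed
  let ?E = "op_exp H c"
  let ?w = "G ?E"
  let ?R1 = "\<lambda>S. ?E S - c S - H c S"
  have R1: "\<bar>?R1 S\<bar> \<le> m * \<eta>\<^sup>2" for S
    using op_exp_linearization[OF nilH m \<eta> c] by simp
  have Hc: "\<bar>H c S\<bar> \<le> \<eta>" for S using op_boundD[OF \<eta>(1) c] by simp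
  have E: "\<bar>?E S\<bar> \<le> m" for S
  proof -
    have "\<bar>?E S\<bar> \<le> (\<Sum>k<m. \<eta> ^ k) * 1" by (rule op_boundD[OF op_bound_exp[OF nilH \<eta>(1)] c])
    then show ?thesis using sumle by simp
  qed
  have w: "\<bar>?w S\<bar> \<le> C * m" for S by (rule op_boundD[OF G(2) E])
  have d: "\<bar>?E S - c S\<bar> \<le> (1 + m) * \<eta>" for S
  proof -
    have "\<eta>\<^sup>2 \<le> \<eta>" using \<eta>0 \<eta>(2) by (simp add: power2_eq_square mult_left_le_one_le)
    then have "m * \<eta>\<^sup>2 \<le> m * \<eta>" by (intro mult_left_mono) auto
    moreover have "\<bar>?E S - c S\<bar> \<le> m * \<eta>\<^sup>2 + \<eta>" using R1[of S] Hc[of S] by linarith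
    ultimately show ?thesis by (simp add: algebra_simps)
  qed
  have wd: "\<bar>?w S - G c S\<bar> \<le> C * ((1 + m) * \<eta>)" for S
    using op_boundD[OF G(2), where c = "\<lambda>S. ?E S - c S", OF d] by (simp add: linear_op_diff[OF G(1)])
  have Hw: "\<bar>H ?w S - H (G c) S\<bar> \<le> \<eta> * (C * ((1 + m) * \<eta>))"
    using op_boundD[OF \<eta>(1), where c = "\<lambda>S. ?w S - G c S", OF wd] by (simp add: linear_op_diff[OF linH])
  have GR: "\<bar>?w S - G c S - G (H c) S\<bar> \<le> C * (m * \<eta>\<^sup>2)"
    using op_boundD[OF G(2), where c = ?R1, OF R1] by (simp add: linear_op_diff[OF G(1)])
  have R2: "\<bar>op_exp H' ?w S - ?w S - H' ?w S\<bar> \<le> m * \<eta>\<^sup>2 * (C * m)"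
    by (rule op_exp_linearization[OF nilmH m \<eta>' \<eta>(2) w])
  have "\<bar>op_exp H' ?w S - G c S - (G (H c) S - H (G c) S)\<bar>
      \<le> m * \<eta>\<^sup>2 * (C * m) + \<eta> * (C * ((1 + m) * \<eta>)) + C * (m * \<eta>\<^sup>2)"
    using R2 Hw GR unfolding H' by linarith
  also have "\<dots> = (2 * real m + 1 + (real m)\<^sup>2) * C * \<eta>\<^sup>2"
    by (simp add: algebra_simps power2_eq_square)
  finally show ?thesis by (simp add: add_ac)
qed

section \<open>The coupled cluster mapping and its derivative\<close>

context coupled_cluster begin

lemma finite_multiindices: "finite multiindices"
  unfolding multiindices_def by (rule finite_subset[of _ "Pow {1..K}"]) auto

lemma \<Xi>_subset: "\<Xi> \<subseteq> multiindices - {{1..CARD('n)}}"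
  using \<Xi>_excitations by (simp add: multiindices_def)

lemma finite_\<Xi>: "finite \<Xi>"
  using \<Xi>_subset finite_multiindices by (meson finite_Diff finite_subset)

lemma ref_in_multiindices: "{1..CARD('n)} \<in> multiindices"
  using N_le_K by (auto simp: multiindices_def)

text \<open>
  Slater determinants are orthonormal, so their coefficients compute the inner product.
\<close>

lemma ip_eq: "ip c d = (\<Sum>\<alpha>\<in>multiindices. c \<alpha> * d \<alpha>)"
proof -
  let ?s = "slater \<phi> :: nat set \<Rightarrow> 'n config \<Rightarrow> real"
  have L2: "L2_fun (\<phi> p)" if "p \<in> {1..K}" for p
    using orbitals_H1[OF that] by (simp add: H1_fun_def)
  have int: "integrable lborel (\<lambda>x. ?s \<alpha> x * ?s \<beta> x)"
    and val: "(\<integral>x. ?s \<alpha> x * ?s \<beta> x \<partial>lborel) = (if \<alpha> = \<beta> then 1 else 0)"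
    if "\<alpha> \<in> multiindices" "\<beta> \<in> multiindices" for \<alpha> \<beta>
  proof -
    have \<alpha>: "\<alpha> \<subseteq> {1..K}" "finite \<alpha>" "card \<alpha> = CARD('n)" and \<beta>: "\<beta> \<subseteq> {1..K}" "finite \<beta>" "card \<beta> = CARD('n)"
      using that by (auto simp: multiindices_def intro: finite_subset)
    show "integrable lborel (\<lambda>x. ?s \<alpha> x * ?s \<beta> x)"
      by (rule slater_mult_integrable[OF L2 orbitals_orthonormal \<alpha> \<beta>])
    show "(\<integral>x. ?s \<alpha> x * ?s \<beta> x \<partial>lborel) = (if \<alpha> = \<beta> then 1 else 0)"
      using slater_orthonormal[OF L2 orbitals_orthonormal \<alpha> \<beta>] by (simp add: L2_inner_def)
  qed
  have "wavefun c x * wavefun d x = (\<Sum>\<alpha>\<in>multiindices. \<Sum>\<beta>\<in>multiindices. c \<alpha> * d \<beta> * (?s \<alpha> x * ?s \<beta> x))" for x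
    unfolding wavefun_def sum_product by (intro sum.cong refl) (simp add: mult_ac)
  then have "ip c d = (\<integral>x. (\<Sum>\<alpha>\<in>multiindices. \<Sum>\<beta>\<in>multiindices. c \<alpha> * d \<beta> * (?s \<alpha> x * ?s \<beta> x)) \<partial>lborel)"
    by (simp add: ip_def L2_inner_def)
  also have "\<dots> = (\<Sum>\<alpha>\<in>multiindices. \<Sum>\<beta>\<in>multiindices. c \<alpha> * d \<beta> * (\<integral>x. ?s \<alpha> x * ?s \<beta> x \<partial>lborel))"
  proof -
    have int2: "integrable lborel (\<lambda>x. \<Sum>\<beta>\<in>multiindices. c \<alpha> * d \<beta> * (?s \<alpha> x * ?s \<beta> x))" if "\<alpha> \<in> multiindices" for \<alpha>
      by (intro Bochner_Integration.integrable_sum integrable_mult_right int that)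
    have "(\<integral>x. (\<Sum>\<beta>\<in>multiindices. c \<alpha> * d \<beta> * (?s \<alpha> x * ?s \<beta> x)) \<partial>lborel) =
        (\<Sum>\<beta>\<in>multiindices. c \<alpha> * d \<beta> * (\<integral>x. ?s \<alpha> x * ?s \<beta> x \<partial>lborel))" if "\<alpha> \<in> multiindices" for \<alpha>
      by (subst Bochner_Integration.integral_sum) (simp_all add: int that)
    then show ?thesis
      by (subst Bochner_Integration.integral_sum[OF int2]) simp_all
  qed
  also have "\<dots> = (\<Sum>\<alpha>\<in>multiindices. \<Sum>\<beta>\<in>multiindices. if \<beta> = \<alpha> then c \<alpha> * d \<alpha> else 0)"
    by (intro sum.cong refl) (simp add: val)
  also have "\<dots> = (\<Sum>\<alpha>\<in>multiindices. c \<alpha> * d \<alpha>)"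
    by (intro sum.cong refl) (simp add: finite_multiindices)
  finally show ?thesis .
qed

lemma ip_sum_left: "ip (\<lambda>S. \<Sum>i\<in>A. a i * c i S) d = (\<Sum>i\<in>A. a i * ip (c i) d)"
  unfolding ip_eq sum_distrib_right sum_distrib_left
  by (subst sum.swap) (simp add: mult.assoc)

lemma ip_sum_right: "ip d (\<lambda>S. \<Sum>i\<in>A. a i * c i S) = (\<Sum>i\<in>A. a i * ip d (c i))"
  using ip_sum_left[of a c A d] by (simp add: ip_eq mult.commute)

lemma ip_scale_left: "ip (\<lambda>S. a * c S) v = a * ip c v"
  by (simp add: ip_eq sum_distrib_left mult.assoc)

lemma ip_diff_left: "ip (\<lambda>S. c S - d S) v = ip c v - ip d v"
  by (simp add: ip_eq algebra_simps sum_subtractf)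

definition hole_particle_pairs :: "nat set \<Rightarrow> (nat \<times> nat) list" where
  "hole_particle_pairs \<alpha> =
     zip (sorted_list_of_set (\<alpha> - {1..CARD('n)})) (sorted_list_of_set ({1..CARD('n)} - \<alpha>))"

lemma X_eq_hops: "X \<alpha> = hops (hole_particle_pairs \<alpha>)"
  by (simp add: X_def excitation_eq_hops hole_particle_pairs_def)

lemma
  assumes "\<alpha> \<in> multiindices"
  shows particles_of_pairs: "fst ` set (hole_particle_pairs \<alpha>) = \<alpha> - {1..CARD('n)}"
    and holes_of_pairs: "snd ` set (hole_particle_pairs \<alpha>) = {1..CARD('n)} - \<alpha>"
    and distinct_pairs: "distinct (map fst (hole_particle_pairs \<alpha>))" "distinct (map snd (hole_particle_pairs \<alpha>))"
    and length_pairs: "length (hole_particle_pairs \<alpha>) = card (\<alpha> - {1..CARD('n)})"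
proof -
  have fin: "finite \<alpha>" and card: "card \<alpha> = CARD('n)"
    using assms by (auto simp: multiindices_def intro: finite_subset)
  have "card (\<alpha> - {1..CARD('n)}) = card ({1..CARD('n)} - \<alpha>)"
    using fin card card_Diff_subset_Int[of \<alpha> "{1..CARD('n)}"] card_Diff_subset_Int[of "{1..CARD('n)}" \<alpha>]
    by (simp add: Int_commute)
  then have len: "length (sorted_list_of_set (\<alpha> - {1..CARD('n)})) = length (sorted_list_of_set ({1..CARD('n)} - \<alpha>))"
    by simp
  have m: "map fst (hole_particle_pairs \<alpha>) = sorted_list_of_set (\<alpha> - {1..CARD('n)})"
    "map snd (hole_particle_pairs \<alpha>) = sorted_list_of_set ({1..CARD('n)} - \<alpha>)"
    using len by (simp_all add: hole_particle_pairs_def)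
  show "distinct (map fst (hole_particle_pairs \<alpha>))" "distinct (map snd (hole_particle_pairs \<alpha>))"
    by (simp_all add: m)
  show "fst ` set (hole_particle_pairs \<alpha>) = \<alpha> - {1..CARD('n)}"
    unfolding set_map[symmetric] m using fin by simp
  show "snd ` set (hole_particle_pairs \<alpha>) = {1..CARD('n)} - \<alpha>"
    unfolding set_map[symmetric] m by simp
  show "length (hole_particle_pairs \<alpha>) = card (\<alpha> - {1..CARD('n)})"
    using m(1) by (metis length_map length_sorted_list_of_set)
qed

lemma linear_op_X: "linear_op (X \<alpha>)"
  unfolding X_eq_hops by (rule linear_op_hops)

text \<open>
  Particles of all excitations are virtual and holes are occupied, so the hops involved commute.
\<close>

lemma X_commute: "\<alpha> \<in> multiindices \<Longrightarrow> \<beta> \<in> multiindices \<Longrightarrow> X \<alpha> (X \<beta> c) = X \<beta> (X \<alpha> c)"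
  unfolding X_eq_hops by (rule hops_commute) (auto simp: particles_of_pairs holes_of_pairs)

lemma op_bound_X: "op_bound 1 (X \<alpha>)"
  by (simp add: op_bound_def X_eq_hops hops_bounded)

lemma X_ref: "X {1..CARD('n)} c = c"
  by (simp add: X_eq_hops hole_particle_pairs_def)

text \<open>
  Any multiindex other than the reference contains a virtual orbital, hence its excitation digs a hole.
\<close>

lemma X_holes:
  assumes "\<alpha> \<in> multiindices" "\<alpha> \<noteq> {1..CARD('n)}" "holes_ge {1..CARD('n)} k c"
  shows "holes_ge {1..CARD('n)} (Suc k) (X \<alpha> c)"
proof -
  have fin: "finite \<alpha>" and card: "card \<alpha> = CARD('n)"
    using assms by (auto simp: multiindices_def intro: finite_subset)
  have "\<not> \<alpha> \<subseteq> {1..CARD('n)}"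
    using assms(2) card card_subset_eq[of "{1..CARD('n)}" \<alpha>] by auto
  then have "card (\<alpha> - {1..CARD('n)}) \<ge> 1" using fin by (simp add: Suc_le_eq card_gt_0_iff)
  moreover have "holes_ge {1..CARD('n)} (k + length (hole_particle_pairs \<alpha>)) (hops (hole_particle_pairs \<alpha>) c)"
    by (rule hops_holes) (use assms in \<open>auto simp: particles_of_pairs holes_of_pairs\<close>)
  ultimately show ?thesis
    using assms(1) by (fastforce simp: holes_ge_def X_eq_hops length_pairs)
qed

text \<open>
  The vectors in the span of Slater determinants, on which \<open>ip\<close> is definite. The type also contains
  vectors with other coefficients, and \<open>ip\<close> ignores these.
\<close>

definition supported :: "fock \<Rightarrow> bool" where
  "supported c \<longleftrightarrow> (\<forall>S. c S \<noteq> 0 \<longrightarrow> S \<in> multiindices)"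

lemma supported_X:
  assumes "\<alpha> \<in> multiindices" "supported c"
  shows "supported (X \<alpha> c)"
  unfolding supported_def
proof (intro allI impI)
  fix S assume "X \<alpha> c S \<noteq> 0"
  then have "S \<subseteq> {1..K} \<and> card S = CARD('n)"
    unfolding X_eq_hops
    by (rule hops_support[of _ "{1..CARD('n)}", rotated -1])
      (use assms in \<open>auto simp: particles_of_pairs holes_of_pairs supported_def multiindices_def\<close>)
  then show "S \<in> multiindices" by (simp add: multiindices_def)
qed

lemma supported_sum: "(\<And>i. i \<in> A \<Longrightarrow> supported (c i)) \<Longrightarrow> supported (\<lambda>S. \<Sum>i\<in>A. a i * c i S)"
  unfolding supported_def by (metis (no_types, lifting) mult_zero_right sum.neutral)

text \<open>
  Stated with \<open>\<Phi> \<alpha> \<alpha>\<close>, so that this coefficient names the sign between the two bases.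
\<close>

lemma \<Phi>_eq_ket:
  assumes "\<alpha> \<in> multiindices"
  shows "\<Phi> \<alpha> = (\<lambda>S. \<Phi> \<alpha> \<alpha> * ket \<alpha> S)" "\<Phi> \<alpha> \<alpha> * \<Phi> \<alpha> \<alpha> = 1"
proof -
  have "\<exists>\<sigma>\<in>{1, -1}. hops (hole_particle_pairs \<alpha>) (ket {1..CARD('n)}) =
     (\<lambda>S. \<sigma> * ket ({1..CARD('n)} - snd ` set (hole_particle_pairs \<alpha>) \<union> fst ` set (hole_particle_pairs \<alpha>)) S)"
    by (rule hops_ket) (use assms in \<open>auto simp: particles_of_pairs holes_of_pairs distinct_pairs simp del: set_map\<close>)
  moreover have "{1..CARD('n)} - ({1..CARD('n)} - \<alpha>) \<union> (\<alpha> - {1..CARD('n)}) = \<alpha>" by auto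
  ultimately have "\<exists>\<sigma>\<in>{1, -1}. \<Phi> \<alpha> = (\<lambda>S. \<sigma> * ket \<alpha> S)"
    unfolding \<Phi>_def \<Phi>0_def X_eq_hops by (simp only: particles_of_pairs[OF assms] holes_of_pairs[OF assms])
  then obtain \<sigma> where \<sigma>: "\<sigma> \<in> {1, -1}" "\<Phi> \<alpha> = (\<lambda>S. \<sigma> * ket \<alpha> S)" by blast
  then have "\<Phi> \<alpha> \<alpha> = \<sigma>" by (simp add: ket_def)
  then show "\<Phi> \<alpha> = (\<lambda>S. \<Phi> \<alpha> \<alpha> * ket \<alpha> S)" "\<Phi> \<alpha> \<alpha> * \<Phi> \<alpha> \<alpha> = 1"
    using \<sigma> by auto
qed

lemma ip_\<Phi>: "\<alpha> \<in> multiindices \<Longrightarrow> ip c (\<Phi> \<alpha>) = c \<alpha> * \<Phi> \<alpha> \<alpha>"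
proof -
  assume \<alpha>: "\<alpha> \<in> multiindices"
  have "ip c (\<Phi> \<alpha>) = (\<Sum>\<beta>\<in>multiindices. if \<beta> = \<alpha> then c \<alpha> * \<Phi> \<alpha> \<alpha> else 0)"
    unfolding ip_eq by (subst \<Phi>_eq_ket(1)[OF \<alpha>]) (intro sum.cong refl, auto simp: ket_def)
  then show ?thesis using \<alpha> by (simp add: finite_multiindices)
qed

lemma ip_\<Phi>_\<Phi>: "\<alpha> \<in> multiindices \<Longrightarrow> \<beta> \<in> multiindices \<Longrightarrow> ip (\<Phi> \<alpha>) (\<Phi> \<beta>) = (if \<alpha> = \<beta> then 1 else 0)"
  using \<Phi>_eq_ket[of \<alpha>] ip_\<Phi>[of \<beta> "\<Phi> \<alpha>"] by (metis ket_def mult_zero_left mult_zero_right)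

lemma supported_expansion:
  assumes "supported c"
  shows "c = (\<lambda>S. \<Sum>\<gamma>\<in>multiindices. ip c (\<Phi> \<gamma>) * \<Phi> \<gamma> S)"
proof
  fix S
  have "ip c (\<Phi> \<gamma>) * \<Phi> \<gamma> S = (if S = \<gamma> then c S else 0)" if "\<gamma> \<in> multiindices" for \<gamma>
  proof -
    have "ip c (\<Phi> \<gamma>) * \<Phi> \<gamma> S = c \<gamma> * (\<Phi> \<gamma> \<gamma> * \<Phi> \<gamma> \<gamma>) * ket \<gamma> S"
      using fun_cong[OF \<Phi>_eq_ket(1)[OF that], of S] ip_\<Phi>[OF that, of c] by simp
    then show ?thesis by (simp add: \<Phi>_eq_ket(2)[OF that] ket_def)
  qed
  then have "(\<Sum>\<gamma>\<in>multiindices. ip c (\<Phi> \<gamma>) * \<Phi> \<gamma> S) = (\<Sum>\<gamma>\<in>multiindices. if S = \<gamma> then c S else 0)"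
    by (intro sum.cong refl)
  also have "\<dots> = c S" using assms by (auto simp: finite_multiindices supported_def)
  finally show "c S = (\<Sum>\<gamma>\<in>multiindices. ip c (\<Phi> \<gamma>) * \<Phi> \<gamma> S)" by simp
qed

lemma abs_\<Phi>0: "\<bar>\<Phi>0 S\<bar> \<le> 1"
  by (simp add: \<Phi>0_def ket_def)

lemma \<Phi>_ref: "\<Phi> {1..CARD('n)} = \<Phi>0"
  unfolding \<Phi>_def by (rule X_ref)

lemma cluster_\<Phi>0: "cluster s \<Phi>0 = (\<lambda>S. \<Sum>\<alpha>\<in>\<Xi>. s \<alpha> * \<Phi> \<alpha> S)"
  by (simp add: cluster_def \<Phi>_def)

lemma cluster_ket:
  assumes "\<alpha> \<in> \<Xi>" shows "cluster (ket \<alpha>) c = X \<alpha> c"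
proof
  fix S
  have "cluster (ket \<alpha>) c S = (\<Sum>\<beta>\<in>\<Xi>. if \<beta> = \<alpha> then X \<alpha> c S else 0)"
    unfolding cluster_def by (intro sum.cong refl) (simp add: ket_def)
  then show "cluster (ket \<alpha>) c S = X \<alpha> c S" using assms by (simp add: finite_\<Xi>)
qed

lemma cluster_minus: "(\<lambda>v S. - cluster t v S) = cluster (\<lambda>\<alpha>. - t \<alpha>)"
  by (simp add: cluster_def fun_eq_iff sum_negf)

lemma linear_op_cluster: "linear_op (cluster t)"
  unfolding cluster_def[abs_def] by (intro linear_op_combination linear_op_X)

lemma op_bound_cluster: "op_bound (\<Sum>\<alpha>\<in>\<Xi>. \<bar>t \<alpha>\<bar>) (cluster t)"
  unfolding cluster_def[abs_def] using op_bound_combination[of \<Xi> "\<lambda>_. 1" X t] op_bound_X by simp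

lemma cluster_X: "\<alpha> \<in> multiindices \<Longrightarrow> cluster t (X \<alpha> c) = X \<alpha> (cluster t c)"
  unfolding cluster_def linear_op_sum[OF linear_op_X]
  using \<Xi>_subset by (intro ext sum.cong refl) (metis DiffD1 X_commute subsetD)

lemma cluster_commute: "cluster t (cluster u c) = cluster u (cluster t c)"
proof -
  have "cluster t (cluster u c) = (\<lambda>S. \<Sum>\<beta>\<in>\<Xi>. u \<beta> * cluster t (X \<beta> c) S)"
    unfolding cluster_def[of u] linear_op_sum[OF linear_op_cluster] ..
  also have "\<dots> = cluster u (cluster t c)"
    unfolding cluster_def[of u] using \<Xi>_subset by (intro ext sum.cong refl) (metis DiffD1 cluster_X subsetD)
  finally show ?thesis .
qed

text \<open>
  After more than \<open>N\<close> excitations there would be more than \<open>N\<close> holes among \<open>N\<close> occupied orbitals.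
\<close>

lemma nilpotent_cluster: "nilpotent_op (Suc CARD('n)) (cluster t)"
proof -
  have step: "holes_ge {1..CARD('n)} (Suc k) (cluster t c)" if "holes_ge {1..CARD('n)} k c" for k c
    unfolding holes_ge_def
  proof (intro allI impI)
    fix S assume "cluster t c S \<noteq> 0"
    then obtain \<alpha> where "\<alpha> \<in> \<Xi>" "X \<alpha> c S \<noteq> 0"
      unfolding cluster_def by (metis (no_types, lifting) mult_zero_right sum.neutral)
    moreover have "holes_ge {1..CARD('n)} (Suc k) (X \<alpha> c)" if "\<alpha> \<in> \<Xi>" for \<alpha>
      using that \<Xi>_subset \<open>holes_ge _ k c\<close> by (intro X_holes) auto
    ultimately show "Suc k \<le> card ({1..CARD('n)} - S)" by (auto simp: holes_ge_def)
  qed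
  have holes: "holes_ge {1..CARD('n)} k ((cluster t ^^ k) c)" for k c
  proof (induction k)
    case (Suc k)
    then show ?case using step[OF Suc] by (simp del: One_nat_def)
  qed (simp add: holes_ge_def)
  have "(cluster t ^^ k) c S = 0" if "k \<ge> Suc CARD('n)" for k c S
  proof (rule ccontr)
    assume "(cluster t ^^ k) c S \<noteq> 0"
    then have "k \<le> card ({1..CARD('n)} - S)" using holes[of k c] by (simp add: holes_ge_def)
    also have "\<dots> \<le> card {1..CARD('n)}" by (intro card_mono) auto
    finally show False using that by simp
  qed
  then show ?thesis by (auto simp: nilpotent_op_def)
qed

lemma supported_exp_cluster: "supported c \<Longrightarrow> supported (op_exp (cluster t) c)"
proof -
  assume c: "supported c"
  have "supported (cluster t d)" if "supported d" for d
    unfolding cluster_def using \<Xi>_subset that by (intro supported_sum supported_X) auto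
  then have "supported ((cluster t ^^ k) c)" for k by (induction k) (auto simp: c)
  then have "supported (\<lambda>S. \<Sum>k<Suc CARD('n). (1 / fact k) * (cluster t ^^ k) c S)"
    by (intro supported_sum)
  then show ?thesis using op_exp_nilpotent[OF nilpotent_cluster order_refl] by simp
qed

lemma op_exp_cluster_add:
  "op_exp (cluster (\<lambda>\<alpha>. t \<alpha> + h \<alpha>)) c = op_exp (cluster t) (op_exp (cluster h) c)"
proof -
  have "cluster (\<lambda>\<alpha>. t \<alpha> + h \<alpha>) = (\<lambda>v S. cluster t v S + cluster h v S)"
    by (simp add: cluster_def fun_eq_iff algebra_simps sum.distrib)
  then show ?thesis
    using op_exp_add_commuting[where T = "cluster t" and H = "cluster h" and m = "Suc CARD('n)" and c = c]
    by (simp add: linear_op_cluster nilpotent_cluster cluster_commute[of t h])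
qed

lemma H_op_eq: "H_op = (\<lambda>c S. \<Sum>\<alpha>\<in>multiindices. \<Sum>\<beta>\<in>multiindices.
   hamiltonian_form V w (slater \<phi> \<alpha> :: 'n config \<Rightarrow> real) (slater \<phi> \<beta>) * (c \<alpha> * ket \<beta> S))"
proof (intro ext)
  fix c S
  let ?h = "\<lambda>\<alpha> \<beta>. hamiltonian_form V w (slater \<phi> \<alpha> :: 'n config \<Rightarrow> real) (slater \<phi> \<beta>)"
  have "(\<Sum>\<beta>\<in>multiindices. ?h \<alpha> \<beta> * (c \<alpha> * ket \<beta> S)) = (if S \<in> multiindices then c \<alpha> * ?h \<alpha> S else 0)" for \<alpha>
  proof -
    have "(\<Sum>\<beta>\<in>multiindices. ?h \<alpha> \<beta> * (c \<alpha> * ket \<beta> S)) = (\<Sum>\<beta>\<in>multiindices. if S = \<beta> then c \<alpha> * ?h \<alpha> S else 0)"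
      by (intro sum.cong refl) (simp add: ket_def)
    then show ?thesis by (simp add: finite_multiindices)
  qed
  then show "H_op c S = (\<Sum>\<alpha>\<in>multiindices. \<Sum>\<beta>\<in>multiindices. ?h \<alpha> \<beta> * (c \<alpha> * ket \<beta> S))"
    by (simp add: H_op_def)
qed

lemma linear_op_H_op: "linear_op H_op"
  unfolding linear_op_def H_op_def
  by (auto simp: fun_eq_iff sum_distrib_left algebra_simps sum.distrib)

lemma op_bound_H_op: "\<exists>C. op_bound C H_op"
proof -
  let ?h = "\<lambda>\<alpha> \<beta>. hamiltonian_form V w (slater \<phi> \<alpha> :: 'n config \<Rightarrow> real) (slater \<phi> \<beta>)"
  have "op_bound (\<Sum>\<alpha>\<in>multiindices. \<Sum>\<beta>\<in>multiindices. \<bar>?h \<alpha> \<beta>\<bar>) H_op"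
    unfolding op_bound_def
  proof (intro conjI allI impI)
    fix c :: fock and B :: real and S assume c: "\<forall>S. \<bar>c S\<bar> \<le> B"
    have "\<bar>H_op c S\<bar> \<le> (\<Sum>\<alpha>\<in>multiindices. \<Sum>\<beta>\<in>multiindices. \<bar>?h \<alpha> \<beta> * (c \<alpha> * ket \<beta> S)\<bar>)"
      unfolding H_op_eq by (rule order_trans[OF sum_abs sum_mono[OF sum_abs]])
    also have "\<dots> \<le> (\<Sum>\<alpha>\<in>multiindices. \<Sum>\<beta>\<in>multiindices. \<bar>?h \<alpha> \<beta>\<bar> * B)"
    proof (intro sum_mono)
      fix \<alpha> \<beta>
      have "\<bar>c \<alpha> * ket \<beta> S\<bar> \<le> B" using c order_trans[OF abs_ge_zero, of "c \<alpha>" B] by (auto simp: ket_def)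
      then show "\<bar>?h \<alpha> \<beta> * (c \<alpha> * ket \<beta> S)\<bar> \<le> \<bar>?h \<alpha> \<beta>\<bar> * B"
        unfolding abs_mult[of "?h \<alpha> \<beta>"] by (intro mult_left_mono) auto
    qed
    finally show "\<bar>H_op c S\<bar> \<le> (\<Sum>\<alpha>\<in>multiindices. \<Sum>\<beta>\<in>multiindices. \<bar>?h \<alpha> \<beta>\<bar>) * B"
      by (simp add: sum_distrib_right)
  qed (intro sum_nonneg abs_ge_zero)
  then show ?thesis ..
qed

lemma H_sim_eq: "H_sim t c = op_exp (cluster (\<lambda>\<alpha>. - t \<alpha>)) (H_op (op_exp (cluster t) c))"
  by (simp add: H_sim_def cluster_minus)

text \<open>
  Moving the base point of the CC mapping to \<open>t\<close>: an increment \<open>h\<close> conjugates the transformed Hamiltonian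
  once more.
\<close>

lemma H_sim_add:
  "H_sim (\<lambda>\<alpha>. t \<alpha> + h \<alpha>) c = op_exp (cluster (\<lambda>\<alpha>. - h \<alpha>)) (H_sim t (op_exp (cluster h) c))"
proof -
  have "(\<lambda>\<alpha>. - (t \<alpha> + h \<alpha>)) = (\<lambda>\<alpha>. - h \<alpha> + - t \<alpha>)" by auto
  then show ?thesis
    unfolding H_sim_eq by (simp only: op_exp_cluster_add[of "\<lambda>\<alpha>. - h \<alpha>" "\<lambda>\<alpha>. - t \<alpha>"] op_exp_cluster_add[of t h])
qed

lemma linear_op_H_sim: "linear_op (H_sim t)"
  unfolding H_sim_eq[abs_def]
  by (rule linear_op_comp[OF linear_op_exp[OF nilpotent_cluster linear_op_cluster]
      linear_op_comp[OF linear_op_H_op linear_op_exp[OF nilpotent_cluster linear_op_cluster]]])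

lemma op_bound_H_sim: "\<exists>C. op_bound C (H_sim t)"
proof -
  obtain C where C: "op_bound C H_op" using op_bound_H_op ..
  show ?thesis
    unfolding H_sim_eq[abs_def]
    by (rule exI, rule op_bound_comp[OF op_bound_exp[OF nilpotent_cluster op_bound_cluster]
        op_bound_comp[OF C op_bound_exp[OF nilpotent_cluster op_bound_cluster]]])
qed

lemma supported_H_sim: "supported (H_sim t c)"
  unfolding H_sim_eq by (rule supported_exp_cluster) (simp add: supported_def H_op_def)

lemma ip_cluster_\<Phi>0: "ip c (cluster s \<Phi>0) = (\<Sum>\<alpha>\<in>\<Xi>. s \<alpha> * ip c (\<Phi> \<alpha>))"
  unfolding cluster_\<Phi>0 by (rule ip_sum_right)

lemma cc_map_ket: "\<alpha> \<in> \<Xi> \<Longrightarrow> cc_map t (ket \<alpha>) = ip (H_sim t \<Phi>0) (\<Phi> \<alpha>)"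
  by (simp add: cc_map_def cluster_ket \<Phi>_def)

text \<open>
  The commutator of \<open>H_sim t\<close> and the cluster operator of \<open>h\<close>, applied to the reference.
\<close>

definition cc_derivative :: "amplitudes \<Rightarrow> amplitudes \<Rightarrow> amplitudes \<Rightarrow> real" where
  "cc_derivative t h s =
     ip (\<lambda>S. H_sim t (cluster h \<Phi>0) S - cluster h (H_sim t \<Phi>0) S) (cluster s \<Phi>0)"

lemma abs_ip_cluster_\<Phi>0:
  assumes "\<And>S. \<bar>c S\<bar> \<le> B"
  shows "\<bar>ip c (cluster s \<Phi>0)\<bar> \<le> B * (\<Sum>\<alpha>\<in>\<Xi>. \<bar>s \<alpha>\<bar>)"
proof -
  have "\<bar>ip c (cluster s \<Phi>0)\<bar> \<le> (\<Sum>\<alpha>\<in>\<Xi>. \<bar>s \<alpha> * ip c (\<Phi> \<alpha>)\<bar>)"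
    unfolding ip_cluster_\<Phi>0 by (rule sum_abs)
  also have "\<dots> \<le> (\<Sum>\<alpha>\<in>\<Xi>. \<bar>s \<alpha>\<bar> * B)"
  proof (rule sum_mono)
    fix \<alpha> assume "\<alpha> \<in> \<Xi>"
    then have \<alpha>: "\<alpha> \<in> multiindices" using \<Xi>_subset by auto
    have "\<bar>\<Phi> \<alpha> \<alpha>\<bar> = 1" using \<Phi>_eq_ket(2)[OF \<alpha>] by (metis abs_1 abs_mult_self_eq abs_square_eq_1 power2_eq_square)
    then have "\<bar>ip c (\<Phi> \<alpha>)\<bar> \<le> B" using assms[of \<alpha>] by (simp add: ip_\<Phi>[OF \<alpha>] abs_mult)
    then show "\<bar>s \<alpha> * ip c (\<Phi> \<alpha>)\<bar> \<le> \<bar>s \<alpha>\<bar> * B" by (simp add: abs_mult mult_left_mono)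
  qed
  also have "\<dots> = B * (\<Sum>\<alpha>\<in>\<Xi>. \<bar>s \<alpha>\<bar>)" by (simp add: sum_distrib_left mult.commute)
  finally show ?thesis .
qed

lemma sum_abs_le_card_L2_set: "(\<Sum>\<alpha>\<in>\<Xi>. \<bar>h \<alpha>\<bar>) \<le> card \<Xi> * L2_set h \<Xi>"
  using sum_bounded_above[of \<Xi> "\<lambda>\<alpha>. \<bar>h \<alpha>\<bar>" "L2_set h \<Xi>"] abs_le_L2_set[OF finite_\<Xi>] by simp

text \<open>
  The expansion of the similarity transform at \<open>\<Phi>0\<close>. The restriction on \<open>h\<close> makes the sum of its
  amplitudes, which bounds the cluster operator, at most \<open>1\<close>.
\<close>

lemma cc_map_linearization:
  "\<exists>C\<ge>0. \<forall>h s. card \<Xi> * L2_set h \<Xi> \<le> 1 \<longrightarrow>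
     \<bar>cc_map (\<lambda>\<alpha>. t \<alpha> + h \<alpha>) s - cc_map t s - cc_derivative t h s\<bar> \<le> C * (L2_set h \<Xi>)\<^sup>2 * L2_set s \<Xi>"
proof -
  obtain B where B: "op_bound B (H_sim t)" using op_bound_H_sim ..
  define m where "m = Suc CARD('n)"
  have m: "m \<ge> 2" using zero_less_card_finite[where 'a = 'n] by (simp add: m_def)
  define C where "C = (2 * real m + 1 + (real m)\<^sup>2) * B"
  have C: "C \<ge> 0" using op_bound_nonneg[OF B] by (simp add: C_def)
  let ?n = "real (card \<Xi>)"
  have "\<bar>cc_map (\<lambda>\<alpha>. t \<alpha> + h \<alpha>) s - cc_map t s - cc_derivative t h s\<bar> \<le> (C * ?n\<^sup>2 * ?n) * (L2_set h \<Xi>)\<^sup>2 * L2_set s \<Xi>"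
    if h: "?n * L2_set h \<Xi> \<le> 1" for h s
  proof -
    let ?\<eta> = "\<Sum>\<alpha>\<in>\<Xi>. \<bar>h \<alpha>\<bar>"
    have \<eta>: "?\<eta> \<le> ?n * L2_set h \<Xi>" by (rule sum_abs_le_card_L2_set)
    have \<eta>0: "?\<eta> \<ge> 0" by (intro sum_nonneg) simp
    let ?R = "\<lambda>S. H_sim (\<lambda>\<alpha>. t \<alpha> + h \<alpha>) \<Phi>0 S - H_sim t \<Phi>0 S - (H_sim t (cluster h \<Phi>0) S - cluster h (H_sim t \<Phi>0) S)"
    have "\<bar>?R S\<bar> \<le> C * ?\<eta>\<^sup>2" for S
      unfolding H_sim_add C_def
    proof (rule similarity_transform_linearization)
      show "nilpotent_op m (cluster h)" "nilpotent_op m (cluster (\<lambda>\<alpha>. - h \<alpha>))"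
        unfolding m_def by (rule nilpotent_cluster)+
      show "cluster (\<lambda>\<alpha>. - h \<alpha>) = (\<lambda>v S. - cluster h v S)" by (rule cluster_minus[symmetric])
      show "?\<eta> \<le> 1" using \<eta> h by linarith
    qed (rule linear_op_cluster m op_bound_cluster linear_op_H_sim B abs_\<Phi>0)+
    moreover have "C * ?\<eta>\<^sup>2 \<le> C * (?n * L2_set h \<Xi>)\<^sup>2"
      using \<eta> \<eta>0 C by (intro mult_left_mono power_mono)
    ultimately have R: "\<bar>?R S\<bar> \<le> C * (?n * L2_set h \<Xi>)\<^sup>2" for S by (meson order_trans)
    have "\<bar>cc_map (\<lambda>\<alpha>. t \<alpha> + h \<alpha>) s - cc_map t s - cc_derivative t h s\<bar> = \<bar>ip ?R (cluster s \<Phi>0)\<bar>"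
      by (simp add: cc_map_def cc_derivative_def ip_diff_left)
    also have "\<dots> \<le> C * (?n * L2_set h \<Xi>)\<^sup>2 * (\<Sum>\<alpha>\<in>\<Xi>. \<bar>s \<alpha>\<bar>)"
      by (rule abs_ip_cluster_\<Phi>0[OF R])
    also have "\<dots> \<le> C * (?n * L2_set h \<Xi>)\<^sup>2 * (?n * L2_set s \<Xi>)"
      using C by (intro mult_left_mono sum_abs_le_card_L2_set) auto
    also have "\<dots> = (C * ?n\<^sup>2 * ?n) * (L2_set h \<Xi>)\<^sup>2 * L2_set s \<Xi>"
      by (simp add: power_mult_distrib mult_ac)
    finally show ?thesis .
  qed
  then show ?thesis using C by (intro exI[of _ "C * ?n\<^sup>2 * ?n"]) auto
qed

lemma cc_derivative_expand_right: "cc_derivative t h s = (\<Sum>\<beta>\<in>\<Xi>. s \<beta> * cc_derivative t h (ket \<beta>))"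
  unfolding cc_derivative_def ip_cluster_\<Phi>0[of _ s] by (intro sum.cong refl) (simp add: cluster_ket \<Phi>_def)

lemma cc_derivative_expand_left: "cc_derivative t h s = (\<Sum>\<alpha>\<in>\<Xi>. h \<alpha> * cc_derivative t (ket \<alpha>) s)"
proof -
  have "(\<lambda>S. H_sim t (cluster h \<Phi>0) S - cluster h (H_sim t \<Phi>0) S)
      = (\<lambda>S. \<Sum>\<alpha>\<in>\<Xi>. h \<alpha> * (H_sim t (X \<alpha> \<Phi>0) S - X \<alpha> (H_sim t \<Phi>0) S))"
    unfolding cluster_def linear_op_sum[OF linear_op_H_sim]
    by (simp add: algebra_simps sum_subtractf)
  then show ?thesis
    unfolding cc_derivative_def by (simp add: ip_sum_left cluster_ket)
qed

lemma linear_functional_expansion: "linear_functional (\<lambda>s. \<Sum>\<alpha>\<in>\<Xi>. s \<alpha> * f \<alpha>)"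
  unfolding linear_functional_def by (simp add: algebra_simps sum.distrib sum_distrib_left)

lemma cc_has_derivative_cc_derivative: "cc_has_derivative t (cc_derivative t)"
  unfolding cc_has_derivative_def
proof (intro conjI ballI allI impI)
  fix h show "linear_functional (cc_derivative t h)"
    using linear_functional_expansion[of "\<lambda>\<beta>. cc_derivative t h (ket \<beta>)"]
    by (simp flip: cc_derivative_expand_right)
next
  fix s show "linear_functional (\<lambda>h. cc_derivative t h s)"
    using linear_functional_expansion[of "\<lambda>\<alpha>. cc_derivative t (ket \<alpha>) s"]
    by (simp flip: cc_derivative_expand_left)
next
  fix \<epsilon> :: real assume \<epsilon>: "\<epsilon> > 0"
  obtain C where C: "C \<ge> 0" "\<And>h s. card \<Xi> * L2_set h \<Xi> \<le> 1 \<Longrightarrow>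
     \<bar>cc_map (\<lambda>\<alpha>. t \<alpha> + h \<alpha>) s - cc_map t s - cc_derivative t h s\<bar> \<le> C * (L2_set h \<Xi>)\<^sup>2 * L2_set s \<Xi>"
    using cc_map_linearization[of t] by blast
  define \<delta> where "\<delta> = min (1 / (card \<Xi> + 1)) (\<epsilon> / (C + 1))"
  show "\<exists>\<delta>>0. \<forall>h\<in>amplitude_space. L2_set h \<Xi> < \<delta> \<longrightarrow> (\<forall>s\<in>amplitude_space.
     \<bar>cc_map (\<lambda>\<alpha>. t \<alpha> + h \<alpha>) s - cc_map t s - cc_derivative t h s\<bar> \<le> \<epsilon> * L2_set h \<Xi> * L2_set s \<Xi>)"
  proof (intro exI[of _ \<delta>] conjI ballI impI)
    show "\<delta> > 0" using \<epsilon> C by (simp add: \<delta>_def)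
    fix h s assume h: "L2_set h \<Xi> < \<delta>"
    have h1: "L2_set h \<Xi> * (card \<Xi> + 1) < 1" and h2: "L2_set h \<Xi> * (C + 1) < \<epsilon>"
      using h C(1) unfolding \<delta>_def min_less_iff_conj by (auto simp: pos_less_divide_eq)
    have L: "L2_set h \<Xi> \<ge> 0" "L2_set s \<Xi> \<ge> 0" by (auto simp: L2_set_nonneg)
    have "L2_set h \<Xi> * card \<Xi> + L2_set h \<Xi> < 1" using h1 by (simp add: algebra_simps)
    then have "card \<Xi> * L2_set h \<Xi> \<le> 1" using L(1) by (subst mult.commute) linarith
    then have "\<bar>cc_map (\<lambda>\<alpha>. t \<alpha> + h \<alpha>) s - cc_map t s - cc_derivative t h s\<bar>
        \<le> (C * L2_set h \<Xi>) * L2_set h \<Xi> * L2_set s \<Xi>"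
      using C(2)[of h s] by (simp add: power2_eq_square mult.assoc)
    also have "\<dots> \<le> \<epsilon> * L2_set h \<Xi> * L2_set s \<Xi>"
    proof (intro mult_right_mono L)
      have "C * L2_set h \<Xi> + L2_set h \<Xi> < \<epsilon>" using h2 by (simp add: algebra_simps)
      then show "C * L2_set h \<Xi> \<le> \<epsilon>" using L(1) by linarith
    qed
    finally show "\<bar>cc_map (\<lambda>\<alpha>. t \<alpha> + h \<alpha>) s - cc_map t s - cc_derivative t h s\<bar>
        \<le> \<epsilon> * L2_set h \<Xi> * L2_set s \<Xi>" .
  qed
qed

lemma amplitude_space_scale: "h \<in> amplitude_space \<Longrightarrow> (\<lambda>\<alpha>. a * h \<alpha>) \<in> amplitude_space"
  by (simp add: amplitude_space_def)

lemma ket_in_amplitude_space: "\<alpha> \<in> \<Xi> \<Longrightarrow> ket \<alpha> \<in> amplitude_space"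
  by (auto simp: amplitude_space_def ket_def)

lemma linear_functional_scale:
  "linear_functional f \<Longrightarrow> s \<in> amplitude_space \<Longrightarrow> f (\<lambda>\<alpha>. a * s \<alpha>) = a * f s"
  unfolding linear_functional_def by (drule bspec[of _ _ s], assumption, drule bspec[of _ _ s], assumption, drule spec[of _ a], drule spec[of _ 0]) simp

text \<open>
  Along \<open>a * h\<close> with small \<open>a > 0\<close> both derivatives approximate the same increment, and by linearity
  the factor \<open>a\<close> cancels.
\<close>

lemma cc_derivative_unique:
  assumes L: "cc_has_derivative t L" and M: "cc_has_derivative t M" and h: "h \<in> amplitude_space" and s: "s \<in> amplitude_space"
  shows "L h s = M h s"
proof (rule ccontr)
  assume ne: "L h s \<noteq> M h s"
  let ?p = "L2_set h \<Xi> * L2_set s \<Xi>"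
  have p: "?p \<ge> 0" by (simp add: L2_set_nonneg)
  \<comment> \<open>Chosen such that \<open>2 * \<epsilon> * ?p\<close>, which bounds the difference, is less than the difference.\<close>
  define \<epsilon> where "\<epsilon> = \<bar>L h s - M h s\<bar> / (2 * ?p + 1) / 2"
  have \<epsilon>: "\<epsilon> > 0" using ne p by (simp add: \<epsilon>_def add_nonneg_pos)
  obtain d1 where d1: "d1 > 0" "\<And>k. k \<in> amplitude_space \<Longrightarrow> L2_set k \<Xi> < d1 \<Longrightarrow>
      \<bar>cc_map (\<lambda>\<alpha>. t \<alpha> + k \<alpha>) s - cc_map t s - L k s\<bar> \<le> \<epsilon> * L2_set k \<Xi> * L2_set s \<Xi>"
    using L \<epsilon> s unfolding cc_has_derivative_def by meson
  obtain d2 where d2: "d2 > 0" "\<And>k. k \<in> amplitude_space \<Longrightarrow> L2_set k \<Xi> < d2 \<Longrightarrow>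
      \<bar>cc_map (\<lambda>\<alpha>. t \<alpha> + k \<alpha>) s - cc_map t s - M k s\<bar> \<le> \<epsilon> * L2_set k \<Xi> * L2_set s \<Xi>"
    using M \<epsilon> s unfolding cc_has_derivative_def by meson
  define a where "a = min d1 d2 / (L2_set h \<Xi> + 1)"
  have L0: "L2_set h \<Xi> \<ge> 0" by (rule L2_set_nonneg)
  have a: "a > 0" using d1(1) d2(1) L0 by (simp add: a_def add_nonneg_pos)
  let ?k = "\<lambda>\<alpha>. a * h \<alpha>"
  have k: "?k \<in> amplitude_space" by (rule amplitude_space_scale[OF h])
  have Lk: "L2_set ?k \<Xi> = a * L2_set h \<Xi>" using a by (simp flip: L2_set_right_distrib)
  have "L2_set h \<Xi> + 1 \<noteq> 0" using L0 by linarith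
  then have "a * (L2_set h \<Xi> + 1) = min d1 d2" by (simp add: a_def)
  then have "a * L2_set h \<Xi> + a = min d1 d2" by (simp add: algebra_simps)
  then have "L2_set ?k \<Xi> < min d1 d2" using a unfolding Lk by linarith
  then have b: "\<bar>cc_map (\<lambda>\<alpha>. t \<alpha> + ?k \<alpha>) s - cc_map t s - L ?k s\<bar> \<le> \<epsilon> * L2_set ?k \<Xi> * L2_set s \<Xi>"
    "\<bar>cc_map (\<lambda>\<alpha>. t \<alpha> + ?k \<alpha>) s - cc_map t s - M ?k s\<bar> \<le> \<epsilon> * L2_set ?k \<Xi> * L2_set s \<Xi>"
    using d1(2)[OF k] d2(2)[OF k] by auto
  have "L ?k s = a * L h s" "M ?k s = a * M h s"
    using L M s h linear_functional_scale[of "\<lambda>h. L h s" h a] linear_functional_scale[of "\<lambda>h. M h s" h a]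
    by (auto simp: cc_has_derivative_def)
  then have "a * \<bar>L h s - M h s\<bar> = \<bar>L ?k s - M ?k s\<bar>"
    using a by (simp add: abs_mult flip: right_diff_distrib)
  also have "\<dots> \<le> 2 * (\<epsilon> * L2_set ?k \<Xi> * L2_set s \<Xi>)" using b by linarith
  also have "\<dots> = a * (2 * \<epsilon> * ?p)" by (simp add: Lk)
  finally have "\<bar>L h s - M h s\<bar> \<le> 2 * \<epsilon> * ?p" using a by simp
  also have "\<dots> < 2 * \<epsilon> * (2 * ?p + 1)" using \<epsilon> p by (intro mult_strict_left_mono) linarith+
  also have "\<dots> = \<bar>L h s - M h s\<bar>"
  proof -
    have "2 * (d / q / 2) * q = d" if "q \<noteq> 0" for d q :: real using that by simp
    moreover have "2 * ?p + 1 \<noteq> 0" using p by linarith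
    ultimately show ?thesis unfolding \<epsilon>_def by blast
  qed
  finally show False by simp
qed

lemma linear_functional_eq_sum:
  assumes f: "linear_functional f" and s: "s \<in> amplitude_space"
  shows "f s = (\<Sum>\<beta>\<in>\<Xi>. s \<beta> * f (ket \<beta>))"
proof -
  have *: "f (\<lambda>\<alpha>. \<Sum>\<beta>\<in>F. s \<beta> * ket \<beta> \<alpha>) = (\<Sum>\<beta>\<in>F. s \<beta> * f (ket \<beta>))" if "finite F" "F \<subseteq> \<Xi>" for F
    using that
  proof (induction F rule: finite_induct)
    case empty
    have "(\<lambda>_. 0) \<in> amplitude_space" by (simp add: amplitude_space_def)
    then show ?case using linear_functional_scale[OF f, of "\<lambda>_. 0" 0] by simp
  next
    case (insert x F)
    have k: "ket x \<in> amplitude_space" and F: "(\<lambda>\<alpha>. \<Sum>\<beta>\<in>F. s \<beta> * ket \<beta> \<alpha>) \<in> amplitude_space"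
      using insert.prems by (auto simp: amplitude_space_def ket_def intro!: sum.neutral)
    have "f (\<lambda>\<alpha>. s x * ket x \<alpha> + 1 * (\<Sum>\<beta>\<in>F. s \<beta> * ket \<beta> \<alpha>)) = s x * f (ket x) + 1 * f (\<lambda>\<alpha>. \<Sum>\<beta>\<in>F. s \<beta> * ket \<beta> \<alpha>)"
      by (rule f[unfolded linear_functional_def, rule_format, OF k F])
    then show ?case using insert by simp
  qed
  have "s = (\<lambda>\<alpha>. \<Sum>\<beta>\<in>\<Xi>. s \<beta> * ket \<beta> \<alpha>)"
  proof
    fix \<alpha>
    have "(\<Sum>\<beta>\<in>\<Xi>. s \<beta> * ket \<beta> \<alpha>) = (\<Sum>\<beta>\<in>\<Xi>. if \<alpha> = \<beta> then s \<alpha> else 0)"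
      by (intro sum.cong refl) (simp add: ket_def)
    then show "s \<alpha> = (\<Sum>\<beta>\<in>\<Xi>. s \<beta> * ket \<beta> \<alpha>)"
      using s by (auto simp: finite_\<Xi> amplitude_space_def)
  qed
  then show ?thesis using *[OF finite_\<Xi> order_refl] by simp
qed

text \<open>
  The central computation. At a zero, \<open>H_sim t \<Phi>0\<close> consists of a multiple of \<open>\<Phi>0\<close>, with the energy as
  factor, and of excitations \<open>\<Phi> \<gamma>\<close> outside \<open>\<Xi>\<close>. Applying \<open>X \<alpha>\<close> to the latter is the same as applying
  \<open>X \<gamma>\<close> to \<open>\<Phi> \<alpha>\<close>, and this is the correction that turns \<open>H_sim\<close> into \<open>H_hat\<close>.
\<close>

lemma cc_derivative_at_zero:
  assumes zero: "cc_zero t" and \<alpha>: "\<alpha> \<in> \<Xi>" and \<beta>: "\<beta> \<in> \<Xi>"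
  shows "cc_derivative t (ket \<alpha>) (ket \<beta>) =
    ip (H_hat t (\<Phi> \<alpha>)) (\<Phi> \<beta>) - (if \<alpha> = \<beta> then cc_energy t else 0)"
proof -
  let ?r = "{1..CARD('n)}"
  let ?\<Xi>c = "multiindices - {?r} - \<Xi>"
  let ?c = "\<lambda>\<gamma>. ip (H_sim t \<Phi>0) (\<Phi> \<gamma>)"
  have \<alpha>M: "\<alpha> \<in> multiindices" and \<beta>M: "\<beta> \<in> multiindices" using \<alpha> \<beta> \<Xi>_subset by auto
  have z: "?c \<gamma> = 0" if "\<gamma> \<in> \<Xi>" for \<gamma>
    using zero that ket_in_amplitude_space[OF that] cc_map_ket[OF that, of t] by (simp add: cc_zero_def)
  have E: "?c ?r = cc_energy t" by (simp only: cc_energy_def \<Phi>_ref)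
  have split: "(\<Sum>\<gamma>\<in>multiindices. ?c \<gamma> * g \<gamma>) = cc_energy t * g ?r + (\<Sum>\<gamma>\<in>?\<Xi>c. ?c \<gamma> * g \<gamma>)" for g
  proof -
    have "(\<Sum>\<gamma>\<in>multiindices. ?c \<gamma> * g \<gamma>) = ?c ?r * g ?r + (\<Sum>\<gamma>\<in>multiindices - {?r}. ?c \<gamma> * g \<gamma>)"
      by (rule sum.remove[OF finite_multiindices ref_in_multiindices])
    also have "(\<Sum>\<gamma>\<in>multiindices - {?r}. ?c \<gamma> * g \<gamma>) = (\<Sum>\<gamma>\<in>?\<Xi>c. ?c \<gamma> * g \<gamma>)"
      by (rule sum.mono_neutral_right) (auto simp: finite_multiindices z)
    finally show ?thesis by (simp only: E)
  qed
  have "X \<alpha> (H_sim t \<Phi>0) = X \<alpha> (\<lambda>S. \<Sum>\<gamma>\<in>multiindices. ?c \<gamma> * \<Phi> \<gamma> S)"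
    using supported_expansion[OF supported_H_sim[of t \<Phi>0]] by simp
  also have "\<dots> = (\<lambda>S. \<Sum>\<gamma>\<in>multiindices. ?c \<gamma> * X \<gamma> (\<Phi> \<alpha>) S)"
    unfolding linear_op_sum[OF linear_op_X]
    by (intro ext sum.cong refl) (simp add: \<Phi>_def X_commute[OF \<alpha>M])
  also have "\<dots> = (\<lambda>S. cc_energy t * \<Phi> \<alpha> S + (\<Sum>\<gamma>\<in>?\<Xi>c. ?c \<gamma> * X \<gamma> (\<Phi> \<alpha>) S))"
    by (simp only: split X_ref)
  finally have "(\<lambda>S. H_sim t (X \<alpha> \<Phi>0) S - X \<alpha> (H_sim t \<Phi>0) S)
     = (\<lambda>S. H_hat t (\<Phi> \<alpha>) S - cc_energy t * \<Phi> \<alpha> S)"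
    by (simp add: H_hat_def \<Phi>_def fun_eq_iff)
  then have "cc_derivative t (ket \<alpha>) (ket \<beta>) = ip (H_hat t (\<Phi> \<alpha>)) (\<Phi> \<beta>) - cc_energy t * ip (\<Phi> \<alpha>) (\<Phi> \<beta>)"
    unfolding cc_derivative_def cluster_ket[OF \<alpha>] cluster_ket[OF \<beta>]
    by (simp only: ip_diff_left ip_scale_left \<Phi>_def[symmetric])
  then show ?thesis by (simp add: ip_\<Phi>_\<Phi>[OF \<alpha>M \<beta>M])
qed

text \<open>
  The projection of \<open>T \<psi>\<close> to the cluster states has an explicit expansion, since the \<open>\<Phi> \<alpha>\<close> with
  \<open>\<alpha> \<in> \<Xi>\<close> are orthonormal; this also gives the uniqueness that the definite description needs.
\<close>

lemma ip_compression:
  assumes "\<beta> \<in> \<Xi>"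
  shows "ip (compression T \<psi>) (\<Phi> \<beta>) = ip (T \<psi>) (\<Phi> \<beta>)"
proof -
  have coeff: "ip (cluster s \<Phi>0) (\<Phi> \<beta>) = s \<beta>" if "\<beta> \<in> \<Xi>" for s \<beta>
  proof -
    have "ip (cluster s \<Phi>0) (\<Phi> \<beta>) = (\<Sum>\<alpha>\<in>\<Xi>. s \<alpha> * ip (\<Phi> \<alpha>) (\<Phi> \<beta>))"
      unfolding cluster_\<Phi>0 by (rule ip_sum_left)
    also have "\<dots> = (\<Sum>\<alpha>\<in>\<Xi>. if \<alpha> = \<beta> then s \<beta> else 0)"
      using that \<Xi>_subset by (intro sum.cong refl) (subst ip_\<Phi>_\<Phi>; auto)
    finally show ?thesis using that by (simp add: finite_\<Xi>)
  qed
  have \<Phi>_state: "\<Phi> \<beta> \<in> cluster_states" if "\<beta> \<in> \<Xi>" for \<beta>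
    unfolding cluster_states_def using ket_in_amplitude_space[OF that] cluster_ket[OF that, of \<Phi>0]
    by (auto simp: \<Phi>_def intro!: exI[of _ "ket \<beta>"])
  define x where "x = (\<lambda>\<alpha>. if \<alpha> \<in> \<Xi> then ip (T \<psi>) (\<Phi> \<alpha>) else 0)"
  have x: "x \<in> amplitude_space" by (simp add: x_def amplitude_space_def)
  have "compression T \<psi> = cluster x \<Phi>0"
    unfolding compression_def
  proof (rule the_equality)
    have "ip (cluster x \<Phi>0) (cluster s \<Phi>0) = ip (T \<psi>) (cluster s \<Phi>0)" for s
      unfolding ip_cluster_\<Phi>0[of _ s] by (intro sum.cong refl) (simp add: coeff x_def)
    then show "cluster x \<Phi>0 \<in> cluster_states \<and> (\<forall>\<psi>'\<in>cluster_states. ip (cluster x \<Phi>0) \<psi>' = ip (T \<psi>) \<psi>')"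
      using x by (auto simp: cluster_states_def)
    fix \<xi> assume \<xi>: "\<xi> \<in> cluster_states \<and> (\<forall>\<psi>'\<in>cluster_states. ip \<xi> \<psi>' = ip (T \<psi>) \<psi>')"
    then obtain s where s: "\<xi> = cluster s \<Phi>0" by (auto simp: cluster_states_def)
    have "s \<beta> = x \<beta>" if "\<beta> \<in> \<Xi>" for \<beta>
      using \<xi> \<Phi>_state[OF that] coeff[OF that, of s] that by (simp add: x_def s)
    then show "\<xi> = cluster x \<Phi>0" unfolding s cluster_def by (intro ext sum.cong refl) simp
  qed
  then show ?thesis using coeff[OF assms, of x] assms by (simp add: x_def)
qed

lemma continuous_on_cluster:
  assumes "\<And>\<alpha>. continuous_on D (\<lambda>x. t x \<alpha>)" "\<And>S. continuous_on D (\<lambda>x. c x S)"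
  shows "continuous_on D (\<lambda>x. cluster (t x) (c x) S)"
  unfolding cluster_def X_eq_hops
  by (intro continuous_on_sum continuous_on_mult assms continuous_on_hops)

lemma continuous_on_exp_cluster:
  assumes "\<And>\<alpha>. continuous_on D (\<lambda>x. t x \<alpha>)" "\<And>S. continuous_on D (\<lambda>x. c x S)"
  shows "continuous_on D (\<lambda>x. op_exp (cluster (t x)) (c x) S)"
proof -
  have "continuous_on D (\<lambda>x. (cluster (t x) ^^ k) (c x) S)" for k S
    by (induction k arbitrary: S) (simp_all add: assms continuous_on_cluster)
  then show ?thesis
    unfolding op_exp_nilpotent[OF nilpotent_cluster order_refl]
    by (intro continuous_on_sum continuous_on_divide continuous_on_const) auto
qed

lemma continuous_on_H_sim:
  assumes t: "\<And>\<alpha>. continuous_on D (\<lambda>x. t x \<alpha>)"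
  shows "continuous_on D (\<lambda>x. H_sim (t x) c S)"
proof -
  have "continuous_on D (\<lambda>x. H_op (op_exp (cluster (t x)) c) S)" for S
    unfolding H_op_def
    by (cases "S \<in> multiindices")
      (simp_all, intro continuous_on_sum continuous_on_mult_right continuous_on_exp_cluster t continuous_on_const)
  then show ?thesis
    unfolding H_sim_eq by (intro continuous_on_exp_cluster continuous_on_minus t)
qed

end

section \<open>Zeros of the coupled cluster mapping in coordinates\<close>

context coupled_cluster begin

context
  fixes e :: "nat \<Rightarrow> nat set" and t :: amplitudes
  assumes e: "bij_betw e {..<card \<Xi>} \<Xi>" and t: "t \<in> amplitude_space" and zero: "cc_zero t"
begin

lemma e_in: "i < card \<Xi> \<Longrightarrow> e i \<in> \<Xi>"
  using e by (auto simp: bij_betw_def)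

lemma e_eq_iff: "i < card \<Xi> \<Longrightarrow> j < card \<Xi> \<Longrightarrow> e i = e j \<longleftrightarrow> i = j"
  using e by (auto simp: bij_betw_def inj_on_def)

lemma sum_\<Xi>: "(\<Sum>\<alpha>\<in>\<Xi>. f \<alpha>) = (\<Sum>i<card \<Xi>. f (e i))"
  using sum.reindex_bij_betw[OF e, of f] by simp

lemma amplitudes_of_in: "amplitudes_of e x \<in> amplitude_space"
  using e_in by (auto simp: amplitudes_of_def amplitude_space_def ket_def intro!: sum.neutral)

lemma amplitudes_of_nth:
  assumes "i < card \<Xi>" shows "amplitudes_of e x (e i) = x i"
proof -
  have "amplitudes_of e x (e i) = (\<Sum>j<card \<Xi>. if j = i then x i else 0)"
    unfolding amplitudes_of_def by (intro sum.cong refl) (auto simp: ket_def e_eq_iff assms)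
  then show ?thesis using assms by simp
qed

lemma amplitude_eqI:
  assumes "s \<in> amplitude_space" "u \<in> amplitude_space" "\<And>i. i < card \<Xi> \<Longrightarrow> s (e i) = u (e i)"
  shows "s = u"
proof
  fix \<alpha>
  show "s \<alpha> = u \<alpha>"
  proof (cases "\<alpha> \<in> \<Xi>")
    case True
    then obtain i where "i < card \<Xi>" "\<alpha> = e i" using e by (auto simp: bij_betw_def)
    then show ?thesis using assms(3) by simp
  qed (use assms(1,2) in \<open>simp add: amplitude_space_def\<close>)
qed

lemma amplitudes_of_coords_of: "s \<in> amplitude_space \<Longrightarrow> amplitudes_of e (coords_of e s) = s"
  by (intro amplitude_eqI amplitudes_of_in) (auto simp: amplitudes_of_nth coords_of_def)

lemma amplitudes_of_add:
  "amplitudes_of e (\<lambda>j. coords_of e t j + h j) = (\<lambda>\<alpha>. t \<alpha> + amplitudes_of e h \<alpha>)"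
proof -
  have "amplitudes_of e (\<lambda>j. coords_of e t j + h j) = (\<lambda>\<alpha>. amplitudes_of e (coords_of e t) \<alpha> + amplitudes_of e h \<alpha>)"
    by (simp add: amplitudes_of_def fun_eq_iff algebra_simps sum.distrib)
  then show ?thesis by (simp add: amplitudes_of_coords_of[OF t])
qed

lemma L2_set_amplitudes_of: "L2_set (amplitudes_of e h) \<Xi> = L2_set h {..<card \<Xi>}"
  unfolding L2_set_def sum_\<Xi> by (intro arg_cong[of _ _ sqrt] sum.cong refl) (simp add: amplitudes_of_nth)

definition H_hat_matrix :: "real mat" where
  "H_hat_matrix = Matrix.mat (card \<Xi>) (card \<Xi>) (\<lambda>(i, j). ip (H_hat t (\<Phi> (e j))) (\<Phi> (e i)))"

text \<open>
  The name is justified by \<open>Jacobian_nth\<close>: at a zero these are the partial derivatives of the CC mapping.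
\<close>

definition Jacobian :: "real mat" where
  "Jacobian = H_hat_matrix - cc_energy t \<cdot>\<^sub>m 1\<^sub>m (card \<Xi>)"

lemma H_hat_matrix_carrier: "H_hat_matrix \<in> carrier_mat (card \<Xi>) (card \<Xi>)"
  by (simp add: H_hat_matrix_def)

lemma Jacobian_carrier: "Jacobian \<in> carrier_mat (card \<Xi>) (card \<Xi>)"
  unfolding Jacobian_def by (intro minus_carrier_mat smult_carrier_mat one_carrier_mat)

lemma compression_matrix_eq: "compression_matrix e (H_hat t) = map_mat complex_of_real H_hat_matrix"
  by (rule eq_matI) (auto simp: compression_matrix_def H_hat_matrix_def ip_compression e_in)

lemma Jacobian_nth:
  assumes "i < card \<Xi>" "j < card \<Xi>"
  shows "Jacobian $$ (i, j) = cc_derivative t (ket (e j)) (ket (e i))"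
  using assms e_eq_iff[of j i]
  by (auto simp: Jacobian_def H_hat_matrix_def cc_derivative_at_zero[OF zero] e_in)

lemma cc_derivative_coords:
  assumes "i < card \<Xi>"
  shows "cc_derivative t h (ket (e i)) = lin_map Jacobian (\<lambda>j. h (e j)) i"
proof -
  have "cc_derivative t h (ket (e i)) = (\<Sum>j<card \<Xi>. h (e j) * cc_derivative t (ket (e j)) (ket (e i)))"
    by (subst cc_derivative_expand_left) (rule sum_\<Xi>)
  also have "\<dots> = (\<Sum>j<card \<Xi>. Jacobian $$ (i, j) * h (e j))"
    by (intro sum.cong refl) (simp add: Jacobian_nth assms)
  finally show ?thesis using Jacobian_carrier assms by (simp add: lin_map_def)
qed

lemma lin_map_Jacobian_cong:
  assumes "\<And>j. j < card \<Xi> \<Longrightarrow> x j = y j"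
  shows "lin_map Jacobian x = lin_map Jacobian y"
  using assms Jacobian_carrier by (auto simp: lin_map_def fun_eq_iff)

text \<open>
  The derivative is unique, so that it may be taken to be \<open>cc_derivative t\<close>. It acts on coordinates by the
  Jacobian matrix, and a functional is determined by its values on the coordinate basis.
\<close>

lemma cc_nondegenerate_iff_det: "cc_nondegenerate t \<longleftrightarrow> det Jacobian \<noteq> 0"
proof
  assume "cc_nondegenerate t"
  then obtain L where L: "cc_has_derivative t L"
    "\<And>f. linear_functional f \<Longrightarrow> \<exists>!h. h \<in> amplitude_space \<and> (\<forall>s\<in>amplitude_space. L h s = f s)"
    unfolding cc_nondegenerate_def by blast
  show "det Jacobian \<noteq> 0"
  proof
    assume "det Jacobian = 0"
    then obtain v where v: "v \<in> carrier_vec (card \<Xi>)" "v \<noteq> 0\<^sub>v (card \<Xi>)" "Jacobian *\<^sub>v v = 0\<^sub>v (card \<Xi>)"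
      using det_0_iff_vec_prod_zero[OF Jacobian_carrier] by blast
    define x where "x i = (if i < card \<Xi> then v $ i else 0)" for i
    have vx: "v = Matrix.vec (card \<Xi>) x" using v(1) by (intro eq_vecI) (auto simp: x_def)
    have ker: "lin_map Jacobian x i = 0" if "i < card \<Xi>" for i
      using v(3) that unfolding vx lin_map_mult_mat_vec[OF Jacobian_carrier] by (metis index_vec index_zero_vec(1))
    let ?h = "amplitudes_of e x"
    have "L ?h s = 0" if s: "s \<in> amplitude_space" for s
    proof -
      have "L ?h s = cc_derivative t ?h s"
        by (rule cc_derivative_unique[OF L(1) cc_has_derivative_cc_derivative amplitudes_of_in s])
      also have "\<dots> = (\<Sum>i<card \<Xi>. s (e i) * lin_map Jacobian (\<lambda>j. ?h (e j)) i)"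
        by (subst cc_derivative_expand_right) (simp add: sum_\<Xi> cc_derivative_coords)
      also have "lin_map Jacobian (\<lambda>j. ?h (e j)) = lin_map Jacobian x"
        by (rule lin_map_Jacobian_cong) (simp add: amplitudes_of_nth)
      finally show ?thesis by (simp add: ker)
    qed
    moreover have "L (\<lambda>_. 0) s = 0" if "s \<in> amplitude_space" for s
      using L(1) that linear_functional_scale[of "\<lambda>h. L h s" "\<lambda>_. 0" 0]
      by (auto simp: cc_has_derivative_def amplitude_space_def)
    moreover have "linear_functional (\<lambda>_. 0)" by (simp add: linear_functional_def)
    moreover have "(\<lambda>_. 0) \<in> amplitude_space" by (simp add: amplitude_space_def)
    ultimately have "?h = (\<lambda>_. 0)" using L(2)[of "\<lambda>_. 0"] amplitudes_of_in by blast
    then have "x i = 0" if "i < card \<Xi>" for i using amplitudes_of_nth[OF that, of x] by simp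
    then have "v = 0\<^sub>v (card \<Xi>)" unfolding vx by (intro eq_vecI) auto
    then show False using v(2) by simp
  qed
next
  assume det: "det Jacobian \<noteq> 0"
  obtain E where E: "E \<in> carrier_mat (card \<Xi>) (card \<Xi>)" "Jacobian * E = 1\<^sub>m (card \<Xi>)"
    using det_non_zero_imp_unit[OF Jacobian_carrier det, of "()"] by (auto simp: Units_def ring_mat_def)
  have "\<exists>!h. h \<in> amplitude_space \<and> (\<forall>s\<in>amplitude_space. cc_derivative t h s = f s)"
    if f: "linear_functional f" for f
  proof
    let ?b = "\<lambda>i. f (ket (e i))"
    let ?h = "amplitudes_of e (lin_map E ?b)"
    have "cc_derivative t ?h s = f s" if s: "s \<in> amplitude_space" for s
    proof -
      have "cc_derivative t ?h (ket (e i)) = ?b i" if i: "i < card \<Xi>" for i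
      proof -
        have "cc_derivative t ?h (ket (e i)) = lin_map Jacobian (lin_map E ?b) i"
          unfolding cc_derivative_coords[OF i]
          by (rule fun_cong[OF lin_map_Jacobian_cong]) (simp add: amplitudes_of_nth)
        also have "\<dots> = lin_map (1\<^sub>m (card \<Xi>)) ?b i"
          by (simp add: lin_map_mult[OF Jacobian_carrier E(1), symmetric] E(2))
        also have "\<dots> = ?b i" using i by (rule lin_map_one)
        finally show ?thesis .
      qed
      then have "(\<Sum>\<beta>\<in>\<Xi>. s \<beta> * cc_derivative t ?h (ket \<beta>)) = (\<Sum>\<beta>\<in>\<Xi>. s \<beta> * f (ket \<beta>))"
        unfolding sum_\<Xi> by (intro sum.cong refl) simp
      then show ?thesis
        using linear_functional_eq_sum[OF f s] cc_derivative_expand_right[of t ?h s] by simp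
    qed
    then show "?h \<in> amplitude_space \<and> (\<forall>s\<in>amplitude_space. cc_derivative t ?h s = f s)"
      using amplitudes_of_in by blast
    then have h: "cc_derivative t ?h (ket (e i)) = ?b i" if "i < card \<Xi>" for i
      using ket_in_amplitude_space[OF e_in[OF that]] by blast
    fix k assume k: "k \<in> amplitude_space \<and> (\<forall>s\<in>amplitude_space. cc_derivative t k s = f s)"
    show "k = ?h"
    proof (rule ccontr)
      assume "k \<noteq> ?h"
      then obtain j where j: "j < card \<Xi>" "k (e j) \<noteq> ?h (e j)"
        using amplitude_eqI[of k ?h] k amplitudes_of_in by blast
      have "\<exists>i<card \<Xi>. lin_map Jacobian (\<lambda>j. k (e j) - ?h (e j)) i \<noteq> 0"
        by (rule lin_map_nonzero[OF Jacobian_carrier det]) (use j in auto)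
      then obtain i where i: "i < card \<Xi>" "lin_map Jacobian (\<lambda>j. k (e j) - ?h (e j)) i \<noteq> 0" by blast
      have "lin_map Jacobian (\<lambda>j. k (e j) - ?h (e j)) i = cc_derivative t k (ket (e i)) - cc_derivative t ?h (ket (e i))"
        unfolding cc_derivative_coords[OF i(1)] by (simp add: lin_map_def right_diff_distrib sum_subtractf)
      then show False using i h[OF i(1)] k ket_in_amplitude_space[OF e_in[OF i(1)]] by simp
    qed
  qed
  then show "cc_nondegenerate t"
    unfolding cc_nondegenerate_def using cc_has_derivative_cc_derivative by blast
qed

text \<open>
  The constant term vanishes at a zero, and the basis functionals have unit norm.
\<close>

lemma cc_map_coords_linearization:
  "\<exists>C\<ge>0. \<forall>h i. L2_set h {..<card \<Xi>} \<le> 1 / (real (card \<Xi>) + 1) \<longrightarrow> i < card \<Xi> \<longrightarrow>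
     \<bar>cc_map_coords e (\<lambda>j. coords_of e t j + h j) i - lin_map Jacobian h i\<bar> \<le> C * (L2_set h {..<card \<Xi>})\<^sup>2"
proof -
  obtain C where C: "C \<ge> 0" "\<And>h s. card \<Xi> * L2_set h \<Xi> \<le> 1 \<Longrightarrow>
     \<bar>cc_map (\<lambda>\<alpha>. t \<alpha> + h \<alpha>) s - cc_map t s - cc_derivative t h s\<bar> \<le> C * (L2_set h \<Xi>)\<^sup>2 * L2_set s \<Xi>"
    using cc_map_linearization[of t] by blast
  have "\<bar>cc_map_coords e (\<lambda>j. coords_of e t j + h j) i - lin_map Jacobian h i\<bar> \<le> C * (L2_set h {..<card \<Xi>})\<^sup>2"
    if h: "L2_set h {..<card \<Xi>} \<le> 1 / (real (card \<Xi>) + 1)" and i: "i < card \<Xi>" for h i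
  proof -
    let ?h = "amplitudes_of e h" and ?s = "ket (e i)"
    have "card \<Xi> * L2_set h {..<card \<Xi>} \<le> card \<Xi> * (1 / (real (card \<Xi>) + 1))"
      using h by (intro mult_left_mono) auto
    also have "\<dots> \<le> 1" by simp
    finally have "card \<Xi> * L2_set ?h \<Xi> \<le> 1" by (simp add: L2_set_amplitudes_of)
    from C(2)[OF this, of ?s]
    have "\<bar>cc_map (\<lambda>\<alpha>. t \<alpha> + ?h \<alpha>) ?s - cc_map t ?s - cc_derivative t ?h ?s\<bar>
       \<le> C * (L2_set h {..<card \<Xi>})\<^sup>2 * L2_set ?s \<Xi>" by (simp add: L2_set_amplitudes_of)
    moreover have "cc_map t ?s = 0"
      using zero ket_in_amplitude_space[OF e_in[OF i]] by (simp add: cc_zero_def)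
    moreover have "L2_set ?s \<Xi> = 1"
    proof -
      have "(\<Sum>\<alpha>\<in>\<Xi>. (?s \<alpha>)\<^sup>2) = (\<Sum>\<alpha>\<in>\<Xi>. if \<alpha> = e i then 1 else 0)"
        by (intro sum.cong refl) (simp add: ket_def)
      then show ?thesis using e_in[OF i] by (simp add: L2_set_def finite_\<Xi>)
    qed
    moreover have "cc_derivative t ?h ?s = lin_map Jacobian h i"
      unfolding cc_derivative_coords[OF i]
      by (rule fun_cong[OF lin_map_Jacobian_cong]) (simp add: amplitudes_of_nth)
    ultimately show ?thesis using i by (simp add: cc_map_coords_def amplitudes_of_add)
  qed
  then show ?thesis using C(1) by blast
qed

lemma continuous_on_cc_map_coords: "continuous_on UNIV (\<lambda>x. cc_map_coords e x i)"
proof (cases "i < card \<Xi>")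
  case True
  have "continuous_on UNIV (\<lambda>x. amplitudes_of e x \<alpha>)" for \<alpha>
    unfolding amplitudes_of_def by (intro continuous_on_sum continuous_on_mult_right continuous_on_product_coordinates)
  then have "continuous_on UNIV (\<lambda>x. H_sim (amplitudes_of e x) \<Phi>0 (e i) * \<Phi> (e i) (e i))"
    by (intro continuous_on_mult_right continuous_on_H_sim)
  moreover have "cc_map_coords e x i = H_sim (amplitudes_of e x) \<Phi>0 (e i) * \<Phi> (e i) (e i)" for x
    using True e_in[OF True] \<Xi>_subset by (auto simp: cc_map_coords_def cc_map_ket ip_\<Phi>)
  ultimately show ?thesis by simp
qed (simp add: cc_map_coords_def)

text \<open>
  Coordinates identify the CC mapping with a continuous map of \<open>n\<close>-dimensional space whose linearization
  at \<open>t\<close> is the Jacobian matrix.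
\<close>

lemma
  assumes det: "det Jacobian \<noteq> 0"
  shows isolated_if_det: "cc_isolated_zero t"
    and index_if_det: "real_of_int (cc_index e t) = sgn (det Jacobian)"
proof -
  obtain C where C: "C \<ge> 0" "\<And>h i. L2_set h {..<card \<Xi>} \<le> 1 / (real (card \<Xi>) + 1) \<Longrightarrow> i < card \<Xi> \<Longrightarrow>
     \<bar>cc_map_coords e (\<lambda>j. coords_of e t j + h j) i - lin_map Jacobian h i\<bar> \<le> C * (L2_set h {..<card \<Xi>})\<^sup>2"
    using cc_map_coords_linearization by blast
  have \<rho>: "1 / (real (card \<Xi>) + 1) > 0" by simp
  have z: "cc_map_coords e x i = 0" if "i \<ge> card \<Xi>" for x i
    using that by (simp add: cc_map_coords_def)
  show "real_of_int (cc_index e t) = sgn (det Jacobian)"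
    unfolding cc_index_def
    by (rule nondegenerate_zero_index[OF Jacobian_carrier det C(1) \<rho> continuous_on_cc_map_coords z C(2)])
  have "\<exists>r0>0. \<forall>h. (\<forall>i\<ge>card \<Xi>. h i = 0) \<longrightarrow> 0 < L2_set h {..<card \<Xi>} \<longrightarrow>
     L2_set h {..<card \<Xi>} < r0 \<longrightarrow> (\<exists>i<card \<Xi>. cc_map_coords e (\<lambda>j. coords_of e t j + h j) i \<noteq> 0)"
    by (rule nondegenerate_zero_isolated[OF Jacobian_carrier det C(1) \<rho> continuous_on_cc_map_coords z C(2)])
  then obtain r0 where r0: "r0 > 0" "\<And>h. (\<forall>i\<ge>card \<Xi>. h i = 0) \<Longrightarrow> 0 < L2_set h {..<card \<Xi>} \<Longrightarrow>
     L2_set h {..<card \<Xi>} < r0 \<Longrightarrow> \<exists>i<card \<Xi>. cc_map_coords e (\<lambda>j. coords_of e t j + h j) i \<noteq> 0"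
    by blast
  have "u = t" if u: "u \<in> amplitude_space" "L2_set (\<lambda>\<alpha>. u \<alpha> - t \<alpha>) \<Xi> < r0" "cc_zero u" for u
  proof (rule ccontr)
    assume "u \<noteq> t"
    then obtain j where j: "j < card \<Xi>" "u (e j) \<noteq> t (e j)"
      using amplitude_eqI[OF u(1) t] by blast
    let ?d = "\<lambda>\<alpha>. u \<alpha> - t \<alpha>"
    let ?h = "coords_of e ?d"
    have d: "amplitudes_of e ?h = ?d"
      using u(1) t by (intro amplitudes_of_coords_of) (simp add: amplitude_space_def)
    have "L2_set ?h {..<card \<Xi>} < r0" using u(2) L2_set_amplitudes_of[of ?h] by (simp add: d)
    moreover have "0 < L2_set ?h {..<card \<Xi>}"
    proof -
      have "0 < \<bar>?h j\<bar>" using j by (simp add: coords_of_def)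
      also have "\<dots> \<le> L2_set ?h {..<card \<Xi>}" using j by (intro abs_le_L2_set) auto
      finally show ?thesis .
    qed
    moreover have "\<forall>i\<ge>card \<Xi>. ?h i = 0" by (simp add: coords_of_def)
    ultimately obtain i where i: "i < card \<Xi>" "cc_map_coords e (\<lambda>j. coords_of e t j + ?h j) i \<noteq> 0"
      using r0(2) by blast
    then have "cc_map u (ket (e i)) \<noteq> 0"
      unfolding cc_map_coords_def amplitudes_of_add d by simp
    then show False using u(3) ket_in_amplitude_space[OF e_in[OF i(1)]] by (simp add: cc_zero_def)
  qed
  then show "cc_isolated_zero t"
    unfolding cc_isolated_zero_def using t zero r0(1) by blast
qed

lemma cc_zero_index:
  "(cc_nondegenerate t \<longleftrightarrow> complex_of_real (cc_energy t) \<notin> spectrum (compression_matrix e (H_hat t))) \<and>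
   (cc_nondegenerate t \<longrightarrow> cc_isolated_zero t \<and>
      cc_index e t = (-1) ^ count_real_eigenvalues_below (compression_matrix e (H_hat t)) (cc_energy t))"
proof (intro conjI impI)
  show "cc_nondegenerate t \<longleftrightarrow> complex_of_real (cc_energy t) \<notin> spectrum (compression_matrix e (H_hat t))"
    unfolding cc_nondegenerate_iff_det Jacobian_def compression_matrix_eq
    by (simp add: det_minus_eq_0_iff_spectrum[OF H_hat_matrix_carrier])
  assume "cc_nondegenerate t"
  then have det: "det Jacobian \<noteq> 0" by (simp add: cc_nondegenerate_iff_det)
  then show "cc_isolated_zero t" by (rule isolated_if_det)
  have "real_of_int (cc_index e t) = real_of_int ((-1) ^ count_real_eigenvalues_below (compression_matrix e (H_hat t)) (cc_energy t))"
    using index_if_det[OF det] det sgn_det_minus_eq_parity_of_real_eigenvalues_below[OF H_hat_matrix_carrier]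
    by (simp add: Jacobian_def compression_matrix_eq)
  then show "cc_index e t = (-1) ^ count_real_eigenvalues_below (compression_matrix e (H_hat t)) (cc_energy t)"
    by (simp only: of_int_eq_iff)
qed

end

end

theorem theorem4p13:
  fixes K :: nat
    and \<phi> :: "nat \<Rightarrow> real^3 \<Rightarrow> real"
    and V w :: "real^3 \<Rightarrow> real"
    and \<Xi> :: "nat set set"
    and e :: "nat \<Rightarrow> nat set"
    and t :: amplitudes
  assumes "coupled_cluster TYPE('n::{finite,linorder}) K \<phi> V w \<Xi>"
    and "bij_betw e {..<card \<Xi>} \<Xi>"
    and "t \<in> coupled_cluster.amplitude_space \<Xi>"
    and "coupled_cluster.cc_zero TYPE('n) K \<phi> V w \<Xi> t"
  shows "(coupled_cluster.cc_nondegenerate TYPE('n) K \<phi> V w \<Xi> t \<longleftrightarrow>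
            complex_of_real (coupled_cluster.cc_energy TYPE('n) K \<phi> V w \<Xi> t)
              \<notin> spectrum (coupled_cluster.compression_matrix TYPE('n) K \<phi> \<Xi> e
                   (coupled_cluster.H_hat TYPE('n) K \<phi> V w \<Xi> t)))
       \<and> (coupled_cluster.cc_nondegenerate TYPE('n) K \<phi> V w \<Xi> t \<longrightarrow>
            coupled_cluster.cc_isolated_zero TYPE('n) K \<phi> V w \<Xi> t \<and>
            coupled_cluster.cc_index TYPE('n) K \<phi> V w \<Xi> e t =
              (-1) ^ count_real_eigenvalues_below
                (coupled_cluster.compression_matrix TYPE('n) K \<phi> \<Xi> e
                   (coupled_cluster.H_hat TYPE('n) K \<phi> V w \<Xi> t))
                (coupled_cluster.cc_energy TYPE('n) K \<phi> V w \<Xi> t))"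
  using coupled_cluster.cc_zero_index[OF assms] .

end
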